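(* Let $t\in\mathbb{R}$ be fixed, let $\sigma(t,\cdot)\in\mathcal{S}'(\mathbb{R}^d)$, and let $E(t,\cdot)=\mathcal{F}^{-1}\sigma(t,\cdot)\in\mathcal{S}'(\mathbb{R}^d)$. The Wigner kernel of the Fourier multiplier $T_t=\sigma(t,D_x):\mathcal{S}(\mathbb{R}^d)\to\mathcal{S}'(\mathbb{R}^d)$, $T_tf=\mathcal{F}^{-1}(\sigma(t,\cdot)\widehat f)=E(t,\cdot)*f$, is given by $$k_W(x,\xi,y,\eta)=\delta(\xi-\eta)\,W(\sigma(t,\cdot))(\xi,y-x)=\delta(\xi-\eta)\,W(E(t,\cdot))(x-y,\xi).$$
   Context: Fourier transform: $\widehat f(\xi)=\mathcal{F}f(\xi)=\int_{\mathbb{R}^d}f(x)e^{-2\pi i x\cdot\xi}\,dx$. Cross-Wigner distribution: $W(f,g)(x,\xi)=\int_{\mathbb{R}^d}f(x+\frac y2)\overline{g(x-\frac y2)}e^{-2\pi i y\cdot\xi}\,dy$, extended to tempered distributions in the usual way, and $Wf=W(f,f)$. The Wigner kernel of a continuous linear operator $T:\mathcal{S}(\mathbb{R}^d)\to\mathcal{S}'(\mathbb{R}^d)$ is the unique $k_W\in\mathcal{S}'(\mathbb{R}^{4d})$ such that $W(Tf,Tg)(z)=\int_{\mathbb{R}^{2d}}k_W(z,w)W(f,g)(w)\,dw$ for all $f,g\in\mathcal{S}(\mathbb{R}^d)$, the integral being understood in the distributional sense, with $z=(x,\xi)$, $w=(y,\eta)$. For $F\in\mathcal{S}'(\mathbb{R}^{2d})$,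 $\delta(\xi-\eta)F(x-y,\xi)$ denotes the tempered distribution $\Phi\mapsto\langle F(s,\xi),\int_{\mathbb{R}^d}\Phi(y+s,\xi,y,\xi)\,dy\rangle$ (bilinear pairing in $(s,\xi)$), $\Phi\in\mathcal{S}(\mathbb{R}^{4d})$. *)

theory Defs
  imports "HOL-Analysis.Analysis"
begin

section \<open>Schwartz functions\<close>

primrec partial_derivs :: "'a list \<Rightarrow> ('a::euclidean_space \<Rightarrow> complex) \<Rightarrow> 'a \<Rightarrow> complex" where
  "partial_derivs [] f = f"
| "partial_derivs (b # bs) f = (\<lambda>x. frechet_derivative (partial_derivs bs f) (at x) b)"

text \<open>Smoothness is expressed by total differentiability of all iterated partial derivatives.\<close>

definition schwartz :: "('a::euclidean_space \<Rightarrow> complex) set" where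
  "schwartz = {f. \<forall>bs \<in> lists Basis.
     (\<forall>x. partial_derivs bs f differentiable at x) \<and>
     (\<forall>k::nat. bounded (range (\<lambda>x. norm x ^ k * norm (partial_derivs bs f x))))}"

definition schwartz_seminorm :: "nat \<Rightarrow> 'a list \<Rightarrow> ('a::euclidean_space \<Rightarrow> complex) \<Rightarrow> real" where
  "schwartz_seminorm k bs f = (SUP x. norm x ^ k * norm (partial_derivs bs f x))"

definition schwartz_topology :: "('a::euclidean_space \<Rightarrow> complex) topology" where
  "schwartz_topology = topology_generated_by
     {{g \<in> schwartz. schwartz_seminorm k bs (\<lambda>x. g x - f x) < e} | f k bs e.
        f \<in> schwartz \<and> bs \<in> lists Basis \<and> e > 0}"

section \<open>Tempered distributions\<close>

text \<open>
  A distribution is represented by a functional on all functions, of which only the restriction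
  to \<^const>\<open>schwartz\<close> matters; accordingly, equality of distributions is \<open>distr_eq\<close>.
  The pairing with test functions is bilinear.
\<close>

type_synonym 'a distr = "('a \<Rightarrow> complex) \<Rightarrow> complex"

definition distr_eq :: "'a::euclidean_space distr \<Rightarrow> 'a distr \<Rightarrow> bool" where
  "distr_eq u v \<longleftrightarrow> (\<forall>\<phi> \<in> schwartz. u \<phi> = v \<phi>)"

definition linear_on_schwartz :: "'a::euclidean_space distr \<Rightarrow> bool" where
  "linear_on_schwartz u \<longleftrightarrow>
     (\<forall>\<phi> \<in> schwartz. \<forall>\<psi> \<in> schwartz. u (\<lambda>x. \<phi> x + \<psi> x) = u \<phi> + u \<psi>) \<and>
     (\<forall>c. \<forall>\<phi> \<in> schwartz. u (\<lambda>x. c * \<phi> x) = c * u \<phi>)"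

definition tempered :: "'a::euclidean_space distr \<Rightarrow> bool" where
  "tempered u \<longleftrightarrow> linear_on_schwartz u \<and> continuous_map schwartz_topology euclidean u"

text \<open>The weak-* topology on tempered distributions.\<close>

definition tempered_topology :: "'a::euclidean_space distr topology" where
  "tempered_topology = topology_generated_by
     {{u. tempered u \<and> u \<phi> \<in> U} | \<phi> U. \<phi> \<in> schwartz \<and> open U}"

definition continuous_linear_operator ::
    "(('a::euclidean_space \<Rightarrow> complex) \<Rightarrow> 'b::euclidean_space distr) \<Rightarrow> bool" where
  "continuous_linear_operator T \<longleftrightarrow>
     (\<forall>\<phi> \<in> schwartz. linear_on_schwartz (\<lambda>f. T f \<phi>)) \<and>
     continuous_map schwartz_topology tempered_topology T"

section \<open>Fourier transform, multipliers and convolution\<close>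

definition fourier :: "('a::euclidean_space \<Rightarrow> complex) \<Rightarrow> 'a \<Rightarrow> complex" where
  "fourier f \<xi> = (\<integral>x. f x * cis (- 2 * pi * (x \<bullet> \<xi>)) \<partial>lborel)"

definition inv_fourier :: "('a::euclidean_space \<Rightarrow> complex) \<Rightarrow> 'a \<Rightarrow> complex" where
  "inv_fourier f x = (\<integral>\<xi>. f \<xi> * cis (2 * pi * (x \<bullet> \<xi>)) \<partial>lborel)"

definition inv_fourier_distr :: "'a::euclidean_space distr \<Rightarrow> 'a distr" where
  "inv_fourier_distr u = (\<lambda>\<phi>. u (inv_fourier \<phi>))"

definition mult_distr :: "'a::euclidean_space distr \<Rightarrow> ('a \<Rightarrow> complex) \<Rightarrow> 'a distr" where
  "mult_distr u g = (\<lambda>\<phi>. u (\<lambda>x. g x * \<phi> x))"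

definition fourier_multiplier :: "'a::euclidean_space distr \<Rightarrow> ('a \<Rightarrow> complex) \<Rightarrow> 'a distr" where
  "fourier_multiplier \<sigma> f = inv_fourier_distr (mult_distr \<sigma> (fourier f))"

text \<open>The transpose of convolution with \<open>f\<close> is convolution with the reflection of \<open>f\<close>.\<close>

definition conv_distr :: "'a::euclidean_space distr \<Rightarrow> ('a \<Rightarrow> complex) \<Rightarrow> 'a distr" where
  "conv_distr u f = (\<lambda>\<phi>. u (\<lambda>y. \<integral>x. f (x - y) * \<phi> x \<partial>lborel))"

section \<open>Cross-Wigner distribution\<close>

definition wigner ::
    "('a::euclidean_space \<Rightarrow> complex) \<Rightarrow> ('a \<Rightarrow> complex) \<Rightarrow> 'a \<times> 'a \<Rightarrow> complex" where
  "wigner f g = (\<lambda>(x, \<xi>). \<integral>y. f (x + (1/2) *\<^sub>R y) * cnj (g (x - (1/2) *\<^sub>R y))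
      * cis (- 2 * pi * (y \<bullet> \<xi>)) \<partial>lborel)"

definition tensor_distr ::
    "'a::euclidean_space distr \<Rightarrow> 'b::euclidean_space distr \<Rightarrow> ('a \<times> 'b) distr" where
  "tensor_distr u v = (\<lambda>\<Phi>. u (\<lambda>p. v (\<lambda>q. \<Phi> (p, q))))"

definition cnj_distr :: "'a::euclidean_space distr \<Rightarrow> 'a distr" where
  "cnj_distr u = (\<lambda>\<phi>. cnj (u (\<lambda>x. cnj (\<phi> x))))"

text \<open>
  The extension of \<^const>\<open>wigner\<close> to distributions by duality: \<open>W(u, v)\<close> is obtained from
  \<open>u \<otimes> cnj v\<close> by the change of variables \<open>p = x + y/2\<close>, \<open>q = x - y/2\<close> (of Jacobian 1 in
  absolute value), followed by the Fourier transform from \<open>y\<close> to \<open>\<xi>\<close>. Both are moved to the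
  test function.
\<close>

definition pullback_midpoint_distr :: "('a::euclidean_space \<times> 'a) distr \<Rightarrow> ('a \<times> 'a) distr" where
  "pullback_midpoint_distr U = (\<lambda>\<Phi>. U (\<lambda>(p, q). \<Phi> ((1/2) *\<^sub>R (p + q), p - q)))"

definition fourier2_distr :: "('a::euclidean_space \<times> 'a) distr \<Rightarrow> ('a \<times> 'a) distr" where
  "fourier2_distr U = (\<lambda>\<Phi>. U (\<lambda>(x, y). fourier (\<lambda>\<xi>. \<Phi> (x, \<xi>)) y))"

definition wigner_distr :: "'a::euclidean_space distr \<Rightarrow> 'a distr \<Rightarrow> ('a \<times> 'a) distr" where
  "wigner_distr u v = fourier2_distr (pullback_midpoint_distr (tensor_distr u (cnj_distr v)))"

section \<open>Wigner kernels\<close>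

text \<open>
  The distribution \<open>\<integral> k(\<cdot>, w) h(w) dw\<close>, for a Schwartz function \<open>h\<close>.
\<close>

definition kernel_apply ::
    "('a::euclidean_space \<times> 'b::euclidean_space) distr \<Rightarrow> ('b \<Rightarrow> complex) \<Rightarrow> 'a distr" where
  "kernel_apply k h = (\<lambda>\<Phi>. k (\<lambda>(z, w). \<Phi> z * h w))"

definition wigner_kernel_identity ::
    "(('a::euclidean_space \<Rightarrow> complex) \<Rightarrow> 'a distr) \<Rightarrow> (('a \<times> 'a) \<times> ('a \<times> 'a)) distr \<Rightarrow> bool" where
  "wigner_kernel_identity T k \<longleftrightarrow>
     (\<forall>f \<in> schwartz. \<forall>g \<in> schwartz.
        distr_eq (wigner_distr (T f) (T g)) (kernel_apply k (wigner f g)))"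

definition is_wigner_kernel ::
    "(('a::euclidean_space \<Rightarrow> complex) \<Rightarrow> 'a distr) \<Rightarrow> (('a \<times> 'a) \<times> ('a \<times> 'a)) distr \<Rightarrow> bool" where
  "is_wigner_kernel T k \<longleftrightarrow>
     continuous_linear_operator T \<and>
     tempered k \<and> wigner_kernel_identity T k \<and>
     (\<forall>k'. tempered k' \<and> wigner_kernel_identity T k' \<longrightarrow> distr_eq k' k)"

text \<open>\<open>\<delta>(\<xi> - \<eta>) F(x - y, \<xi>)\<close>, as a distribution in \<open>((x, \<xi>), (y, \<eta>))\<close>.\<close>

definition delta_kernel ::
    "('a::euclidean_space \<times> 'a) distr \<Rightarrow> (('a \<times> 'a) \<times> ('a \<times> 'a)) distr" where
  "delta_kernel F = (\<lambda>\<Phi>. F (\<lambda>(s, \<xi>). \<integral>y. \<Phi> ((y + s, \<xi>), (y, \<xi>)) \<partial>lborel))"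

text \<open>
  \<open>G(\<xi>, -s)\<close>, as a distribution in \<open>(s, \<xi>)\<close>. Hence \<open>delta_kernel (swap_reflect_distr G)\<close> is
  \<open>\<delta>(\<xi> - \<eta>) G(\<xi>, y - x)\<close>.
\<close>

definition swap_reflect_distr :: "('a::euclidean_space \<times> 'a) distr \<Rightarrow> ('a \<times> 'a) distr" where
  "swap_reflect_distr G = (\<lambda>\<phi>. G (\<lambda>(\<xi>, r). \<phi> (- r, \<xi>)))"

end

(*
  Write mid* for the pullback along (p, q) |-> ((p + q)/2, p - q), F2 for the Fourier transform in
  the second variable and K for the inverse Fourier transform in the first variable composed with
  the Fourier transform in the second. Since E = F^-1 sigma,
    W(E) = (sigma (x) cnj sigma) o K o mid* o F2,
  and by Fourier inversion
    K (mid* (F2 Phi)) (a, b) = int Phi(x, (a+b)/2) e^(2 pi i x.(a-b)) dx.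
  The right-hand side is also mid* (F2 Phi') for Phi'(xi, r) = Phi(-r, xi), whence the equality of the
  two kernels; and it turns the convolution in x with W(f,g) that is hidden in delta(xi - eta) into
  multiplication by f^(a) cnj(g^(b)), which is what replacing sigma by sigma f^ and sigma g^ does.

  Identities between tempered distributions on a product space are checked on tensor products,
  which are total. The same density gives uniqueness of the kernel, because the Wigner functions
  W(f,g) are the images of tensor products under an isomorphism of the Schwartz space.
*)
theory Submission
  imports Defs "HOL-Probability.Sinc_Integral"
begin

section \<open>Partial derivatives\<close>

text \<open>Every identity is moved to test functions, so each map between test functions must be
  shown continuous on the Schwartz space, and most of the work goes there. Smoothness and continuity
  are proved by closure: a family of functions or operators with pointwise bounds that is stable
  under differentiation needs no formula for iterated derivatives. Integration is itself treated as
  a tempered distribution, so one result on applying a distribution in one variable yields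
  differentiation under the integral sign, and one commutation result yields Fubini.

  The recurring obstacle is that Fourier kernels and constants do not decay, so integrands fail to
  be Schwartz functions of all variables jointly. The Gaussian removes it: it decays, never vanishes
  and equals 1 at 0, so it can be inserted as a factor and later divided out, evaluated at 0, or
  sent to 1 in a limit. It also factorises over products, which is why narrow Gaussians give the
  density of tensor products.\<close>

definition partial_deriv :: "'a \<Rightarrow> ('a::euclidean_space \<Rightarrow> complex) \<Rightarrow> 'a \<Rightarrow> complex" where
  "partial_deriv b f = (\<lambda>x. frechet_derivative f (at x) b)"

lemma partial_derivs_Cons [simp]: "partial_derivs (b # bs) f = partial_deriv b (partial_derivs bs f)"
  by (simp add: partial_deriv_def)

declare partial_derivs.simps(2) [simp del]

lemma partial_derivs_append:
  "partial_derivs (as @ bs) f = partial_derivs as (partial_derivs bs f)"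
  by (induction as) auto

text \<open>The head of a list is the last derivative to be taken. Arguments that replace
  \<open>f\<close> by one of its derivatives need the new direction at the other end.\<close>

lemma partial_derivs_snoc:
  "partial_derivs (bs @ [b]) f = partial_derivs bs (partial_deriv b f)"
  by (simp add: partial_derivs_append partial_deriv_def)

lemma partial_deriv_eqI:
  assumes "(f has_derivative f') (at x)"
  shows "partial_deriv b f x = f' b"
  using frechet_derivative_at[OF assms] by (simp add: partial_deriv_def)

lemma differentiable_has_derivative:
  assumes "f differentiable at x"
  shows "(f has_derivative (\<lambda>h. partial_deriv h f x)) (at x)"
  using assms by (simp add: partial_deriv_def frechet_derivative_works)

lemma partial_deriv_linear:
  assumes "f differentiable at x"
  shows "linear (\<lambda>h. partial_deriv h f x)"
  using differentiable_has_derivative[OF assms] has_derivative_linear by blast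

lemma partial_deriv_sum_Basis:
  assumes "f differentiable at x"
  shows "partial_deriv h f x = (\<Sum>b\<in>Basis. (h \<bullet> b) *\<^sub>R partial_deriv b f x)"
proof -
  interpret linear "\<lambda>h. partial_deriv h f x" by (rule partial_deriv_linear[OF assms])
  have "partial_deriv h f x = partial_deriv (\<Sum>b\<in>Basis. (h \<bullet> b) *\<^sub>R b) f x"
    by (simp add: euclidean_representation)
  also have "\<dots> = (\<Sum>b\<in>Basis. (h \<bullet> b) *\<^sub>R partial_deriv b f x)"
    by (simp add: sum scaleR)
  finally show ?thesis .
qed

section \<open>Smooth functions\<close>

definition smooth_fun :: "('a::euclidean_space \<Rightarrow> complex) \<Rightarrow> bool" where
  "smooth_fun f \<longleftrightarrow> (\<forall>bs\<in>lists Basis. \<forall>x. partial_derivs bs f differentiable at x)"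

lemma smooth_funD:
  "smooth_fun f \<Longrightarrow> set bs \<subseteq> Basis \<Longrightarrow> partial_derivs bs f differentiable at x"
  by (auto simp: smooth_fun_def in_lists_conv_set)

lemma smooth_fun_differentiable: "smooth_fun f \<Longrightarrow> f differentiable at x"
  using smooth_funD[of f "[]"] by simp

lemma smooth_fun_partial_deriv:
  assumes "smooth_fun f" "b \<in> Basis"
  shows "smooth_fun (partial_deriv b f)"
  unfolding smooth_fun_def
  using smooth_funD[OF assms(1), of "_ @ [b]"] assms(2)
  by (auto simp: partial_derivs_snoc in_lists_conv_set subset_eq)

lemma partial_deriv_add:
  assumes "f differentiable at x" "g differentiable at x"
  shows "partial_deriv b (\<lambda>x. f x + g x) x = partial_deriv b f x + partial_deriv b g x"
  by (rule partial_deriv_eqI)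
    (intro has_derivative_add differentiable_has_derivative assms)

lemma partial_deriv_cmult:
  assumes "f differentiable at x"
  shows "partial_deriv b (\<lambda>x. c * f x) x = c * partial_deriv b f x"
  by (rule partial_deriv_eqI)
    (rule has_derivative_mult_right[OF differentiable_has_derivative[OF assms]])

lemma partial_deriv_mult:
  assumes "f differentiable at x" "g differentiable at x"
  shows "partial_deriv b (\<lambda>x. f x * g x) x = f x * partial_deriv b g x + partial_deriv b f x * g x"
  by (rule partial_deriv_eqI)
    (rule has_derivative_mult[OF differentiable_has_derivative[OF assms(1)]
        differentiable_has_derivative[OF assms(2)]])

lemma partial_deriv_cnj:
  assumes "f differentiable at x"
  shows "partial_deriv b (\<lambda>x. cnj (f x)) x = cnj (partial_deriv b f x)"
  by (rule partial_deriv_eqI)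
    (rule has_derivative_cnj[OF differentiable_has_derivative[OF assms]])

lemma differentiable_cnj: "f differentiable at x \<Longrightarrow> (\<lambda>x. cnj (f x)) differentiable at x"
  unfolding differentiable_def using has_derivative_cnj by blast

lemma partial_deriv_compose_linear:
  assumes "bounded_linear A" "f differentiable at (A x)"
  shows "partial_deriv b (\<lambda>x. f (A x)) x = partial_deriv (A b) f (A x)"
    and "(\<lambda>x. f (A x)) differentiable at x"
proof -
  have "((\<lambda>x. f (A x)) has_derivative (\<lambda>h. partial_deriv (A h) f (A x))) (at x)"
    using has_derivative_compose[OF bounded_linear_imp_has_derivative[OF assms(1)]
        differentiable_has_derivative[OF assms(2)]] .
  then show "partial_deriv b (\<lambda>x. f (A x)) x = partial_deriv (A b) f (A x)"
    "(\<lambda>x. f (A x)) differentiable at x"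
    by (auto intro: partial_deriv_eqI simp: differentiable_def)
qed

lemma partial_derivs_add:
  assumes "smooth_fun f" "smooth_fun g" "set bs \<subseteq> Basis"
  shows "partial_derivs bs (\<lambda>x. f x + g x) = (\<lambda>x. partial_derivs bs f x + partial_derivs bs g x)"
  using assms(3)
  by (induction bs)
    (auto simp: partial_deriv_add smooth_funD assms fun_eq_iff[of "partial_deriv _ _"])

lemma partial_derivs_cmult:
  assumes "smooth_fun f" "set bs \<subseteq> Basis"
  shows "partial_derivs bs (\<lambda>x. c * f x) = (\<lambda>x. c * partial_derivs bs f x)"
  using assms(2)
  by (induction bs)
    (auto simp: partial_deriv_cmult smooth_funD assms fun_eq_iff[of "partial_deriv _ _"])

lemma partial_derivs_cnj:
  assumes "smooth_fun f" "set bs \<subseteq> Basis"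
  shows "partial_derivs bs (\<lambda>x. cnj (f x)) = (\<lambda>x. cnj (partial_derivs bs f x))"
  using assms(2)
  by (induction bs)
    (auto simp: partial_deriv_cnj smooth_funD assms fun_eq_iff[of "partial_deriv _ _"])

lemma smooth_fun_add:
  assumes "smooth_fun f" "smooth_fun g"
  shows "smooth_fun (\<lambda>x. f x + g x)"
  using assms unfolding smooth_fun_def
  by (auto simp: partial_derivs_add[OF assms] in_lists_conv_set subset_eq)

lemma smooth_fun_cmult:
  assumes "smooth_fun f"
  shows "smooth_fun (\<lambda>x. c * f x)"
  using assms unfolding smooth_fun_def
  by (auto simp: partial_derivs_cmult[OF assms] in_lists_conv_set subset_eq)

lemma smooth_fun_cnj:
  assumes "smooth_fun f"
  shows "smooth_fun (\<lambda>x. cnj (f x))"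
  using assms unfolding smooth_fun_def
  by (auto simp: partial_derivs_cnj[OF assms] in_lists_conv_set subset_eq differentiable_cnj)

section \<open>Schwartz functions and their seminorms\<close>

lemma schwartz_iff:
  "f \<in> schwartz \<longleftrightarrow> smooth_fun f \<and>
     (\<forall>bs k. set bs \<subseteq> Basis \<longrightarrow> (\<exists>C. \<forall>x. norm x ^ k * norm (partial_derivs bs f x) \<le> C))"
proof -
  have "bounded (range (\<lambda>x. norm x ^ k * norm (partial_derivs bs f x))) \<longleftrightarrow>
    (\<exists>C. \<forall>x. norm x ^ k * norm (partial_derivs bs f x) \<le> C)" for k bs
    by (auto simp: bounded_iff)
  then show ?thesis
    unfolding schwartz_def smooth_fun_def by (auto simp: in_lists_conv_set subset_eq Ball_def)
qed

lemma schwartz_smooth: "f \<in> schwartz \<Longrightarrow> smooth_fun f"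
  by (simp add: schwartz_iff)

lemma schwartz_differentiable: "f \<in> schwartz \<Longrightarrow> f differentiable at x"
  by (simp add: schwartz_smooth smooth_fun_differentiable)

lemma schwartz_continuous: "f \<in> schwartz \<Longrightarrow> continuous_on A f"
  by (meson schwartz_differentiable differentiable_imp_continuous_within continuous_at_imp_continuous_on)

lemma schwartz_borel_measurable [measurable_dest]: "f \<in> schwartz \<Longrightarrow> f \<in> borel_measurable borel"
  using borel_measurable_continuous_onI schwartz_continuous by blast

lemma schwartz_bounded:
  fixes k :: nat
  assumes "f \<in> schwartz" "set bs \<subseteq> Basis"
  shows "\<exists>C. \<forall>x. norm x ^ k * norm (partial_derivs bs f x) \<le> C"
  using assms by (auto simp: schwartz_iff)

text \<open>Smoothness is the greatest property that implies differentiability and passes to basis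
  derivatives. A suitable family \<open>X\<close> therefore replaces any formula for iterated
  derivatives.\<close>

lemma smooth_fun_coinduct:
  assumes "f \<in> X"
    and "\<And>f x. f \<in> X \<Longrightarrow> f differentiable at x"
    and "\<And>f b. f \<in> X \<Longrightarrow> b \<in> Basis \<Longrightarrow> partial_deriv b f \<in> X"
  shows "smooth_fun f" and "set bs \<subseteq> Basis \<Longrightarrow> partial_derivs bs f \<in> X"
proof -
  have *: "partial_derivs bs f \<in> X" if "set bs \<subseteq> Basis" for bs
    using that by (induction bs) (auto simp: assms)
  then show "smooth_fun f" and "set bs \<subseteq> Basis \<Longrightarrow> partial_derivs bs f \<in> X"
    using assms by (auto simp: smooth_fun_def in_lists_conv_set subset_eq)
qed

lemma schwartz_coinduct:
  assumes "f \<in> X"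
    and "\<And>f x. f \<in> X \<Longrightarrow> f differentiable at x"
    and "\<And>f b. f \<in> X \<Longrightarrow> b \<in> Basis \<Longrightarrow> partial_deriv b f \<in> X"
    and "\<And>f k. f \<in> X \<Longrightarrow> \<exists>C. \<forall>x. norm x ^ k * norm (f x) \<le> C"
  shows "f \<in> schwartz"
  using smooth_fun_coinduct[OF assms(1-3)] assms(4) by (auto simp: schwartz_iff)

lemma partial_derivs_schwartz:
  assumes "f \<in> schwartz" "set bs \<subseteq> Basis"
  shows "partial_derivs bs f \<in> schwartz"
  unfolding schwartz_iff smooth_fun_def
proof (intro conjI ballI allI impI)
  fix as x assume "as \<in> lists (Basis :: 'a set)"
  then show "partial_derivs as (partial_derivs bs f) differentiable at x"
    using smooth_funD[OF schwartz_smooth[OF assms(1)], of "as @ bs" x] assms(2)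
    by (auto simp: partial_derivs_append in_lists_conv_set)
next
  fix as k assume "set as \<subseteq> (Basis :: 'a set)"
  then show "\<exists>C. \<forall>x. norm x ^ k * norm (partial_derivs as (partial_derivs bs f) x) \<le> C"
    using schwartz_bounded[OF assms(1), of "as @ bs" k] assms(2)
    by (simp add: partial_derivs_append)
qed

lemma partial_deriv_schwartz: "f \<in> schwartz \<Longrightarrow> b \<in> Basis \<Longrightarrow> partial_deriv b f \<in> schwartz"
  using partial_derivs_schwartz[of f "[b]"] by (simp add: partial_deriv_def)

lemma weighted_norm_triangle:
  fixes a b :: "'a::real_normed_vector"
  assumes "0 \<le> c"
  shows "c * norm (a + b) \<le> c * norm a + c * norm b"
  using mult_left_mono[OF norm_triangle_ineq assms] by (simp add: distrib_left)

lemma schwartz_add: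
  assumes "f \<in> schwartz" "g \<in> schwartz"
  shows "(\<lambda>x. f x + g x) \<in> schwartz"
  unfolding schwartz_iff
proof (intro conjI allI impI)
  show "smooth_fun (\<lambda>x. f x + g x)"
    by (simp add: assms schwartz_smooth smooth_fun_add)
next
  fix bs and k :: nat assume bs: "set bs \<subseteq> (Basis :: 'a set)"
  obtain C D where C: "\<And>x. norm x ^ k * norm (partial_derivs bs f x) \<le> C"
    and D: "\<And>x. norm x ^ k * norm (partial_derivs bs g x) \<le> D"
    using schwartz_bounded[OF assms(1) bs, of k] schwartz_bounded[OF assms(2) bs, of k] by blast
  have "norm x ^ k * norm (partial_derivs bs f x + partial_derivs bs g x) \<le> C + D" for x
    by (intro order_trans[OF weighted_norm_triangle add_mono[OF C D]]) simp
  then show "\<exists>C. \<forall>x. norm x ^ k * norm (partial_derivs bs (\<lambda>x. f x + g x) x) \<le> C"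
    by (auto simp: partial_derivs_add bs assms schwartz_smooth)
qed

lemma schwartz_cmult:
  assumes "f \<in> schwartz"
  shows "(\<lambda>x. c * f x) \<in> schwartz"
  unfolding schwartz_iff
proof (intro conjI allI impI)
  show "smooth_fun (\<lambda>x. c * f x)"
    by (simp add: assms schwartz_smooth smooth_fun_cmult)
next
  fix bs and k :: nat assume bs: "set bs \<subseteq> (Basis :: 'a set)"
  obtain C where C: "\<And>x. norm x ^ k * norm (partial_derivs bs f x) \<le> C"
    using schwartz_bounded[OF assms(1) bs, of k] by blast
  have "norm x ^ k * norm (c * partial_derivs bs f x) \<le> norm c * C" for x
    using mult_left_mono[OF C[of x], of "norm c"] by (simp add: norm_mult algebra_simps)
  then show "\<exists>C. \<forall>x. norm x ^ k * norm (partial_derivs bs (\<lambda>x. c * f x) x) \<le> C"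
    by (auto simp: partial_derivs_cmult bs assms schwartz_smooth)
qed

lemma schwartz_cnj:
  assumes "f \<in> schwartz"
  shows "(\<lambda>x. cnj (f x)) \<in> schwartz"
  using assms by (auto simp: schwartz_iff smooth_fun_cnj partial_derivs_cnj)

lemma schwartz_uminus: "f \<in> schwartz \<Longrightarrow> (\<lambda>x. - f x) \<in> schwartz"
  using schwartz_cmult[of f "-1"] by simp

lemma schwartz_diff: "f \<in> schwartz \<Longrightarrow> g \<in> schwartz \<Longrightarrow> (\<lambda>x. f x - g x) \<in> schwartz"
  using schwartz_add[of f "\<lambda>x. - g x"] schwartz_uminus[of g] by simp

lemma schwartz_zero: "(\<lambda>x. 0) \<in> (schwartz :: ('a::euclidean_space \<Rightarrow> complex) set)"
proof (rule schwartz_coinduct[of _ "{\<lambda>x. 0}"])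
  fix f :: "'a \<Rightarrow> complex" and b assume "f \<in> {\<lambda>x. 0}"
  then show "partial_deriv b f \<in> {\<lambda>x. 0}"
    using partial_deriv_eqI[OF has_derivative_const] by auto
qed auto

lemma schwartz_sum:
  assumes "\<And>i. i \<in> I \<Longrightarrow> f i \<in> schwartz"
  shows "(\<lambda>x. \<Sum>i\<in>I. f i x) \<in> schwartz"
  using assms by (induction I rule: infinite_finite_induct) (auto simp: schwartz_zero schwartz_add)

text \<open>An increasing sequence of norms that defines the same topology as the seminorms indexed
  by \<open>k\<close> and \<open>bs\<close>. With a single directed index, continuity becomes one
  estimate against one \<open>snorm m\<close>.\<close>

definition snorm :: "nat \<Rightarrow> ('a::euclidean_space \<Rightarrow> complex) \<Rightarrow> real" where
  "snorm n f = (SUP (k, bs, x) \<in> {..n} \<times> {bs. set bs \<subseteq> Basis \<and> length bs \<le> n} \<times> UNIV.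
     norm x ^ k * norm (partial_derivs bs f x))"

text \<open>As \<open>Basis\<close> is finite, only finitely many pairs of \<open>k\<close> and
  \<open>bs\<close> enter the supremum, and each contributes a bounded function of \<open>x\<close>.
  Hence the set is bounded above and the real \<open>SUP\<close> behaves as intended.\<close>

lemma snorm_upper:
  fixes f :: "'a::euclidean_space \<Rightarrow> complex"
  assumes "f \<in> schwartz" "k \<le> n" "set bs \<subseteq> Basis" "length bs \<le> n"
  shows "norm x ^ k * norm (partial_derivs bs f x) \<le> snorm n f"
proof -
  let ?I = "{..n} \<times> {bs. set bs \<subseteq> (Basis :: 'a set) \<and> length bs \<le> n}"
  let ?g = "\<lambda>(k, bs, x). norm x ^ k * norm (partial_derivs bs f x)"
  have "\<forall>i\<in>?I. \<exists>C. \<forall>x. ?g (fst i, snd i, x) \<le> C"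
    using schwartz_bounded[OF assms(1)] by auto
  from bchoice[OF this] obtain C where C: "\<And>i x. i \<in> ?I \<Longrightarrow> ?g (fst i, snd i, x) \<le> C i"
    by blast
  have "finite ?I"
    by (intro finite_cartesian_product finite_atMost finite_lists_length_le finite_Basis)
  have "?g j \<le> Max (C ` ?I)"
    if "j \<in> {..n} \<times> {bs. set bs \<subseteq> Basis \<and> length bs \<le> n} \<times> UNIV" for j
  proof -
    obtain k bs x where j: "j = (k, bs, x)"
      by (cases j)
    have "?g j \<le> C (k, bs)"
      using C[of "(k, bs)" x] that unfolding j by simp
    also have "C (k, bs) \<le> Max (C ` ?I)"
      using \<open>finite ?I\<close> that unfolding j by (intro Max_ge) auto
    finally show ?thesis .
  qed
  then have "bdd_above (?g ` ({..n} \<times> {bs. set bs \<subseteq> Basis \<and> length bs \<le> n} \<times> UNIV))"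
    by (rule bdd_aboveI2)
  then show ?thesis
    unfolding snorm_def
    using cSUP_upper[of "(k, bs, x)" "{..n} \<times> {bs. set bs \<subseteq> Basis \<and> length bs \<le> n} \<times> UNIV" ?g] assms
    by auto
qed

lemma snorm_least:
  assumes "\<And>k bs x. k \<le> n \<Longrightarrow> set bs \<subseteq> Basis \<Longrightarrow> length bs \<le> n \<Longrightarrow>
    norm x ^ k * norm (partial_derivs bs f x) \<le> B"
  shows "snorm n f \<le> B"
proof -
  have "(0, [], undefined) \<in> {..n} \<times> {bs. set bs \<subseteq> (Basis :: 'a set) \<and> length bs \<le> n} \<times> (UNIV :: 'a set)"
    by auto
  then have "{..n} \<times> {bs. set bs \<subseteq> (Basis :: 'a set) \<and> length bs \<le> n} \<times> (UNIV :: 'a set) \<noteq> {}"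
    by blast
  then show ?thesis
    unfolding snorm_def by (rule cSUP_least) (use assms in auto)
qed

lemma snorm_upper0: "f \<in> schwartz \<Longrightarrow> k \<le> n \<Longrightarrow> norm x ^ k * norm (f x) \<le> snorm n f"
  using snorm_upper[of f k n "[]" x] by simp

lemma snorm_nonneg: "f \<in> schwartz \<Longrightarrow> 0 \<le> snorm n f"
  using order.trans[OF norm_ge_zero[of "f 0"]] snorm_upper0[of f 0 n 0] by simp

lemma snorm_mono: "f \<in> schwartz \<Longrightarrow> m \<le> n \<Longrightarrow> snorm m f \<le> snorm n f"
  by (rule snorm_least) (simp add: snorm_upper)

lemma snorm_add:
  assumes "f \<in> schwartz" "g \<in> schwartz"
  shows "snorm n (\<lambda>x. f x + g x) \<le> snorm n f + snorm n g"
proof (rule snorm_least)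
  fix k bs x assume *: "k \<le> n" "set bs \<subseteq> (Basis :: 'a set)" "length bs \<le> n"
  have "norm x ^ k * norm (partial_derivs bs f x + partial_derivs bs g x) \<le>
    norm x ^ k * norm (partial_derivs bs f x) + norm x ^ k * norm (partial_derivs bs g x)"
    by (intro weighted_norm_triangle) simp
  also have "\<dots> \<le> snorm n f + snorm n g"
    by (intro add_mono snorm_upper assms *)
  finally show "norm x ^ k * norm (partial_derivs bs (\<lambda>x. f x + g x) x) \<le> snorm n f + snorm n g"
    by (simp add: partial_derivs_add schwartz_smooth assms *)
qed

lemma snorm_cmult:
  assumes "f \<in> schwartz"
  shows "snorm n (\<lambda>x. c * f x) \<le> norm c * snorm n f"
proof (rule snorm_least)
  fix k bs x assume *: "k \<le> n" "set bs \<subseteq> (Basis :: 'a set)" "length bs \<le> n"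
  show "norm x ^ k * norm (partial_derivs bs (\<lambda>x. c * f x) x) \<le> norm c * snorm n f"
    using mult_left_mono[OF snorm_upper[OF assms *, of x], of "norm c"]
    by (simp add: partial_derivs_cmult schwartz_smooth assms * norm_mult algebra_simps)
qed

lemma snorm_partial_derivs:
  assumes "f \<in> schwartz" "set bs \<subseteq> Basis"
  shows "snorm n (partial_derivs bs f) \<le> snorm (n + length bs) f"
  using snorm_upper[OF assms(1), of _ "n + length bs" "_ @ bs"] assms(2)
  by (intro snorm_least) (simp add: partial_derivs_append)

lemma schwartz_seminorm_upper:
  assumes "f \<in> schwartz" "set bs \<subseteq> Basis"
  shows "norm x ^ k * norm (partial_derivs bs f x) \<le> schwartz_seminorm k bs f"
  unfolding schwartz_seminorm_def
proof (rule cSUP_upper)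
  obtain C where "\<And>x. norm x ^ k * norm (partial_derivs bs f x) \<le> C"
    using schwartz_bounded[OF assms(1) assms(2), of k] by blast
  then show "bdd_above (range (\<lambda>x. norm x ^ k * norm (partial_derivs bs f x)))"
    by (rule bdd_aboveI2)
qed simp

lemma schwartz_seminorm_le_snorm:
  assumes "f \<in> schwartz" "set bs \<subseteq> Basis" "k \<le> n" "length bs \<le> n"
  shows "schwartz_seminorm k bs f \<le> snorm n f"
  unfolding schwartz_seminorm_def
  using snorm_upper[OF assms(1,3,2,4)] by (intro cSUP_least) auto

lemma schwartz_seminorm_add:
  assumes "f \<in> schwartz" "g \<in> schwartz" "set bs \<subseteq> Basis"
  shows "schwartz_seminorm k bs (\<lambda>x. f x + g x) \<le> schwartz_seminorm k bs f + schwartz_seminorm k bs g"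
  unfolding schwartz_seminorm_def[of k bs "\<lambda>x. f x + g x"]
proof (rule cSUP_least)
  fix x
  have "norm x ^ k * norm (partial_derivs bs f x + partial_derivs bs g x) \<le>
    norm x ^ k * norm (partial_derivs bs f x) + norm x ^ k * norm (partial_derivs bs g x)"
    by (intro weighted_norm_triangle) simp
  also have "\<dots> \<le> schwartz_seminorm k bs f + schwartz_seminorm k bs g"
    by (intro add_mono schwartz_seminorm_upper assms)
  finally show "norm x ^ k * norm (partial_derivs bs (\<lambda>x. f x + g x) x) \<le>
      schwartz_seminorm k bs f + schwartz_seminorm k bs g"
    by (simp add: partial_derivs_add schwartz_smooth assms)
qed simp

section \<open>The topology of the Schwartz space\<close>

lemma topspace_schwartz_topology [simp]:
  "topspace schwartz_topology = (schwartz :: ('a::euclidean_space \<Rightarrow> complex) set)"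
proof
  show "topspace schwartz_topology \<subseteq> (schwartz :: ('a \<Rightarrow> complex) set)"
    unfolding schwartz_topology_def topology_generated_by_topspace by blast
  show "(schwartz :: ('a \<Rightarrow> complex) set) \<subseteq> topspace schwartz_topology"
  proof
    fix g :: "'a \<Rightarrow> complex" assume g: "g \<in> schwartz"
    let ?N = "{h \<in> schwartz. schwartz_seminorm 0 [] (\<lambda>x. h x - g x) < 1}"
    have "g \<in> ?N"
      using g by (simp add: schwartz_seminorm_def)
    moreover have "openin schwartz_topology ?N"
      unfolding schwartz_topology_def using g
      by (intro topology_generated_by_Basis CollectI exI[of _ g] exI[of _ 0] exI[of _ "[]"] exI[of _ 1]) auto
    ultimately show "g \<in> topspace schwartz_topology"
      using openin_subset by blast
  qed
qed

text \<open>By the triangle inequality a subbasic set is a neighbourhood of each of its points, not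
  only of its centre, and this survives finite intersections and unions. Conversely, every
  \<open>snorm\<close> ball contains a finite intersection of subbasic sets around its
  centre.\<close>

lemma openin_schwartz_topology:
  "openin schwartz_topology V \<longleftrightarrow>
    V \<subseteq> schwartz \<and> (\<forall>f\<in>V. \<exists>n e. e > 0 \<and> (\<forall>g\<in>schwartz. snorm n (\<lambda>x. g x - f x) < e \<longrightarrow> g \<in> V))"
  (is "?L \<longleftrightarrow> ?R V")
proof
  assume ?L
  then have "generate_topology_on {{g \<in> schwartz. schwartz_seminorm k bs (\<lambda>x. g x - f x) < e} | f k bs e.
        f \<in> schwartz \<and> bs \<in> lists Basis \<and> e > 0} V"
    by (simp add: schwartz_topology_def openin_topology_generated_by_iff)
  then show "?R V"
  proof induction
    case (Int a b)
    have "\<exists>n e. e > 0 \<and> (\<forall>g\<in>schwartz. snorm n (\<lambda>x. g x - f x) < e \<longrightarrow> g \<in> a \<inter> b)"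
      if f: "f \<in> a \<inter> b" for f
    proof -
      obtain m d where m: "d > 0" "\<And>g. g \<in> schwartz \<Longrightarrow> snorm m (\<lambda>x. g x - f x) < d \<Longrightarrow> g \<in> a"
        using Int f by (meson IntD1)
      obtain n e where n: "e > 0" "\<And>g. g \<in> schwartz \<Longrightarrow> snorm n (\<lambda>x. g x - f x) < e \<Longrightarrow> g \<in> b"
        using Int f by (meson IntD2)
      have "f \<in> schwartz"
        using f Int by auto
      then have "snorm m (\<lambda>x. g x - f x) \<le> snorm (max m n) (\<lambda>x. g x - f x)"
        "snorm n (\<lambda>x. g x - f x) \<le> snorm (max m n) (\<lambda>x. g x - f x)" if "g \<in> schwartz" for g
        using that by (auto intro!: snorm_mono schwartz_diff)
      then have "\<forall>g\<in>schwartz. snorm (max m n) (\<lambda>x. g x - f x) < min d e \<longrightarrow> g \<in> a \<inter> b"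
        using m n by fastforce
      then show ?thesis
        using m n by (metis min_less_iff_conj)
    qed
    then show ?case
      using Int by auto
  next
    case (UN K)
    then have IH: "?R k" if "k \<in> K" for k
      using that by blast
    show ?case
    proof (intro conjI ballI)
      show "\<Union> K \<subseteq> schwartz"
        using IH by blast
      fix f assume "f \<in> \<Union> K"
      then obtain k where k: "k \<in> K" "f \<in> k"
        by blast
      then obtain n e where "e > 0" "\<forall>g\<in>schwartz. snorm n (\<lambda>x. g x - f x) < e \<longrightarrow> g \<in> k"
        using IH by blast
      with k show "\<exists>n e. e > 0 \<and> (\<forall>g\<in>schwartz. snorm n (\<lambda>x. g x - f x) < e \<longrightarrow> g \<in> \<Union> K)"
        by blast
    qed
  next
    case (Basis s)
    then obtain f0 k bs e where s: "s = {g \<in> schwartz. schwartz_seminorm k bs (\<lambda>x. g x - f0 x) < e}"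
      and *: "f0 \<in> schwartz" "set bs \<subseteq> Basis" "e > 0"
      by (auto simp: in_lists_conv_set subset_eq)
    have "\<exists>n d. d > 0 \<and> (\<forall>g\<in>schwartz. snorm n (\<lambda>x. g x - f x) < d \<longrightarrow> g \<in> s)" if f: "f \<in> s" for f
    proof (intro exI conjI ballI impI)
      have fs: "f \<in> schwartz"
        using f s by simp
      \<comment> \<open>The radius is the slack that the distance from \<open>f0\<close> to
        \<open>f\<close> leaves in the triangle inequality.\<close>
      show "0 < e - schwartz_seminorm k bs (\<lambda>x. f x - f0 x)"
        using f s by simp
      fix g assume g: "g \<in> schwartz"
        "snorm (max k (length bs)) (\<lambda>x. g x - f x) < e - schwartz_seminorm k bs (\<lambda>x. f x - f0 x)"
      have "schwartz_seminorm k bs (\<lambda>x. g x - f0 x) \<le>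
        schwartz_seminorm k bs (\<lambda>x. g x - f x) + schwartz_seminorm k bs (\<lambda>x. f x - f0 x)"
        using schwartz_seminorm_add[of "\<lambda>x. g x - f x" "\<lambda>x. f x - f0 x" bs k] fs g *
        by (simp add: schwartz_diff)
      also have "schwartz_seminorm k bs (\<lambda>x. g x - f x) \<le> snorm (max k (length bs)) (\<lambda>x. g x - f x)"
        using fs g * by (intro schwartz_seminorm_le_snorm schwartz_diff) auto
      finally show "g \<in> s"
        using g s by simp
    qed
    then show ?case
      by (auto simp: s)
  qed simp
next
  assume R: "?R V"
  \<comment> \<open>Finite intersections of subbasic sets stand in for \<open>snorm\<close> balls,
    because they are open by construction.\<close>
  define nbh :: "nat \<Rightarrow> real \<Rightarrow> ('a \<Rightarrow> complex) \<Rightarrow> ('a \<Rightarrow> complex) set" where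
    "nbh n e f = schwartz \<inter> (\<Inter>(k, bs)\<in>{..n} \<times> {bs. set bs \<subseteq> Basis \<and> length bs \<le> n}.
      {g \<in> schwartz. schwartz_seminorm k bs (\<lambda>x. g x - f x) < e})" for n e f
  have op: "openin schwartz_topology (nbh n e f)" if "f \<in> schwartz" "e > 0" for n e f
  proof -
    have "finite ({..n} \<times> {bs. set bs \<subseteq> (Basis :: 'a set) \<and> length bs \<le> n})"
      by (intro finite_cartesian_product finite_atMost finite_lists_length_le finite_Basis)
    moreover have "openin schwartz_topology {g \<in> schwartz. schwartz_seminorm k bs (\<lambda>x. g x - f x) < e}"
      if "set bs \<subseteq> Basis" for k bs
      unfolding schwartz_topology_def using that \<open>f \<in> schwartz\<close> \<open>e > 0\<close>
      by (intro topology_generated_by_Basis) (auto simp: in_lists_conv_set subset_eq)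
    moreover have "openin schwartz_topology (schwartz :: ('a \<Rightarrow> complex) set)"
      by (metis openin_topspace topspace_schwartz_topology)
    moreover have "{..n} \<times> {bs. set bs \<subseteq> (Basis :: 'a set) \<and> length bs \<le> n} \<noteq> {}"
      by (auto intro!: exI[of _ "[]"])
    ultimately show ?thesis
      unfolding nbh_def by (intro openin_Int openin_Inter) auto
  qed
  have small: "g \<in> schwartz \<and> snorm n (\<lambda>x. g x - f x) \<le> e"
    if "f \<in> schwartz" "g \<in> nbh n e f" for f g n e
  proof
    show g: "g \<in> schwartz"
      using that by (simp add: nbh_def)
    show "snorm n (\<lambda>x. g x - f x) \<le> e"
    proof (rule snorm_least)
      fix k bs x assume *: "k \<le> n" "set bs \<subseteq> (Basis :: 'a set)" "length bs \<le> n"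
      have "norm x ^ k * norm (partial_derivs bs (\<lambda>x. g x - f x) x) \<le> schwartz_seminorm k bs (\<lambda>x. g x - f x)"
        using g that * by (intro schwartz_seminorm_upper schwartz_diff)
      also have "\<dots> \<le> e"
        using that * by (force simp: nbh_def)
      finally show "norm x ^ k * norm (partial_derivs bs (\<lambda>x. g x - f x) x) \<le> e" .
    qed
  qed
  have mem: "f \<in> nbh n e f" if "f \<in> schwartz" "e > 0" for f n e
  proof -
    have "partial_derivs bs (\<lambda>x. 0 :: complex) = (\<lambda>x. 0)" if "set bs \<subseteq> (Basis :: 'a set)" for bs
      using partial_derivs_cmult[of "\<lambda>x. 0" bs 0] that schwartz_smooth[OF schwartz_zero] by simp
    then show ?thesis
      using that by (auto simp: nbh_def schwartz_seminorm_def)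
  qed
  have "\<exists>W. openin schwartz_topology W \<and> f \<in> W \<and> W \<subseteq> V" if "f \<in> V" for f
  proof -
    have "f \<in> schwartz"
      using R that by auto
    obtain n e where *: "e > 0" "\<forall>g\<in>schwartz. snorm n (\<lambda>x. g x - f x) < e \<longrightarrow> g \<in> V"
      using bspec[OF conjunct2[OF R] \<open>f \<in> V\<close>] by (elim exE conjE)
    \<comment> \<open>A supremum of values below a bound may attain the bound, so membership in
      \<open>nbh\<close> gives only a weak inequality; halving the radius restores the strict
      one.\<close>
    have "nbh n (e / 2) f \<subseteq> V"
    proof
      fix g assume "g \<in> nbh n (e / 2) f"
      then have "g \<in> schwartz" "snorm n (\<lambda>x. g x - f x) \<le> e / 2"
        using small[OF \<open>f \<in> schwartz\<close>, of g n "e / 2"] by auto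
      then show "g \<in> V"
        using * by fastforce
    qed
    then show ?thesis
      using op[of f "e / 2" n] mem[of f "e / 2" n] \<open>f \<in> schwartz\<close> * by auto
  qed
  then show ?L
    by (subst openin_subopen) auto
qed

section \<open>Tempered distributions\<close>

lemma linear_on_schwartzD:
  assumes "linear_on_schwartz u"
  shows "f \<in> schwartz \<Longrightarrow> g \<in> schwartz \<Longrightarrow> u (\<lambda>x. f x + g x) = u f + u g"
    and "f \<in> schwartz \<Longrightarrow> u (\<lambda>x. c * f x) = c * u f"
  using assms by (auto simp: linear_on_schwartz_def)

lemma linear_on_schwartz_zero: "linear_on_schwartz u \<Longrightarrow> u (\<lambda>x. 0) = 0"
  using linear_on_schwartzD(2)[of u "\<lambda>x. 0" 0] schwartz_zero by simp

lemma linear_on_schwartz_diff: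
  assumes "linear_on_schwartz u" "f \<in> schwartz" "g \<in> schwartz"
  shows "u (\<lambda>x. f x - g x) = u f - u g"
  using linear_on_schwartzD(1)[OF assms(1,2) schwartz_cmult[OF assms(3), of "-1"]]
    linear_on_schwartzD(2)[OF assms(1,3), of "-1"] by simp

lemma linear_on_schwartz_sum:
  assumes "linear_on_schwartz u" "\<And>i. i \<in> I \<Longrightarrow> f i \<in> schwartz"
  shows "u (\<lambda>x. \<Sum>i\<in>I. f i x) = (\<Sum>i\<in>I. u (f i))"
  using assms(2)
proof (induction I rule: infinite_finite_induct)
  case (insert i I)
  then show ?case
    using linear_on_schwartzD(1)[OF assms(1), of "f i" "\<lambda>x. \<Sum>i\<in>I. f i x"]
    by (simp add: schwartz_sum)
qed (simp_all add: linear_on_schwartz_zero assms(1))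

text \<open>Homogeneity turns continuity at 0 into a global estimate; conversely the estimate,
  applied to differences, gives continuity at every point.\<close>

lemma tempered_iff:
  "tempered u \<longleftrightarrow> linear_on_schwartz u \<and> (\<exists>m C. \<forall>f\<in>schwartz. norm (u f) \<le> C * snorm m f)"
proof (intro iffI conjI)
  assume T: "tempered u"
  then show lin: "linear_on_schwartz u"
    by (simp add: tempered_def)
  have "openin schwartz_topology {f \<in> topspace schwartz_topology. u f \<in> ball 0 1}"
    using T unfolding tempered_def
    by (intro openin_continuous_map_preimage[where Y=euclidean]) auto
  moreover have "(\<lambda>x. 0) \<in> {f \<in> topspace schwartz_topology. u f \<in> ball 0 1}"
    using schwartz_zero linear_on_schwartz_zero[OF lin] by auto
  ultimately obtain n e where e: "e > 0"
    and "\<forall>g\<in>schwartz. snorm n (\<lambda>x. g x - 0) < e \<longrightarrow>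
      g \<in> {f \<in> topspace schwartz_topology. u f \<in> ball 0 1}"
    unfolding openin_schwartz_topology by (elim conjE) (drule (1) bspec, elim exE conjE)
  then have *: "norm (u g) < 1" if "g \<in> schwartz" "snorm n g < e" for g
    using that by auto
  have "norm (u f) \<le> (2 / e) * snorm n f" if f: "f \<in> schwartz" for f
  proof (rule field_le_epsilon)
    fix d :: real assume d: "d > 0"
    \<comment> \<open>The added term keeps the divisor positive even if \<open>snorm n f\<close>
      vanishes. Scaling by \<open>e / (2 * s)\<close> brings \<open>f\<close> into the ball of
      radius \<open>e\<close>, and the added term costs exactly \<open>d\<close> in the final
      bound.\<close>
    define s where "s = snorm n f + d * e / 2"
    have s: "s > 0"
      using snorm_nonneg[OF f, of n] d e by (simp add: s_def add_nonneg_pos)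
    define c where "c = complex_of_real (e / (2 * s))"
    have "snorm n f \<le> s" "0 \<le> snorm n f"
      using d e snorm_nonneg[OF f] by (auto simp: s_def)
    then have "snorm n (\<lambda>x. c * f x) \<le> e / (2 * s) * s"
      using s e by (intro order.trans[OF snorm_cmult[OF f]] mult_mono) (auto simp: c_def norm_divide)
    also have "\<dots> < e"
      using s e by simp
    finally have "norm (u (\<lambda>x. c * f x)) < 1"
      by (intro * schwartz_cmult f)
    then have "e / (2 * s) * norm (u f) < 1"
      unfolding linear_on_schwartzD(2)[OF lin f] norm_mult
      using s e by (simp add: c_def norm_divide)
    then have "norm (u f) < 2 * s / e"
      using s e by (simp add: field_simps)
    then show "norm (u f) \<le> 2 / e * snorm n f + d"
      using e by (simp add: s_def field_simps)
  qed
  then show "\<exists>m C. \<forall>f\<in>schwartz. norm (u f) \<le> C * snorm m f"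
    by blast
next
  assume "linear_on_schwartz u \<and> (\<exists>m C. \<forall>f\<in>schwartz. norm (u f) \<le> C * snorm m f)"
  then obtain m C where lin: "linear_on_schwartz u" and C: "\<And>f. f \<in> schwartz \<Longrightarrow> norm (u f) \<le> C * snorm m f"
    by auto
  have "openin schwartz_topology {f \<in> schwartz. u f \<in> V}" if V: "open V" for V
    unfolding openin_schwartz_topology
  proof (intro conjI ballI)
    fix f assume "f \<in> {f \<in> schwartz. u f \<in> V}"
    then have f: "f \<in> schwartz" "u f \<in> V"
      by auto
    then obtain e where e: "e > 0" "ball (u f) e \<subseteq> V"
      using V openE by blast
    \<comment> \<open>Nothing is known about the sign of \<open>C\<close>; the absolute value plus 1
      gives a positive denominator and leaves the last inequality strict.\<close>
    define d where "d = e / (\<bar>C\<bar> + 1)"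
    show "\<exists>n e. e > 0 \<and> (\<forall>g\<in>schwartz. snorm n (\<lambda>x. g x - f x) < e \<longrightarrow> g \<in> {f \<in> schwartz. u f \<in> V})"
    proof (intro exI conjI ballI impI)
      show "d > 0"
        using e by (simp add: d_def add_nonneg_pos)
      fix g assume g: "g \<in> schwartz" "snorm m (\<lambda>x. g x - f x) < d"
      have "norm (u g - u f) \<le> C * snorm m (\<lambda>x. g x - f x)"
        using C[OF schwartz_diff[OF g(1) f(1)]] linear_on_schwartz_diff[OF lin g(1) f(1)] by simp
      also have "\<dots> \<le> \<bar>C\<bar> * d"
        using g snorm_nonneg[OF schwartz_diff[OF g(1) f(1)], of m] by (intro mult_mono) auto
      also have "\<dots> < e"
        using e by (simp add: d_def field_simps)
      finally show "g \<in> {f \<in> schwartz. u f \<in> V}"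
        using e g by (auto simp: dist_norm norm_minus_commute)
    qed
  qed auto
  then show "tempered u"
    using lin by (auto simp: tempered_def continuous_map_def)
qed

lemma tempered_linear: "tempered u \<Longrightarrow> linear_on_schwartz u"
  by (simp add: tempered_def)

lemma tempered_bound:
  assumes "tempered u"
  shows "\<exists>m C. C \<ge> 0 \<and> (\<forall>f\<in>schwartz. norm (u f) \<le> C * snorm m f)"
proof -
  obtain m C where C: "\<And>f. f \<in> schwartz \<Longrightarrow> norm (u f) \<le> C * snorm m f"
    using assms unfolding tempered_iff by auto
  have "norm (u f) \<le> \<bar>C\<bar> * snorm m f" if "f \<in> schwartz" for f
    using C[OF that] mult_right_mono[OF abs_ge_self[of C] snorm_nonneg[OF that, of m]] by linarith
  then show ?thesis
    by (intro exI[of _ m] exI[of _ "\<bar>C\<bar>"]) simp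
qed

lemma temperedI:
  assumes "linear_on_schwartz u" "\<And>f. f \<in> schwartz \<Longrightarrow> norm (u f) \<le> C * snorm m f"
  shows "tempered u"
  using assms by (auto simp: tempered_iff)

lemma tempered_cong:
  assumes "tempered u" "\<And>f. f \<in> schwartz \<Longrightarrow> u f = v f"
  shows "tempered v"
proof -
  have "linear_on_schwartz v"
    using linear_on_schwartzD[OF tempered_linear[OF assms(1)]]
    by (simp add: linear_on_schwartz_def schwartz_add schwartz_cmult assms(2)[symmetric])
  moreover obtain m C where "\<And>f. f \<in> schwartz \<Longrightarrow> norm (u f) \<le> C * snorm m f"
    using tempered_bound[OF assms(1)] by blast
  ultimately show ?thesis
    using assms(2) by (intro temperedI[of v C m]) simp_all
qed

lemma tempered_cnj_distr:
  assumes "tempered u"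
  shows "tempered (cnj_distr u)"
proof -
  obtain m C where C: "C \<ge> 0" "\<And>f. f \<in> schwartz \<Longrightarrow> norm (u f) \<le> C * snorm m f"
    using tempered_bound[OF assms] by blast
  note lin = tempered_linear[OF assms]
  show ?thesis
  proof (rule temperedI)
    show "linear_on_schwartz (cnj_distr u)"
      using linear_on_schwartzD[OF lin]
      by (auto simp: linear_on_schwartz_def cnj_distr_def schwartz_cnj)
    fix f :: "'a \<Rightarrow> complex" assume f: "f \<in> schwartz"
    have "snorm m (\<lambda>x. cnj (f x)) \<le> snorm m f"
      by (rule snorm_least) (simp add: partial_derivs_cnj schwartz_smooth f snorm_upper)
    then show "norm (cnj_distr u f) \<le> C * snorm m f"
      using order.trans[OF C(2)[OF schwartz_cnj[OF f]] mult_left_mono[OF _ C(1)]]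
      by (simp add: cnj_distr_def)
  qed
qed

lemma tempered_diff:
  assumes "tempered u" "tempered v"
  shows "tempered (\<lambda>f. u f - v f)"
proof -
  obtain m C where C: "C \<ge> 0" "\<And>f. f \<in> schwartz \<Longrightarrow> norm (u f) \<le> C * snorm m f"
    using tempered_bound[OF assms(1)] by blast
  obtain n D where D: "D \<ge> 0" "\<And>f. f \<in> schwartz \<Longrightarrow> norm (v f) \<le> D * snorm n f"
    using tempered_bound[OF assms(2)] by blast
  show ?thesis
  proof (rule temperedI)
    show "linear_on_schwartz (\<lambda>f. u f - v f)"
      using assms[THEN tempered_linear] by (auto simp: linear_on_schwartz_def algebra_simps)
    fix f :: "'a \<Rightarrow> complex" assume f: "f \<in> schwartz"
    have "norm (u f - v f) \<le> C * snorm m f + D * snorm n f"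
      using norm_triangle_ineq4[of "u f" "v f"] C(2)[OF f] D(2)[OF f] by linarith
    also have "\<dots> \<le> C * snorm (max m n) f + D * snorm (max m n) f"
      by (intro add_mono mult_left_mono snorm_mono f C D) auto
    finally show "norm (u f - v f) \<le> (C + D) * snorm (max m n) f"
      by (simp add: algebra_simps)
  qed
qed

section \<open>Continuous linear operators between Schwartz spaces\<close>

definition schwartz_op ::
    "(('a::euclidean_space \<Rightarrow> complex) \<Rightarrow> ('b::euclidean_space \<Rightarrow> complex)) \<Rightarrow> bool" where
  "schwartz_op L \<longleftrightarrow>
     (\<forall>f\<in>schwartz. L f \<in> schwartz) \<and>
     (\<forall>f\<in>schwartz. \<forall>g\<in>schwartz. L (\<lambda>x. f x + g x) = (\<lambda>x. L f x + L g x)) \<and>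
     (\<forall>c. \<forall>f\<in>schwartz. L (\<lambda>x. c * f x) = (\<lambda>x. c * L f x)) \<and>
     (\<forall>n. \<exists>m C. C \<ge> 0 \<and> (\<forall>f\<in>schwartz. snorm n (L f) \<le> C * snorm m f))"

lemma schwartz_opD:
  assumes "schwartz_op L"
  shows "f \<in> schwartz \<Longrightarrow> L f \<in> schwartz"
    and "f \<in> schwartz \<Longrightarrow> g \<in> schwartz \<Longrightarrow> L (\<lambda>x. f x + g x) = (\<lambda>x. L f x + L g x)"
    and "f \<in> schwartz \<Longrightarrow> L (\<lambda>x. c * f x) = (\<lambda>x. c * L f x)"
    and "\<exists>m C. C \<ge> 0 \<and> (\<forall>f\<in>schwartz. snorm n (L f) \<le> C * snorm m f)"
  using assms by (auto simp: schwartz_op_def)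

lemma schwartz_op_cong:
  assumes "schwartz_op L" "\<And>f. f \<in> schwartz \<Longrightarrow> L f = M f"
  shows "schwartz_op M"
  using assms(1) unfolding schwartz_op_def
  by (simp add: assms(2)[symmetric] schwartz_add schwartz_cmult cong: ball_cong)

lemma schwartz_op_id: "schwartz_op (\<lambda>f. f)"
  unfolding schwartz_op_def
proof (intro conjI allI ballI)
  show "\<exists>m C. C \<ge> 0 \<and> (\<forall>f\<in>schwartz. snorm n f \<le> C * snorm m f)" for n
    by (intro exI[of _ n] exI[of _ 1]) simp
qed simp_all

lemma schwartz_op_compose:
  assumes "schwartz_op L" "schwartz_op M"
  shows "schwartz_op (\<lambda>f. L (M f))"
  unfolding schwartz_op_def
proof (intro conjI allI ballI)
  fix n
  obtain m C where C: "C \<ge> 0" "\<And>f. f \<in> schwartz \<Longrightarrow> snorm n (L f) \<le> C * snorm m f"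
    using schwartz_opD(4)[OF assms(1), of n] by blast
  obtain l D where D: "D \<ge> 0" "\<And>f. f \<in> schwartz \<Longrightarrow> snorm m (M f) \<le> D * snorm l f"
    using schwartz_opD(4)[OF assms(2), of m] by blast
  have "snorm n (L (M f)) \<le> (C * D) * snorm l f" if f: "f \<in> schwartz" for f
    using order.trans[OF C(2)[OF schwartz_opD(1)[OF assms(2) f]] mult_left_mono[OF D(2)[OF f] C(1)]]
    by (simp add: mult.assoc)
  then show "\<exists>m C'. C' \<ge> 0 \<and> (\<forall>f\<in>schwartz. snorm n (L (M f)) \<le> C' * snorm m f)"
    using C(1) D(1) by (intro exI[of _ l] exI[of _ "C * D"]) simp
qed (simp_all add: schwartz_opD[OF assms(1)] schwartz_opD[OF assms(2)])

lemma schwartz_op_partial_derivs: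
  assumes "set bs \<subseteq> Basis"
  shows "schwartz_op (partial_derivs bs)"
  unfolding schwartz_op_def
proof (intro conjI allI ballI)
  fix n
  show "\<exists>m C. C \<ge> 0 \<and> (\<forall>f\<in>schwartz. snorm n (partial_derivs bs f) \<le> C * snorm m f)"
    using snorm_partial_derivs[OF _ assms]
    by (intro exI[of _ "n + length bs"] exI[of _ 1]) simp
qed (simp_all add: partial_derivs_schwartz partial_derivs_add partial_derivs_cmult schwartz_smooth assms)

lemma schwartz_op_partial_deriv: "b \<in> Basis \<Longrightarrow> schwartz_op (partial_deriv b)"
  using schwartz_op_partial_derivs[of "[b]"]
  by (rule_tac schwartz_op_cong[of "partial_derivs [b]"]) (auto simp: partial_deriv_def)

lemma tempered_compose:
  assumes "tempered u" "schwartz_op L"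
  shows "tempered (\<lambda>f. u (L f))"
proof -
  obtain m C where C: "C \<ge> 0" "\<And>f. f \<in> schwartz \<Longrightarrow> norm (u f) \<le> C * snorm m f"
    using tempered_bound[OF assms(1)] by blast
  obtain l D where D: "D \<ge> 0" "\<And>f. f \<in> schwartz \<Longrightarrow> snorm m (L f) \<le> D * snorm l f"
    using schwartz_opD(4)[OF assms(2), of m] by blast
  show ?thesis
  proof (rule temperedI)
    show "linear_on_schwartz (\<lambda>f. u (L f))"
      using linear_on_schwartzD[OF tempered_linear[OF assms(1)]] schwartz_opD[OF assms(2)]
      by (simp add: linear_on_schwartz_def)
    fix f :: "'b \<Rightarrow> complex" assume f: "f \<in> schwartz"
    show "norm (u (L f)) \<le> (C * D) * snorm l f"
      using order.trans[OF C(2)[OF schwartz_opD(1)[OF assms(2) f]] mult_left_mono[OF D(2)[OF f] C(1)]]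
      by (simp add: mult.assoc)
  qed
qed

text \<open>
  Continuity of an operator \<open>L\<close> is obtained from pointwise estimates alone: it suffices that \<open>L\<close>
  belongs to a family of operators each of which satisfies such estimates and whose partial
  derivatives are linear combinations of members of the family.
\<close>

inductive op_span :: "(('a \<Rightarrow> complex) \<Rightarrow> ('b \<Rightarrow> complex)) set \<Rightarrow> (('a \<Rightarrow> complex) \<Rightarrow> ('b \<Rightarrow> complex)) \<Rightarrow> bool"
  for B where
  zero: "op_span B (\<lambda>f x. 0)"
| base: "L \<in> B \<Longrightarrow> op_span B L"
| add: "op_span B L \<Longrightarrow> op_span B M \<Longrightarrow> op_span B (\<lambda>f x. L f x + M f x)"
| scale: "op_span B L \<Longrightarrow> op_span B (\<lambda>f x. c * L f x)"

lemma op_span_sum: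
  assumes "\<And>i. i \<in> I \<Longrightarrow> op_span B (L i)"
  shows "op_span B (\<lambda>f x. \<Sum>i\<in>I. L i f x)"
  using assms by (induction I rule: infinite_finite_induct) (auto intro: op_span.intros)

definition decay_bounded :: "(('a::euclidean_space \<Rightarrow> complex) \<Rightarrow> ('b::euclidean_space \<Rightarrow> complex)) \<Rightarrow> bool" where
  "decay_bounded L \<longleftrightarrow>
     (\<forall>k. \<exists>m C. C \<ge> 0 \<and> (\<forall>f\<in>schwartz. \<forall>x. norm x ^ k * norm (L f x) \<le> C * snorm m f))"

lemma decay_bounded_add:
  assumes "decay_bounded L" "decay_bounded M"
  shows "decay_bounded (\<lambda>f x. L f x + M f x)"
  unfolding decay_bounded_def
proof
  fix k
  obtain m C where C: "C \<ge> 0" "\<And>f x. f \<in> schwartz \<Longrightarrow> norm x ^ k * norm (L f x) \<le> C * snorm m f"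
    using assms(1) unfolding decay_bounded_def by blast
  obtain n D where D: "D \<ge> 0" "\<And>f x. f \<in> schwartz \<Longrightarrow> norm x ^ k * norm (M f x) \<le> D * snorm n f"
    using assms(2) unfolding decay_bounded_def by blast
  have "norm x ^ k * norm (L f x + M f x) \<le> (C + D) * snorm (max m n) f" if f: "f \<in> schwartz" for f x
  proof -
    have "norm x ^ k * norm (L f x + M f x) \<le> norm x ^ k * norm (L f x) + norm x ^ k * norm (M f x)"
      by (intro weighted_norm_triangle) simp
    also have "\<dots> \<le> C * snorm m f + D * snorm n f"
      by (intro add_mono C D f)
    also have "\<dots> \<le> C * snorm (max m n) f + D * snorm (max m n) f"
      by (intro add_mono mult_left_mono snorm_mono f C D) auto
    finally show ?thesis
      by (simp add: algebra_simps)
  qed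
  then show "\<exists>m C'. C' \<ge> 0 \<and> (\<forall>f\<in>schwartz. \<forall>x. norm x ^ k * norm (L f x + M f x) \<le> C' * snorm m f)"
    using C(1) D(1) by (intro exI[of _ "max m n"] exI[of _ "C + D"]) simp
qed

lemma decay_bounded_scale:
  assumes "decay_bounded L"
  shows "decay_bounded (\<lambda>f x. c * L f x)"
  unfolding decay_bounded_def
proof
  fix k
  obtain m C where C: "C \<ge> 0" "\<And>f x. f \<in> schwartz \<Longrightarrow> norm x ^ k * norm (L f x) \<le> C * snorm m f"
    using assms unfolding decay_bounded_def by blast
  have "norm x ^ k * norm (c * L f x) \<le> (norm c * C) * snorm m f" if f: "f \<in> schwartz" for f x
    using mult_left_mono[OF C(2)[OF f, of x], of "norm c"]
    by (simp add: norm_mult algebra_simps)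
  then show "\<exists>m C'. C' \<ge> 0 \<and> (\<forall>f\<in>schwartz. \<forall>x. norm x ^ k * norm (c * L f x) \<le> C' * snorm m f)"
    using C(1) by (intro exI[of _ m] exI[of _ "norm c * C"]) simp
qed

text \<open>The index and the constant depend on the operator and on the power. As
  \<open>snorm\<close> is increasing in its index, maxima serve finitely many operators and powers
  at once, which is all that a single \<open>snorm n\<close> involves.\<close>

lemma decay_bounded_uniform:
  assumes "finite I" "\<And>i. i \<in> I \<Longrightarrow> decay_bounded (L i)"
  shows "\<exists>m C. C \<ge> 0 \<and> (\<forall>i\<in>I. \<forall>k\<le>n. \<forall>f\<in>schwartz. \<forall>x. norm x ^ k * norm (L i f x) \<le> C * snorm m f)"
proof -
  have *: "\<exists>m C. C \<ge> 0 \<and> (\<forall>j\<in>J. \<forall>f\<in>schwartz. \<forall>x. norm x ^ snd j * norm (L (fst j) f x) \<le> C * snorm m f)"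
    if "finite J" "J \<subseteq> I \<times> UNIV" for J :: "(_ \<times> nat) set"
    using that
  proof induction
    case empty
    then show ?case
      by auto
  next
    case (insert j J)
    obtain m C where C: "C \<ge> 0"
      "\<And>i f x. i \<in> J \<Longrightarrow> f \<in> schwartz \<Longrightarrow> norm x ^ snd i * norm (L (fst i) f x) \<le> C * snorm m f"
      using insert.IH insert.prems by (meson insert_subset)
    have "decay_bounded (L (fst j))"
      using insert assms by auto
    then obtain n D where D: "D \<ge> 0" "\<And>f x. f \<in> schwartz \<Longrightarrow> norm x ^ snd j * norm (L (fst j) f x) \<le> D * snorm n f"
      unfolding decay_bounded_def by blast
    have "norm x ^ snd i * norm (L (fst i) f x) \<le> max C D * snorm (max m n) f"
      if "i \<in> insert j J" "f \<in> schwartz" for i f x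
    proof (cases "i = j")
      case True
      have "D * snorm n f \<le> max C D * snorm (max m n) f"
        by (intro mult_mono snorm_mono snorm_nonneg that) (auto simp: D(1) le_max_iff_disj)
      then show ?thesis
        using D(2)[OF that(2), of x] unfolding True by linarith
    next
      case False
      have "C * snorm m f \<le> max C D * snorm (max m n) f"
        by (intro mult_mono snorm_mono snorm_nonneg that) (auto simp: C(1) le_max_iff_disj)
      then show ?thesis
        using C(2)[of i f x] that False by auto
    qed
    then show ?case
      using C(1) by (intro exI[of _ "max m n"] exI[of _ "max C D"]) auto
  qed
  from *[of "I \<times> {..n}"] show ?thesis
    using assms(1) by fastforce
qed

lemma schwartz_op_criterion:
  fixes L :: "('a::euclidean_space \<Rightarrow> complex) \<Rightarrow> ('b::euclidean_space \<Rightarrow> complex)"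
  assumes L: "L \<in> B"
    and add: "\<And>f g. f \<in> schwartz \<Longrightarrow> g \<in> schwartz \<Longrightarrow> L (\<lambda>x. f x + g x) = (\<lambda>x. L f x + L g x)"
    and scale: "\<And>c f. f \<in> schwartz \<Longrightarrow> L (\<lambda>x. c * f x) = (\<lambda>x. c * L f x)"
    and diff: "\<And>L f x. L \<in> B \<Longrightarrow> f \<in> schwartz \<Longrightarrow> L f differentiable at x"
    and deriv: "\<And>L b. L \<in> B \<Longrightarrow> b \<in> Basis \<Longrightarrow>
      \<exists>M. op_span B M \<and> (\<forall>f\<in>schwartz. \<forall>x. partial_deriv b (L f) x = M f x)"
    and bound: "\<And>L. L \<in> B \<Longrightarrow> decay_bounded L"
  shows "schwartz_op L"
proof -
  have diff': "M f differentiable at x" if "op_span B M" "f \<in> schwartz" for M f x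
    using that by induction (auto intro!: diff differentiable_add differentiable_mult)
  have bound': "decay_bounded M" if "op_span B M" for M
    using that
  proof induction
    case zero
    have "0 \<le> snorm 0 f" if "f \<in> schwartz" for f :: "'a \<Rightarrow> complex"
      by (rule snorm_nonneg[OF that])
    then show ?case
      unfolding decay_bounded_def by (intro allI exI[of _ 0] exI[of _ 1]) auto
  qed (auto intro: bound decay_bounded_add decay_bounded_scale)
  have deriv': "\<exists>M'. op_span B M' \<and> (\<forall>f\<in>schwartz. partial_deriv b (M f) = M' f)"
    if "op_span B M" "b \<in> Basis" for M b
    using that
  proof induction
    case zero
    show ?case
      using partial_deriv_eqI[OF has_derivative_const]
      by (intro exI[of _ "\<lambda>f x. 0"]) (auto intro: op_span.intros)
  next
    case (base M)
    then show ?case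
      using deriv[of M b] by (auto simp: fun_eq_iff)
  next
    case (add M N)
    then obtain M' N' where "op_span B M'" "op_span B N'"
      "\<And>f. f \<in> schwartz \<Longrightarrow> partial_deriv b (M f) = M' f"
      "\<And>f. f \<in> schwartz \<Longrightarrow> partial_deriv b (N f) = N' f"
      by blast
    then show ?case
      using add diff'
      by (intro exI[of _ "\<lambda>f x. M' f x + N' f x"])
        (auto intro: op_span.intros simp: partial_deriv_add fun_eq_iff)
  next
    case (scale M c)
    then obtain M' where "op_span B M'" "\<And>f. f \<in> schwartz \<Longrightarrow> partial_deriv b (M f) = M' f"
      by blast
    then show ?case
      using scale diff'
      by (intro exI[of _ "\<lambda>f x. c * M' f x"])
        (auto intro: op_span.intros simp: partial_deriv_cmult fun_eq_iff)
  qed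
  have "\<exists>M. op_span B M \<and> (\<forall>f\<in>schwartz. partial_derivs bs (L f) = M f)" if "set bs \<subseteq> Basis" for bs
    using that
  proof (induction bs)
    case Nil
    then show ?case
      using L by (auto intro: op_span.base)
  next
    case (Cons b bs)
    then obtain M where M: "op_span B M" "\<And>f. f \<in> schwartz \<Longrightarrow> partial_derivs bs (L f) = M f"
      by auto
    obtain M' where "op_span B M'" "\<And>f. f \<in> schwartz \<Longrightarrow> partial_deriv b (M f) = M' f"
      using deriv'[OF M(1), of b] Cons by auto
    then show ?case
      using M by auto
  qed
  \<comment> \<open>The operator \<open>D bs\<close> is chosen once for all \<open>f\<close>: the
    estimates below must hold with one index and one constant for every \<open>f\<close>.\<close>
  then obtain D where D: "\<And>bs. set bs \<subseteq> Basis \<Longrightarrow> op_span B (D bs)"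
    "\<And>bs f. set bs \<subseteq> Basis \<Longrightarrow> f \<in> schwartz \<Longrightarrow> partial_derivs bs (L f) = D bs f"
    by metis
  have S: "L f \<in> schwartz" if "f \<in> schwartz" for f
    unfolding schwartz_iff smooth_fun_def
  proof (intro conjI ballI allI impI)
    fix bs x assume "bs \<in> lists (Basis :: 'b set)"
    then have "set bs \<subseteq> Basis"
      by auto
    then show "partial_derivs bs (L f) differentiable at x"
      using D[of bs] diff' that by simp
  next
    fix bs and k :: nat assume "set bs \<subseteq> (Basis :: 'b set)"
    then have "decay_bounded (D bs)" "partial_derivs bs (L f) = D bs f"
      using D that bound' by auto
    then show "\<exists>C. \<forall>x. norm x ^ k * norm (partial_derivs bs (L f) x) \<le> C"
      using that unfolding decay_bounded_def by metis
  qed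
  have "\<exists>m C. C \<ge> 0 \<and> (\<forall>f\<in>schwartz. snorm n (L f) \<le> C * snorm m f)" for n
  proof -
    let ?I = "{bs. set bs \<subseteq> (Basis :: 'b set) \<and> length bs \<le> n}"
    have "finite ?I"
      by (intro finite_lists_length_le finite_Basis)
    moreover have "decay_bounded (D bs)" if "bs \<in> ?I" for bs
      using that D(1) bound' by auto
    ultimately obtain m C where C: "C \<ge> 0"
      "\<And>bs k f x. bs \<in> ?I \<Longrightarrow> k \<le> n \<Longrightarrow> f \<in> schwartz \<Longrightarrow> norm x ^ k * norm (D bs f x) \<le> C * snorm m f"
      using decay_bounded_uniform[of ?I D n] by blast
    have "snorm n (L f) \<le> C * snorm m f" if "f \<in> schwartz" for f
      using C(2) that D(2) by (intro snorm_least) auto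
    then show ?thesis
      using C(1) by blast
  qed
  then show ?thesis
    using S add scale by (simp add: schwartz_op_def)
qed

text \<open>The families used with \<open>schwartz_op_criterion\<close> consist of one fixed
  operation applied after an arbitrary \<open>schwartz_op\<close>. This reduces their estimates to
  the fixed operation alone.\<close>

lemma decay_bounded_compose:
  assumes "decay_bounded L" "schwartz_op D"
  shows "decay_bounded (\<lambda>f. L (D f))"
  unfolding decay_bounded_def
proof
  fix k
  obtain m C where C: "C \<ge> 0" "\<And>f x. f \<in> schwartz \<Longrightarrow> norm x ^ k * norm (L f x) \<le> C * snorm m f"
    using assms(1) unfolding decay_bounded_def by blast
  obtain n E where E: "E \<ge> 0" "\<And>f. f \<in> schwartz \<Longrightarrow> snorm m (D f) \<le> E * snorm n f"
    using schwartz_opD(4)[OF assms(2), of m] by blast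
  have "norm x ^ k * norm (L (D f) x) \<le> (C * E) * snorm n f" if f: "f \<in> schwartz" for f x
    using order.trans[OF C(2)[OF schwartz_opD(1)[OF assms(2) f]] mult_left_mono[OF E(2)[OF f] C(1)]]
    by (simp add: mult.assoc)
  then show "\<exists>m C'. C' \<ge> 0 \<and> (\<forall>f\<in>schwartz. \<forall>x. norm x ^ k * norm (L (D f) x) \<le> C' * snorm m f)"
    using C(1) E(1) by (intro exI[of _ n] exI[of _ "C * E"]) simp
qed

section \<open>Composition with linear maps\<close>

text \<open>Injectivity bounds \<open>norm (A x)\<close> below by a multiple of
  \<open>norm x\<close>, so decay in \<open>A x\<close> is decay in \<open>x\<close>. By the chain
  rule a derivative is a combination of derivatives of \<open>f\<close> composed with
  \<open>A\<close>, which is why the family ranges over all \<open>D\<close>.\<close>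

lemma schwartz_op_compose_linear:
  fixes A :: "'a::euclidean_space \<Rightarrow> 'b::euclidean_space"
  assumes "linear A" "inj A"
  shows "schwartz_op (\<lambda>f x. f (A x))"
proof -
  let ?B = "{\<lambda>f x. D f (A x) | D :: ('b \<Rightarrow> complex) \<Rightarrow> ('b \<Rightarrow> complex). schwartz_op D}"
  have bl: "bounded_linear A"
    using assms(1) by (simp add: linear_conv_bounded_linear)
  obtain c where c: "c > 0" "\<And>x. c * norm x \<le> norm (A x)"
    using linear_inj_bounded_below_pos[OF assms] by blast
  have le: "norm x \<le> (1 / c) * norm (A x)" for x
    using c(1) c(2)[of x] by (simp add: field_simps)
  show ?thesis
  proof (rule schwartz_op_criterion[where B = ?B])
    show "(\<lambda>f x. f (A x)) \<in> ?B"
      using schwartz_op_id by (intro CollectI exI[of _ "\<lambda>f. f"] conjI refl)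
  next
    fix L :: "('b \<Rightarrow> complex) \<Rightarrow> 'a \<Rightarrow> complex" and f :: "'b \<Rightarrow> complex" and x :: 'a
    assume "L \<in> ?B" "f \<in> schwartz"
    then show "L f differentiable at x"
      using partial_deriv_compose_linear(2)[OF bl] schwartz_opD(1) schwartz_differentiable by blast
  next
    fix L :: "('b \<Rightarrow> complex) \<Rightarrow> 'a \<Rightarrow> complex" and b :: 'a
    assume "L \<in> ?B"
    then obtain D :: "('b \<Rightarrow> complex) \<Rightarrow> ('b \<Rightarrow> complex)" where D: "schwartz_op D" and L: "L = (\<lambda>f x. D f (A x))"
      by blast
    have "partial_deriv b (L f) x = (\<Sum>j\<in>Basis. complex_of_real (A b \<bullet> j) * partial_deriv j (D f) (A x))"
      if "f \<in> schwartz" for f x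
    proof -
      note diff = schwartz_differentiable[OF schwartz_opD(1)[OF D that]]
      show ?thesis
        unfolding L partial_deriv_compose_linear(1)[OF bl diff]
        by (subst partial_deriv_sum_Basis[OF diff]) (simp add: scaleR_conv_of_real)
    qed
    moreover have "(\<lambda>f x. partial_deriv j (D f) (A x)) \<in> ?B" if "j \<in> Basis" for j
      using schwartz_op_compose[OF schwartz_op_partial_deriv[OF that] D]
      by (intro CollectI exI[of _ "\<lambda>f. partial_deriv j (D f)"] conjI refl)
    then have "op_span ?B (\<lambda>f x. \<Sum>j\<in>Basis. complex_of_real (A b \<bullet> j) * partial_deriv j (D f) (A x))"
      by (intro op_span_sum op_span.scale op_span.base)
    ultimately show "\<exists>M. op_span ?B M \<and> (\<forall>f\<in>schwartz. \<forall>x. partial_deriv b (L f) x = M f x)"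
      by (intro exI[of _ "\<lambda>f x. \<Sum>j\<in>Basis. complex_of_real (A b \<bullet> j) * partial_deriv j (D f) (A x)"])
        simp
  next
    fix L :: "('b \<Rightarrow> complex) \<Rightarrow> 'a \<Rightarrow> complex"
    assume "L \<in> ?B"
    then obtain D :: "('b \<Rightarrow> complex) \<Rightarrow> ('b \<Rightarrow> complex)" where D: "schwartz_op D" and L: "L = (\<lambda>f x. D f (A x))"
      by blast
    have "decay_bounded (\<lambda>(f::'b \<Rightarrow> complex) x. f (A x))"
      unfolding decay_bounded_def
    proof (intro allI exI conjI ballI)
      fix k and f :: "'b \<Rightarrow> complex" and x
      assume f: "f \<in> schwartz"
      have "norm x ^ k * norm (f (A x)) \<le> ((1 / c) * norm (A x)) ^ k * norm (f (A x))"
        by (intro mult_right_mono power_mono le) auto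
      also have "\<dots> \<le> (1 / c) ^ k * (norm (A x) ^ k * norm (f (A x)))"
        by (simp add: power_divide algebra_simps)
      also have "\<dots> \<le> (1 / c) ^ k * snorm k f"
        using c(1) by (intro mult_left_mono snorm_upper0 f) auto
      finally show "norm x ^ k * norm (f (A x)) \<le> (1 / c) ^ k * snorm k f" .
    qed (use c(1) in auto)
    from decay_bounded_compose[OF this D] show "decay_bounded L"
      unfolding L .
  qed auto
qed

lemma schwartz_compose_linear:
  "f \<in> schwartz \<Longrightarrow> linear A \<Longrightarrow> inj A \<Longrightarrow> (\<lambda>x. f (A x)) \<in> schwartz"
  using schwartz_op_compose_linear schwartz_opD(1) by blast

section \<open>Multiplication by functions of moderate growth\<close>

text \<open>The space O_M of multipliers of the Schwartz space. The power may depend on the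
  derivative.\<close>

definition moderate :: "('a::euclidean_space \<Rightarrow> complex) set" where
  "moderate = {g. smooth_fun g \<and>
     (\<forall>bs. set bs \<subseteq> Basis \<longrightarrow> (\<exists>k C. \<forall>x. norm (partial_derivs bs g x) \<le> C * (1 + norm x) ^ k))}"

lemma moderate_smooth: "g \<in> moderate \<Longrightarrow> smooth_fun g"
  by (simp add: moderate_def)

lemma moderate_differentiable: "g \<in> moderate \<Longrightarrow> g differentiable at x"
  by (simp add: moderate_smooth smooth_fun_differentiable)

lemma moderate_bound:
  fixes g :: "'a::euclidean_space \<Rightarrow> complex"
  assumes "g \<in> moderate" "set bs \<subseteq> Basis"
  shows "\<exists>k C. C \<ge> 0 \<and> (\<forall>x. norm (partial_derivs bs g x) \<le> C * (1 + norm x) ^ k)"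
proof -
  obtain k C where C: "\<And>x. norm (partial_derivs bs g x) \<le> C * (1 + norm x) ^ k"
    using assms unfolding moderate_def by blast
  have "norm (partial_derivs bs g x) \<le> \<bar>C\<bar> * (1 + norm x) ^ k" for x
    using C[of x] mult_right_mono[OF abs_ge_self[of C], of "(1 + norm x) ^ k"] by simp
  then show ?thesis
    by (intro exI[of _ k] exI[of _ "\<bar>C\<bar>"]) simp
qed

lemma moderate_coinduct:
  assumes "g \<in> X"
    and "\<And>f x. f \<in> X \<Longrightarrow> f differentiable at x"
    and "\<And>f b. f \<in> X \<Longrightarrow> b \<in> Basis \<Longrightarrow> partial_deriv b f \<in> X"
    and "\<And>f. f \<in> X \<Longrightarrow> \<exists>k C. \<forall>x. norm (f x) \<le> C * (1 + norm x) ^ k"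
  shows "g \<in> moderate"
  using smooth_fun_coinduct[OF assms(1-3)] assms(4) by (auto simp: moderate_def)

lemma moderate_partial_deriv:
  fixes g :: "'a::euclidean_space \<Rightarrow> complex"
  assumes "g \<in> moderate" "b \<in> Basis"
  shows "partial_deriv b g \<in> moderate"
  unfolding moderate_def
proof (intro CollectI conjI allI impI)
  show "smooth_fun (partial_deriv b g)"
    by (simp add: assms moderate_smooth smooth_fun_partial_deriv)
  fix bs assume "set bs \<subseteq> (Basis :: 'a set)"
  then show "\<exists>k C. \<forall>x. norm (partial_derivs bs (partial_deriv b g) x) \<le> C * (1 + norm x) ^ k"
    using moderate_bound[OF assms(1), of "bs @ [b]"] assms(2) by (auto simp: partial_derivs_snoc)
qed

lemma schwartz_moderate: "f \<in> schwartz \<Longrightarrow> f \<in> moderate"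
  unfolding moderate_def
  using schwartz_bounded[of f _ 0] by (auto simp: schwartz_smooth intro!: exI[of _ "0::nat"])

lemma moderate_growth_add:
  fixes f g :: "'a::real_normed_vector \<Rightarrow> complex"
  assumes "\<exists>k C. \<forall>x. norm (f x) \<le> C * (1 + norm x) ^ k" "\<exists>k C. \<forall>x. norm (g x) \<le> C * (1 + norm x) ^ k"
  shows "\<exists>k C. \<forall>x. norm (f x + g x) \<le> C * (1 + norm x) ^ k"
proof -
  obtain k C where C: "\<And>x. norm (f x) \<le> C * (1 + norm x) ^ k"
    using assms(1) by blast
  obtain l D where D: "\<And>x. norm (g x) \<le> D * (1 + norm x) ^ l"
    using assms(2) by blast
  have "norm (f x + g x) \<le> (\<bar>C\<bar> + \<bar>D\<bar>) * (1 + norm x) ^ (max k l)" for x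
  proof -
    have "C * (1 + norm x) ^ k \<le> \<bar>C\<bar> * (1 + norm x) ^ max k l"
      "D * (1 + norm x) ^ l \<le> \<bar>D\<bar> * (1 + norm x) ^ max k l"
      by (intro mult_mono power_increasing; simp)+
    then show ?thesis
      using norm_triangle_ineq[of "f x" "g x"] C[of x] D[of x] by (simp add: algebra_simps)
  qed
  then show ?thesis
    by blast
qed

lemma moderate_growth_mult:
  fixes f g :: "'a::real_normed_vector \<Rightarrow> complex"
  assumes "\<exists>k C. \<forall>x. norm (f x) \<le> C * (1 + norm x) ^ k" "\<exists>k C. \<forall>x. norm (g x) \<le> C * (1 + norm x) ^ k"
  shows "\<exists>k C. \<forall>x. norm (f x * g x) \<le> C * (1 + norm x) ^ k"
proof -
  obtain k C where C: "\<And>x. norm (f x) \<le> C * (1 + norm x) ^ k"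
    using assms(1) by blast
  obtain l D where D: "\<And>x. norm (g x) \<le> D * (1 + norm x) ^ l"
    using assms(2) by blast
  have "norm (f x * g x) \<le> (C * D) * (1 + norm x) ^ (k + l)" for x
  proof -
    have "norm (f x) * norm (g x) \<le> (C * (1 + norm x) ^ k) * (D * (1 + norm x) ^ l)"
      using order.trans[OF norm_ge_zero C] by (intro mult_mono C D) auto
    then show ?thesis
      by (simp add: norm_mult power_add algebra_simps)
  qed
  then show ?thesis
    by blast
qed

lemma moderate_growth: "g \<in> moderate \<Longrightarrow> \<exists>k C. \<forall>x. norm (g x) \<le> C * (1 + norm x) ^ k"
  using moderate_bound[of g "[]"] by auto

lemma moderate_add:
  fixes f g :: "'a::euclidean_space \<Rightarrow> complex"
  assumes "f \<in> moderate" "g \<in> moderate"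
  shows "(\<lambda>x. f x + g x) \<in> moderate"
  unfolding moderate_def
proof (intro CollectI conjI allI impI)
  show "smooth_fun (\<lambda>x. f x + g x)"
    by (simp add: assms moderate_smooth smooth_fun_add)
  fix bs assume bs: "set bs \<subseteq> (Basis :: 'a set)"
  then show "\<exists>k C. \<forall>x. norm (partial_derivs bs (\<lambda>x. f x + g x) x) \<le> C * (1 + norm x) ^ k"
    unfolding partial_derivs_add[OF moderate_smooth[OF assms(1)] moderate_smooth[OF assms(2)] bs]
    using moderate_bound[OF assms(1) bs] moderate_bound[OF assms(2) bs]
    by (intro moderate_growth_add) blast+
qed

text \<open>Sums of products are stable under differentiation, so that the closure argument replaces
  the Leibniz formula of higher order.\<close>

inductive_set product_sums :: "('a::euclidean_space \<Rightarrow> complex) set" where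
  prod: "f \<in> moderate \<Longrightarrow> g \<in> moderate \<Longrightarrow> (\<lambda>x. f x * g x) \<in> product_sums"
| add: "h \<in> product_sums \<Longrightarrow> k \<in> product_sums \<Longrightarrow> (\<lambda>x. h x + k x) \<in> product_sums"

lemma moderate_mult:
  fixes f g :: "'a::euclidean_space \<Rightarrow> complex"
  assumes "f \<in> moderate" "g \<in> moderate"
  shows "(\<lambda>x. f x * g x) \<in> moderate"
proof (rule moderate_coinduct[of _ product_sums])
  show "(\<lambda>x. f x * g x) \<in> product_sums"
    by (intro product_sums.intros assms)
  show diff: "h differentiable at x" if "h \<in> product_sums" for h :: "'a \<Rightarrow> complex" and x
    using that by induction (auto intro: differentiable_mult differentiable_add moderate_differentiable)
  show "partial_deriv b h \<in> product_sums" if "h \<in> product_sums" "b \<in> Basis" for h :: "'a \<Rightarrow> complex" and b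
    using that
  proof induction
    case (prod f g)
    then have "partial_deriv b (\<lambda>x. f x * g x) = (\<lambda>x. f x * partial_deriv b g x + partial_deriv b f x * g x)"
      by (simp add: fun_eq_iff partial_deriv_mult moderate_differentiable)
    then show ?case
      using prod by (simp add: product_sums.intros moderate_partial_deriv)
  next
    case (add h k)
    then have "partial_deriv b (\<lambda>x. h x + k x) = (\<lambda>x. partial_deriv b h x + partial_deriv b k x)"
      by (simp add: fun_eq_iff partial_deriv_add diff)
    then show ?case
      using add by (simp add: product_sums.intros)
  qed
  show "\<exists>k C. \<forall>x. norm (h x) \<le> C * (1 + norm x) ^ k" if "h \<in> product_sums" for h :: "'a \<Rightarrow> complex"
    using that by induction (auto intro: moderate_growth_add moderate_growth_mult moderate_growth)
qed

lemma moderate_affine: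
  fixes l :: "'a::euclidean_space \<Rightarrow> complex"
  assumes "bounded_linear l"
  shows "(\<lambda>x. l x + c) \<in> moderate"
proof (rule moderate_coinduct[of _ "{\<lambda>x. l x + c | l c. bounded_linear l}"])
  show "(\<lambda>x. l x + c) \<in> {\<lambda>x. l x + c | l c. bounded_linear l}"
    using assms by blast
next
  fix f :: "'a \<Rightarrow> complex" and x b :: 'a
  assume "f \<in> {\<lambda>x. l x + c | l c. bounded_linear l}"
  then obtain l c where l: "bounded_linear l" and f: "f = (\<lambda>x. l x + c)"
    by blast
  have der: "(f has_derivative l) (at x)" for x
    unfolding f using bounded_linear_imp_has_derivative[OF l] has_derivative_add_const by blast
  then show "f differentiable at x"
    using differentiable_def by blast
  have "partial_deriv b f = (\<lambda>x. 0 + l b)"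
    using partial_deriv_eqI[OF der] by auto
  then show "partial_deriv b f \<in> {\<lambda>x. l x + c | l c. bounded_linear l}"
    by (intro CollectI exI[of _ "\<lambda>x. 0"] exI[of _ "l b"] conjI bounded_linear_zero)
  obtain K where K: "\<And>x. norm (l x) \<le> norm x * K" "K \<ge> 0"
    using bounded_linear.nonneg_bounded[OF l] by blast
  have "norm (f x) \<le> (K + norm c) * (1 + norm x) ^ 1" for x
  proof -
    have "norm (f x) \<le> norm x * K + norm c"
      using norm_triangle_ineq[of "l x" c] K(1)[of x] unfolding f by linarith
    also have "\<dots> \<le> norm x * K + norm c + (K + norm x * norm c)"
      using K(2) by (simp add: add_nonneg_nonneg)
    finally show ?thesis
      using K(2) mult_nonneg_nonneg[of "norm x" "norm c"] by (simp add: algebra_simps)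
  qed
  then show "\<exists>k C. \<forall>x. norm (f x) \<le> C * (1 + norm x) ^ k"
    by blast
qed

lemma moderate_linear: "bounded_linear l \<Longrightarrow> l \<in> moderate"
  using moderate_affine[of l 0] by simp

lemma moderate_const: "(\<lambda>x. c) \<in> moderate"
  using moderate_affine[OF bounded_linear_zero, of c] by simp

lemma moderate_inner: "(\<lambda>x. complex_of_real (l x \<bullet> b)) \<in> moderate" if "bounded_linear l"
  by (rule moderate_linear)
    (intro bounded_linear_compose[OF bounded_linear_of_real]
      bounded_linear_inner_left_comp that)

text \<open>All derivatives have the form of a moderate function times \<open>cis (q x)\<close>, and
  the second factor has modulus 1. Covers Fourier kernels, whose derivatives grow with the frequency
  when both variables are free.\<close>

lemma moderate_cis:
  fixes q :: "'a::euclidean_space \<Rightarrow> real"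
  assumes "\<And>x. (q has_derivative q' x) (at x)"
    and "\<And>b. b \<in> Basis \<Longrightarrow> (\<lambda>x. complex_of_real (q' x b)) \<in> moderate"
  shows "(\<lambda>x. cis (q x)) \<in> moderate"
proof (rule moderate_coinduct[of _ "{\<lambda>x. m x * cis (q x) | m. m \<in> moderate}"])
  show "(\<lambda>x. cis (q x)) \<in> {\<lambda>x. m x * cis (q x) | m. m \<in> moderate}"
    using moderate_const[of 1] by force
next
  fix f :: "'a \<Rightarrow> complex" and x b :: 'a
  assume "f \<in> {\<lambda>x. m x * cis (q x) | m. m \<in> moderate}"
  then obtain m where m: "m \<in> moderate" and f: "f = (\<lambda>x. m x * cis (q x))"
    by blast
  have der: "((\<lambda>x. cis (q x)) has_derivative (\<lambda>h. q' x h *\<^sub>R (\<i> * cis (q x)))) (at x)" for x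
    by (intro has_derivative_cis assms)
  then have diff: "(\<lambda>x. cis (q x)) differentiable at x" for x
    using differentiable_def by blast
  then show "f differentiable at x"
    unfolding f using moderate_differentiable[OF m] by (intro differentiable_mult)
  {
    assume b: "b \<in> Basis"
    have "partial_deriv b f = (\<lambda>x. (\<i> * of_real (q' x b) * m x + partial_deriv b m x) * cis (q x))"
      unfolding f
      by (simp add: fun_eq_iff partial_deriv_mult moderate_differentiable[OF m] diff
        partial_deriv_eqI[OF der] scaleR_conv_of_real algebra_simps)
    moreover have "(\<lambda>x. \<i> * of_real (q' x b) * m x + partial_deriv b m x) \<in> moderate"
      by (intro moderate_add moderate_mult moderate_const assms(2) m b moderate_partial_deriv)
    ultimately show "partial_deriv b f \<in> {\<lambda>x. m x * cis (q x) | m. m \<in> moderate}"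
      by (intro CollectI exI[of _ "\<lambda>x. \<i> * of_real (q' x b) * m x + partial_deriv b m x"] conjI)
  }
  show "\<exists>k C. \<forall>x. norm (f x) \<le> C * (1 + norm x) ^ k"
    using moderate_growth[OF m] unfolding f by (simp add: norm_mult)
qed

lemma partial_deriv_cis:
  assumes "(q has_derivative q') (at x)"
  shows "partial_deriv b (\<lambda>x. cis (q x)) x = \<i> * of_real (q' b) * cis (q x)"
    and "(\<lambda>x. cis (q x)) differentiable at x"
proof -
  note der = has_derivative_cis[OF assms]
  show "partial_deriv b (\<lambda>x. cis (q x)) x = \<i> * of_real (q' b) * cis (q x)"
    using partial_deriv_eqI[OF der] by (simp add: scaleR_conv_of_real)
  show "(\<lambda>x. cis (q x)) differentiable at x"
    using der unfolding differentiable_def by blast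
qed

lemma moderate_cis_bilinear:
  fixes l k :: "'a::euclidean_space \<Rightarrow> 'b::euclidean_space"
  assumes l: "bounded_linear l" and k: "bounded_linear k"
  shows "(\<lambda>x. cis (c * (l x \<bullet> k x))) \<in> moderate"
proof (rule moderate_cis)
  show "((\<lambda>x. c * (l x \<bullet> k x)) has_derivative (\<lambda>h. c * (l x \<bullet> k h + l h \<bullet> k x))) (at x)" for x
    using has_derivative_inner[OF bounded_linear_imp_has_derivative[OF l] bounded_linear_imp_has_derivative[OF k]]
    by (rule has_derivative_mult_right)
  show "(\<lambda>x. complex_of_real (c * (l x \<bullet> k b + l b \<bullet> k x))) \<in> moderate" for b
    by (intro moderate_linear bounded_linear_compose[OF bounded_linear_of_real] bounded_linear_const_mult
      bounded_linear_add bounded_linear_compose[OF bounded_linear_inner_right]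
      bounded_linear_compose[OF bounded_linear_inner_left] l k)
qed

lemma moderate_cis_linear:
  assumes l: "bounded_linear l"
  shows "(\<lambda>x. cis (c * (l x \<bullet> v))) \<in> moderate"
proof (rule moderate_cis)
  show "((\<lambda>x. c * (l x \<bullet> v)) has_derivative (\<lambda>h. c * (l h \<bullet> v))) (at x)" for x
    using has_derivative_inner_left[OF bounded_linear_imp_has_derivative[OF l]]
    by (rule has_derivative_mult_right)
qed (rule moderate_const)

lemma moderate_cis_inner: "(\<lambda>x. cis (c * (x \<bullet> v))) \<in> moderate"
  by (rule moderate_cis_linear[OF bounded_linear_ident])

text \<open>Growth bounds are stated with powers of \<open>1 + norm x\<close>, the norms with powers
  of \<open>norm x\<close>. The comparison distinguishes whether \<open>norm x\<close> exceeds
  1.\<close>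

lemma power_one_plus_norm_le: "(1 + norm x) ^ j \<le> 2 ^ j * (1 + norm x ^ j)"
proof (cases "norm x \<le> 1")
  case True
  then have "(1 + norm x) ^ j \<le> 2 ^ j"
    by (intro power_mono) auto
  then show ?thesis
    by (simp add: algebra_simps add_increasing2)
next
  case False
  then have "(1 + norm x) ^ j \<le> (2 * norm x) ^ j"
    by (intro power_mono) auto
  then show ?thesis
    by (simp add: algebra_simps power_mult_distrib add_increasing)
qed

lemma snorm_upper_weight:
  assumes "f \<in> schwartz"
  shows "(1 + norm x) ^ j * (norm x ^ k * norm (f x)) \<le> 2 ^ Suc j * snorm (k + j) f"
proof -
  have "(1 + norm x) ^ j * (norm x ^ k * norm (f x)) \<le>
      2 ^ j * (1 + norm x ^ j) * (norm x ^ k * norm (f x))"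
    by (intro mult_right_mono power_one_plus_norm_le) simp
  also have "\<dots> = 2 ^ j * (norm x ^ k * norm (f x) + norm x ^ (k + j) * norm (f x))"
    by (simp add: algebra_simps power_add)
  also have "\<dots> \<le> 2 ^ j * (snorm (k + j) f + snorm (k + j) f)"
    by (intro mult_left_mono add_mono snorm_upper0 assms) auto
  finally show ?thesis
    by simp
qed

lemma schwartz_op_mult:
  fixes g :: "'a::euclidean_space \<Rightarrow> complex"
  assumes "g \<in> moderate"
  shows "schwartz_op (\<lambda>f x. g x * f x)"
proof -
  let ?B = "{\<lambda>f x. h x * D f x | h D. h \<in> moderate \<and> schwartz_op D} :: (('a \<Rightarrow> complex) \<Rightarrow> ('a \<Rightarrow> complex)) set"
  show ?thesis
  proof (rule schwartz_op_criterion[where B = ?B])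
    show "(\<lambda>f x. g x * f x) \<in> ?B"
      using assms schwartz_op_id by (intro CollectI exI[of _ g] exI[of _ "\<lambda>f. f"] conjI refl)
  next
    fix L :: "('a \<Rightarrow> complex) \<Rightarrow> 'a \<Rightarrow> complex" and f :: "'a \<Rightarrow> complex" and x :: 'a
    assume "L \<in> ?B" "f \<in> schwartz"
    then show "L f differentiable at x"
      using moderate_differentiable schwartz_differentiable[OF schwartz_opD(1)]
      by (auto intro!: differentiable_mult)
  next
    fix L :: "('a \<Rightarrow> complex) \<Rightarrow> 'a \<Rightarrow> complex" and b :: 'a
    assume "L \<in> ?B" and b: "b \<in> Basis"
    then obtain h D where hD: "h \<in> moderate" "schwartz_op D" and L: "L = (\<lambda>f x. h x * D f x)"
      by blast
    have "partial_deriv b (L f) x = h x * partial_deriv b (D f) x + partial_deriv b h x * D f x"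
      if "f \<in> schwartz" for f x
      unfolding L by (intro partial_deriv_mult moderate_differentiable schwartz_differentiable hD
        schwartz_opD(1)[OF hD(2)] that)
    moreover have "(\<lambda>f x. h x * partial_deriv b (D f) x) \<in> ?B" "(\<lambda>f x. partial_deriv b h x * D f x) \<in> ?B"
      using hD moderate_partial_deriv[OF hD(1) b] schwartz_op_compose[OF schwartz_op_partial_deriv[OF b] hD(2)]
      by - (intro CollectI exI conjI; (rule refl | assumption))+
    ultimately show "\<exists>M. op_span ?B M \<and> (\<forall>f\<in>schwartz. \<forall>x. partial_deriv b (L f) x = M f x)"
      by (intro exI[of _ "\<lambda>f x. h x * partial_deriv b (D f) x + partial_deriv b h x * D f x"] conjI
        op_span.add op_span.base ballI allI)
  next
    fix L :: "('a \<Rightarrow> complex) \<Rightarrow> 'a \<Rightarrow> complex"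
    assume "L \<in> ?B"
    then obtain h D where hD: "h \<in> moderate" "schwartz_op D" and L: "L = (\<lambda>f x. h x * D f x)"
      by blast
    obtain j C where C: "C \<ge> 0" "\<And>x. norm (h x) \<le> C * (1 + norm x) ^ j"
      using moderate_bound[OF hD(1), of "[]"] by auto
    have "decay_bounded (\<lambda>f x. h x * f x)"
      unfolding decay_bounded_def
    proof (intro allI exI conjI ballI)
      fix k and f :: "'a \<Rightarrow> complex" and x
      assume f: "f \<in> schwartz"
      have "norm x ^ k * norm (h x * f x) \<le> norm x ^ k * ((C * (1 + norm x) ^ j) * norm (f x))"
        unfolding norm_mult by (intro mult_left_mono mult_right_mono C) auto
      also have "\<dots> = C * ((1 + norm x) ^ j * (norm x ^ k * norm (f x)))"
        by simp
      also have "\<dots> \<le> C * (2 ^ Suc j * snorm (k + j) f)"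
        by (intro mult_left_mono snorm_upper_weight f C)
      finally show "norm x ^ k * norm (h x * f x) \<le> (C * 2 ^ Suc j) * snorm (k + j) f"
        by (simp add: mult.assoc)
    qed (use C(1) in auto)
    from decay_bounded_compose[OF this hD(2)] show "decay_bounded L"
      unfolding L .
  qed (auto simp: algebra_simps)
qed

lemma schwartz_mult: "g \<in> moderate \<Longrightarrow> f \<in> schwartz \<Longrightarrow> (\<lambda>x. g x * f x) \<in> schwartz"
  using schwartz_op_mult schwartz_opD(1) by blast

section \<open>The Gaussian\<close>

definition gauss :: "'a::euclidean_space \<Rightarrow> complex" where
  "gauss x = of_real (exp (- (x \<bullet> x) / 2))"

lemma gauss_nonzero: "gauss x \<noteq> 0"
  by (simp add: gauss_def)

lemma gauss_zero: "gauss 0 = 1"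
  by (simp add: gauss_def)

lemma gauss_Pair: "gauss (x, y) = gauss x * gauss y"
  by (simp add: gauss_def diff_divide_distrib flip: exp_add of_real_mult)

lemma has_derivative_gauss: "(gauss has_derivative (\<lambda>h. of_real (- (x \<bullet> h)) * gauss x)) (at x)"
  unfolding gauss_def
  by (auto intro!: derivative_eq_intros simp: fun_eq_iff inner_commute algebra_simps)

lemma gauss_schwartz: "gauss \<in> (schwartz :: ('a::euclidean_space \<Rightarrow> complex) set)"
proof (rule schwartz_coinduct[of _ "{\<lambda>x. m x * gauss x | m. m \<in> moderate}"])
  show "gauss \<in> {\<lambda>x. m x * gauss x | m. m \<in> (moderate :: ('a \<Rightarrow> complex) set)}"
    using moderate_const[of 1] by force
next
  fix f :: "'a \<Rightarrow> complex" and x b :: 'a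
  assume "f \<in> {\<lambda>x. m x * gauss x | m. m \<in> moderate}"
  then obtain m where m: "m \<in> moderate" and f: "f = (\<lambda>x. m x * gauss x)"
    by blast
  have der: "(gauss has_derivative (\<lambda>h. of_real (- (x \<bullet> h)) * gauss x)) (at x)" for x :: 'a
    by (rule has_derivative_gauss)
  then have diff: "gauss differentiable at x" for x :: 'a
    using differentiable_def by blast
  then show "f differentiable at x"
    unfolding f using moderate_differentiable[OF m] by (intro differentiable_mult)
  {
    assume b: "b \<in> Basis"
    have "partial_deriv b f = (\<lambda>x. (of_real (x \<bullet> (- b)) * m x + partial_deriv b m x) * gauss x)"
      unfolding f
      by (simp add: fun_eq_iff partial_deriv_mult moderate_differentiable[OF m] diff
        partial_deriv_eqI[OF der] algebra_simps)
    moreover have "(\<lambda>x. of_real (x \<bullet> (- b)) * m x + partial_deriv b m x) \<in> moderate"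
      by (intro moderate_add moderate_mult m b moderate_partial_deriv moderate_inner bounded_linear_ident)
    ultimately show "partial_deriv b f \<in> {\<lambda>x. m x * gauss x | m. m \<in> moderate}"
      by (intro CollectI exI[of _ "\<lambda>x. of_real (x \<bullet> (- b)) * m x + partial_deriv b m x"] conjI)
  }
  fix k
  obtain j C where C: "C \<ge> 0" "\<And>x. norm (m x) \<le> C * (1 + norm x) ^ j"
    using moderate_bound[OF m, of "[]"] by auto
  \<comment> \<open>A single term of the exponential series bounds the n-th power of
    \<open>1 + norm x\<close> by \<open>fact n * exp (1 + norm x)\<close>, and completing the square
    bounds the Gaussian by \<open>exp (1 - norm x)\<close>. The exponents add up to 2.\<close>
  have "norm x ^ k * norm (f x) \<le> C * (fact (k + j) * exp 2)" for x
  proof -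
    have "(1 + norm x) ^ n \<le> fact n * exp (1 + norm x)" for n
    proof -
      have "(\<Sum>i\<in>{n}. (1 + norm x) ^ i /\<^sub>R fact i) \<le> exp (1 + norm x)"
        unfolding exp_def using exp_converges[of "1 + norm x"]
        by (intro sum_le_suminf) (auto simp: sums_iff)
      then show ?thesis
        by (simp add: field_simps)
    qed
    note * = this[of "k + j"]
    have "norm (gauss x) = exp (- (norm x ^ 2) / 2)"
      by (simp add: gauss_def power2_norm_eq_inner)
    also have "\<dots> \<le> exp (1 - norm x)"
    proof -
      have "0 \<le> (norm x - 1) ^ 2"
        by simp
      then show ?thesis
        unfolding exp_le_cancel_iff power2_diff by simp
    qed
    finally have g: "norm (gauss x) \<le> exp (1 - norm x)" .
    have "norm x ^ k * norm (f x) \<le> (1 + norm x) ^ k * ((C * (1 + norm x) ^ j) * norm (gauss x))"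
      unfolding f norm_mult by (intro mult_mono power_mono C) (auto simp: C)
    also have "\<dots> = C * ((1 + norm x) ^ (k + j) * norm (gauss x))"
      by (simp add: power_add)
    also have "\<dots> \<le> C * ((fact (k + j) * exp (1 + norm x)) * exp (1 - norm x))"
      by (intro mult_left_mono mult_mono * g C) auto
    also have "\<dots> = C * (fact (k + j) * exp 2)"
      by (simp flip: exp_add)
    finally show ?thesis .
  qed
  then show "\<exists>C. \<forall>x. norm x ^ k * norm (f x) \<le> C"
    by blast
qed

section \<open>Tensor products\<close>

definition tensor :: "('a \<Rightarrow> complex) \<Rightarrow> ('b \<Rightarrow> complex) \<Rightarrow> 'a \<times> 'b \<Rightarrow> complex" where
  "tensor f g = (\<lambda>p. f (fst p) * g (snd p))"

lemma partial_deriv_tensor: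
  fixes f :: "'a::euclidean_space \<Rightarrow> complex" and g :: "'b::euclidean_space \<Rightarrow> complex"
  assumes f: "\<And>x. f differentiable at x" and g: "\<And>y. g differentiable at y"
  shows "partial_deriv b (tensor f g) p =
      f (fst p) * partial_deriv (snd b) g (snd p) + partial_deriv (fst b) f (fst p) * g (snd p)"
    and "tensor f g differentiable at p"
proof -
  note 1 = partial_deriv_compose_linear[OF bounded_linear_fst f]
  note 2 = partial_deriv_compose_linear[OF bounded_linear_snd g]
  show "partial_deriv b (tensor f g) p =
      f (fst p) * partial_deriv (snd b) g (snd p) + partial_deriv (fst b) f (fst p) * g (snd p)"
    unfolding tensor_def by (subst partial_deriv_mult) (simp_all add: 1 2)
  show "tensor f g differentiable at p"
    unfolding tensor_def by (intro differentiable_mult 1 2)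
qed

text \<open>The norm of a pair \<open>p\<close> is at most
  \<open>(1 + norm (fst p)) * (1 + norm (snd p))\<close>, so the weight splits into one factor for
  \<open>f\<close> and one for the fixed function. Both \<open>h\<close> and \<open>D\<close> vary
  in the family because a basis vector of the product differentiates one factor or the
  other.\<close>

lemma schwartz_op_tensor_left:
  fixes g :: "'b::euclidean_space \<Rightarrow> complex"
  assumes "g \<in> schwartz"
  shows "schwartz_op (\<lambda>f::'a::euclidean_space \<Rightarrow> complex. tensor f g)"
proof -
  let ?B = "{\<lambda>f. tensor (D f) h | h D. h \<in> schwartz \<and> schwartz_op D} ::
    (('a \<Rightarrow> complex) \<Rightarrow> ('a \<times> 'b \<Rightarrow> complex)) set"
  show ?thesis
  proof (rule schwartz_op_criterion[where B = ?B])
    show "(\<lambda>f. tensor f g) \<in> ?B"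
      using assms schwartz_op_id by (intro CollectI exI[of _ g] exI[of _ "\<lambda>f. f"] conjI refl)
  next
    fix L :: "('a \<Rightarrow> complex) \<Rightarrow> 'a \<times> 'b \<Rightarrow> complex" and f :: "'a \<Rightarrow> complex" and x
    assume "L \<in> ?B" and f: "f \<in> schwartz"
    then obtain h D where hD: "h \<in> schwartz" "schwartz_op D" and L: "L = (\<lambda>f. tensor (D f) h)"
      by blast
    show "L f differentiable at x"
      unfolding L using schwartz_opD(1)[OF hD(2) f] hD(1)
      by (intro partial_deriv_tensor(2) schwartz_differentiable)
  next
    fix L :: "('a \<Rightarrow> complex) \<Rightarrow> 'a \<times> 'b \<Rightarrow> complex" and b :: "'a \<times> 'b"
    assume "L \<in> ?B" and b: "b \<in> Basis"
    then obtain h D where hD: "h \<in> schwartz" "schwartz_op D" and L: "L = (\<lambda>f. tensor (D f) h)"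
      by blast
    have deriv: "partial_deriv b (L f) x = D f (fst x) * partial_deriv (snd b) h (snd x)
      + partial_deriv (fst b) (D f) (fst x) * h (snd x)" if "f \<in> schwartz" for f x
      unfolding L using schwartz_opD(1)[OF hD(2) that] hD(1)
      by (intro partial_deriv_tensor(1) schwartz_differentiable)
    have zero: "partial_deriv 0 f x = 0" if "f \<in> schwartz" for f :: "'c::euclidean_space \<Rightarrow> complex" and x
      using linear_0[OF partial_deriv_linear[OF schwartz_differentiable[OF that]]] .
    consider "fst b \<in> Basis" "snd b = 0" | "fst b = 0" "snd b \<in> Basis"
      using b by (auto simp: Basis_prod_def)
    then obtain M where "M \<in> ?B" "\<forall>f\<in>schwartz. \<forall>x. partial_deriv b (L f) x = M f x"
    proof cases
      case 1
      have "(\<lambda>f. tensor (partial_deriv (fst b) (D f)) h) \<in> ?B"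
        using hD(1) schwartz_op_compose[OF schwartz_op_partial_deriv[OF 1(1)] hD(2)]
        by (intro CollectI exI[of _ h] exI[of _ "\<lambda>f. partial_deriv (fst b) (D f)"] conjI refl)
      then show thesis
        by (rule that) (auto simp: deriv zero hD(1) tensor_def 1(2))
    next
      case 2
      have "(\<lambda>f. tensor (D f) (partial_deriv (snd b) h)) \<in> ?B"
        using hD(2) partial_deriv_schwartz[OF hD(1) 2(2)]
        by (intro CollectI exI[of _ "partial_deriv (snd b) h"] exI[of _ D] conjI refl)
      then show thesis
        by (rule that) (auto simp: deriv zero schwartz_opD(1)[OF hD(2)] tensor_def 2(1))
    qed
    then show "\<exists>M. op_span ?B M \<and> (\<forall>f\<in>schwartz. \<forall>x. partial_deriv b (L f) x = M f x)"
      by (intro exI[of _ M] conjI op_span.base)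
  next
    fix L :: "('a \<Rightarrow> complex) \<Rightarrow> 'a \<times> 'b \<Rightarrow> complex"
    assume "L \<in> ?B"
    then obtain h D where hD: "h \<in> schwartz" "schwartz_op D" and L: "L = (\<lambda>f. tensor (D f) h)"
      by blast
    have "decay_bounded (\<lambda>f::'a \<Rightarrow> complex. tensor f h)"
      unfolding decay_bounded_def
    proof (intro allI exI conjI ballI)
      fix k
      show "0 \<le> 2 ^ Suc k * (2 ^ Suc k * snorm k h)"
        using snorm_nonneg[OF hD(1), of k] by simp
      fix f :: "'a \<Rightarrow> complex" and p :: "'a \<times> 'b"
      assume f: "f \<in> schwartz"
      have "norm p \<le> norm (fst p) + norm (snd p)"
        using norm_Pair_le[of "fst p" "snd p"] by simp
      also have "\<dots> \<le> (1 + norm (fst p)) * (1 + norm (snd p))"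
        by (simp add: algebra_simps)
      finally have "norm p ^ k \<le> (1 + norm (fst p)) ^ k * (1 + norm (snd p)) ^ k"
        unfolding power_mult_distrib[symmetric] by (intro power_mono) auto
      then have "norm p ^ k * norm (tensor f h p) \<le>
        (1 + norm (fst p)) ^ k * (1 + norm (snd p)) ^ k * (norm (f (fst p)) * norm (h (snd p)))"
        unfolding tensor_def norm_mult by (intro mult_right_mono) auto
      also have "\<dots> = ((1 + norm (fst p)) ^ k * norm (f (fst p))) * ((1 + norm (snd p)) ^ k * norm (h (snd p)))"
        by simp
      also have "\<dots> \<le> (2 ^ Suc k * snorm k f) * (2 ^ Suc k * snorm k h)"
        using snorm_upper_weight[OF f, of "fst p" k 0] snorm_upper_weight[OF hD(1), of "snd p" k 0]
          snorm_nonneg[OF f, of k]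
        by (rule_tac mult_mono) auto
      finally show "norm p ^ k * norm (tensor f h p) \<le> (2 ^ Suc k * (2 ^ Suc k * snorm k h)) * snorm k f"
        by (simp add: algebra_simps)
    qed
    from decay_bounded_compose[OF this hD(2)] show "decay_bounded L"
      unfolding L .
  qed (auto simp: tensor_def algebra_simps)
qed

lemma tensor_schwartz:
  fixes f :: "'a::euclidean_space \<Rightarrow> complex" and g :: "'b::euclidean_space \<Rightarrow> complex"
  shows "f \<in> schwartz \<Longrightarrow> g \<in> schwartz \<Longrightarrow> tensor f g \<in> schwartz"
  using schwartz_opD(1)[OF schwartz_op_tensor_left] by blast

lemma linear_swap: "linear prod.swap" and inj_swap: "inj prod.swap"
  by (auto intro!: linearI injI simp: prod.swap_def)

lemma schwartz_op_tensor_right: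
  fixes f :: "'a::euclidean_space \<Rightarrow> complex"
  assumes "f \<in> schwartz"
  shows "schwartz_op (\<lambda>g::'b::euclidean_space \<Rightarrow> complex. tensor f g)"
  using schwartz_op_compose[OF schwartz_op_compose_linear[OF linear_swap inj_swap]
      schwartz_op_tensor_left[OF assms]]
  by (rule schwartz_op_cong) (auto simp: tensor_def)

section \<open>Symmetry of second derivatives\<close>

lemma norm_diff_le_vector_derivative:
  fixes f :: "real \<Rightarrow> 'a::real_normed_vector"
  assumes "0 \<le> s"
    and der: "\<And>t. 0 \<le> t \<Longrightarrow> t \<le> s \<Longrightarrow> (f has_vector_derivative f' t) (at t)"
    and B: "\<And>t. 0 \<le> t \<Longrightarrow> t \<le> s \<Longrightarrow> norm (f' t) \<le> B"
  shows "norm (f s - f 0) \<le> B * s"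
proof -
  have "norm (f s - f 0) \<le> B * norm (s - 0)"
  proof (rule differentiable_bound[where S = "{0..s}" and f' = "\<lambda>t h. h *\<^sub>R f' t"])
    show "(f has_derivative (\<lambda>h. h *\<^sub>R f' t)) (at t within {0..s})" if "t \<in> {0..s}" for t
      using der[of t] that by (auto simp: has_vector_derivative_def intro: has_derivative_at_withinI)
    show "onorm (\<lambda>h. h *\<^sub>R f' t) \<le> B" if "t \<in> {0..s}" for t
    proof (rule onorm_le)
      show "norm (h *\<^sub>R f' t) \<le> B * norm h" for h
        using mult_left_mono[OF B[of t], of "norm h"] that by (simp add: mult.commute)
    qed
  qed (use assms in auto)
  then show ?thesis
    using assms(1) by simp
qed

lemma has_vector_derivative_along_line:
  assumes "f differentiable at (x + t *\<^sub>R b)"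
  shows "((\<lambda>t. f (x + t *\<^sub>R b)) has_vector_derivative partial_deriv b f (x + t *\<^sub>R b)) (at t)"
proof -
  have "((\<lambda>t. x + t *\<^sub>R b) has_derivative (\<lambda>h. h *\<^sub>R b)) (at t)"
    by (auto intro!: derivative_eq_intros)
  from has_derivative_compose[OF this differentiable_has_derivative[OF assms]]
  have "((\<lambda>t. f (x + t *\<^sub>R b)) has_derivative (\<lambda>h. partial_deriv (h *\<^sub>R b) f (x + t *\<^sub>R b))) (at t)" .
  then show ?thesis
    unfolding has_vector_derivative_def by (simp add: linear_scale[OF partial_deriv_linear[OF assms]])
qed

text \<open>In the direction \<open>b\<close> the difference has as derivative an increment of
  \<open>partial_deriv b f\<close> between two points at distance of order \<open>s\<close> from
  \<open>x\<close>. Differentiability at \<open>x\<close> linearises this increment up to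
  \<open>e * s\<close>, and the mean value inequality over an interval of length \<open>s\<close>
  supplies the second factor \<open>s\<close>.\<close>

lemma second_difference_estimate:
  fixes f :: "'a::euclidean_space \<Rightarrow> complex"
  assumes f: "\<And>x. f differentiable at x" and g: "partial_deriv b f differentiable at x" and e: "e > 0"
  shows "\<exists>d>0. \<forall>s. 0 < s \<longrightarrow> s < d \<longrightarrow>
    norm (f (x + s *\<^sub>R a + s *\<^sub>R b) - f (x + s *\<^sub>R b) - f (x + s *\<^sub>R a) + f x
      - (s * s) *\<^sub>R partial_deriv a (partial_deriv b f) x) \<le> e * (s * s)"
proof -
  define g where "g = partial_deriv b f"
  \<comment> \<open>Collects the distances of the two points from \<open>x\<close>, namely
    \<open>s * (norm a + norm b)\<close> and at most \<open>s * norm b\<close>; the summand 1 makes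
    it positive.\<close>
  define c where "c = norm a + 2 * norm b + 1"
  have c: "c > 0"
    by (simp add: c_def add_nonneg_pos)
  have "(g has_derivative (\<lambda>h. partial_deriv h g x)) (at x)"
    using differentiable_has_derivative[OF g] by (simp add: g_def)
  then obtain d where d: "d > 0"
    "\<And>y. norm (y - x) < d \<Longrightarrow> norm (g y - g x - partial_deriv (y - x) g x) \<le> (e / c) * norm (y - x)"
    using c e unfolding has_derivative_at_alt by (meson divide_pos_pos)
  have lin: "linear (\<lambda>h. partial_deriv h g x)"
    using partial_deriv_linear[OF g] by (simp add: g_def)
  show ?thesis
  proof (intro exI[of _ "d / c"] conjI allI impI)
    show "d / c > 0"
      using d c by simp
    fix s :: real assume s: "0 < s" "s < d / c"
    \<comment> \<open>The main term is subtracted in advance, so that \<open>F s - F 0\<close> is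
      the whole quantity to be estimated.\<close>
    define F where "F = (\<lambda>t. f (x + s *\<^sub>R a + t *\<^sub>R b) - f (x + t *\<^sub>R b) - t *\<^sub>R (s *\<^sub>R partial_deriv a g x))"
    have "norm (F s - F 0) \<le> (e * s) * s"
    proof (rule norm_diff_le_vector_derivative)
      fix t :: real assume t: "0 \<le> t" "t \<le> s"
      show "(F has_vector_derivative
          g (x + s *\<^sub>R a + t *\<^sub>R b) - g (x + t *\<^sub>R b) - s *\<^sub>R partial_deriv a g x) (at t)"
        unfolding F_def g_def
        by (intro has_vector_derivative_diff has_vector_derivative_along_line f)
          (auto intro!: derivative_eq_intros simp: has_vector_derivative_def)
      have tb: "t * norm b \<le> s * norm b"
        using t by (intro mult_right_mono) auto
      have n1: "norm (s *\<^sub>R a + t *\<^sub>R b) \<le> s * (norm a + norm b)"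
        using norm_triangle_ineq[of "s *\<^sub>R a" "t *\<^sub>R b"] s t tb by (simp add: algebra_simps)
      have n2: "norm (t *\<^sub>R b) \<le> s * norm b"
        using t tb by simp
      have sc: "s * c < d"
        using s c by (simp add: field_simps)
      have "s * (norm a + norm b) \<le> s * c" "s * norm b \<le> s * c"
        using s by (auto simp: c_def intro!: mult_left_mono)
      then have "norm (s *\<^sub>R a + t *\<^sub>R b) < d" "norm (t *\<^sub>R b) < d"
        using n1 n2 sc by linarith+
      then have 1: "norm (g (x + s *\<^sub>R a + t *\<^sub>R b) - g x - partial_deriv (s *\<^sub>R a + t *\<^sub>R b) g x)
          \<le> (e / c) * (s * (norm a + norm b))"
        and 2: "norm (g (x + t *\<^sub>R b) - g x - partial_deriv (t *\<^sub>R b) g x) \<le> (e / c) * (s * norm b)"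
        using d(2)[of "x + s *\<^sub>R a + t *\<^sub>R b"] d(2)[of "x + t *\<^sub>R b"] c e
          mult_left_mono[OF n1, of "e / c"] mult_left_mono[OF n2, of "e / c"]
        by (auto simp: add.assoc intro: order_trans)
      have eq: "g (x + s *\<^sub>R a + t *\<^sub>R b) - g (x + t *\<^sub>R b) - s *\<^sub>R partial_deriv a g x =
        (g (x + s *\<^sub>R a + t *\<^sub>R b) - g x - partial_deriv (s *\<^sub>R a + t *\<^sub>R b) g x) -
        (g (x + t *\<^sub>R b) - g x - partial_deriv (t *\<^sub>R b) g x)"
        by (simp add: linear_add[OF lin] linear_scale[OF lin])
      have "norm (g (x + s *\<^sub>R a + t *\<^sub>R b) - g (x + t *\<^sub>R b) - s *\<^sub>R partial_deriv a g x)
        \<le> (e / c) * (s * (norm a + norm b)) + (e / c) * (s * norm b)"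
        unfolding eq using norm_triangle_ineq4 1 2 by (meson add_mono order_trans)
      also have "\<dots> = (e / c) * s * (norm a + 2 * norm b)"
        by (simp add: algebra_simps)
      also have "\<dots> \<le> (e / c) * s * c"
        using e c s by (intro mult_left_mono) (auto simp: c_def)
      also have "\<dots> = e * s"
        using c by simp
      finally show "norm (g (x + s *\<^sub>R a + t *\<^sub>R b) - g (x + t *\<^sub>R b) - s *\<^sub>R partial_deriv a g x) \<le> e * s" .
    qed (use s in simp)
    then show "norm (f (x + s *\<^sub>R a + s *\<^sub>R b) - f (x + s *\<^sub>R b) - f (x + s *\<^sub>R a) + f x
      - (s * s) *\<^sub>R partial_deriv a (partial_deriv b f) x) \<le> e * (s * s)"
      by (simp add: F_def g_def algebra_simps)
  qed
qed

text \<open>Young's theorem: the second difference is symmetric in \<open>a\<close> and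
  \<open>b\<close>, and divided by \<open>s * s\<close> it approximates either mixed
  derivative.\<close>

lemma partial_deriv_commute:
  fixes f :: "'a::euclidean_space \<Rightarrow> complex"
  assumes f: "\<And>x. f differentiable at x"
    and fa: "partial_deriv a f differentiable at x" and fb: "partial_deriv b f differentiable at x"
  shows "partial_deriv a (partial_deriv b f) x = partial_deriv b (partial_deriv a f) x"
proof -
  let ?u = "partial_deriv a (partial_deriv b f) x" and ?v = "partial_deriv b (partial_deriv a f) x"
  have "norm (?u - ?v) \<le> 0 + e" if e: "e > 0" for e
  proof -
    obtain d1 where d1: "d1 > 0" "\<And>s. 0 < s \<Longrightarrow> s < d1 \<Longrightarrow>
      norm (f (x + s *\<^sub>R a + s *\<^sub>R b) - f (x + s *\<^sub>R b) - f (x + s *\<^sub>R a) + f x - (s * s) *\<^sub>R ?u) \<le> e / 2 * (s * s)"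
      using second_difference_estimate[where f = f and x = x and a = a and b = b and e = "e / 2"] f fb e by auto
    obtain d2 where d2: "d2 > 0" "\<And>s. 0 < s \<Longrightarrow> s < d2 \<Longrightarrow>
      norm (f (x + s *\<^sub>R b + s *\<^sub>R a) - f (x + s *\<^sub>R a) - f (x + s *\<^sub>R b) + f x - (s * s) *\<^sub>R ?v) \<le> e / 2 * (s * s)"
      using second_difference_estimate[where f = f and x = x and a = b and b = a and e = "e / 2"] f fa e by auto
    define s where "s = min d1 d2 / 2"
    have s: "0 < s" "s < d1" "s < d2"
      using d1(1) d2(1) by (auto simp: s_def)
    have "(s * s) *\<^sub>R (?v - ?u) =
      (f (x + s *\<^sub>R a + s *\<^sub>R b) - f (x + s *\<^sub>R b) - f (x + s *\<^sub>R a) + f x - (s * s) *\<^sub>R ?u) -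
      (f (x + s *\<^sub>R b + s *\<^sub>R a) - f (x + s *\<^sub>R a) - f (x + s *\<^sub>R b) + f x - (s * s) *\<^sub>R ?v)"
      by (simp add: algebra_simps)
    then have "norm ((s * s) *\<^sub>R (?v - ?u)) \<le> e / 2 * (s * s) + e / 2 * (s * s)"
      using order_trans[OF norm_triangle_ineq4 add_mono[OF d1(2)[OF s(1,2)] d2(2)[OF s(1,3)]]] by simp
    then have "(s * s) * norm (?v - ?u) \<le> (s * s) * e"
      unfolding norm_scaleR using s by (simp add: mult.commute)
    moreover have "s * s > 0"
      using s by simp
    ultimately have "norm (?v - ?u) \<le> e"
      by (simp only: mult_le_cancel_left_pos)
    then show ?thesis
      by (simp add: norm_minus_commute)
  qed
  then have "norm (?u - ?v) \<le> 0"
    by (rule field_le_epsilon)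
  then show ?thesis
    by simp
qed

lemma partial_derivs_commute:
  assumes "smooth_fun f" "set bs \<subseteq> Basis" "b \<in> Basis"
  shows "partial_deriv b (partial_derivs bs f) = partial_derivs bs (partial_deriv b f)"
  using assms(2)
proof (induction bs)
  case (Cons c bs)
  have "partial_derivs as f differentiable at x" if "set as \<subseteq> Basis" for as x
    using smooth_funD[OF assms(1) that] .
  from this[of bs] this[of "c # bs"] this[of "b # bs"]
  have "partial_deriv b (partial_deriv c (partial_derivs bs f)) = partial_deriv c (partial_deriv b (partial_derivs bs f))"
    using Cons.prems assms(3)
    by (intro ext partial_deriv_commute) auto
  then show ?case
    using Cons by simp
qed simp

section \<open>Integration of Schwartz functions\<close>

text \<open>With exponent 2 per dimension the function lies below the product over the basis of
  \<open>1 / (1 + (x \<bullet> b) ^ 2)\<close>, whose integral is a finite product of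
  one-dimensional ones.\<close>

definition weight :: "'a::euclidean_space \<Rightarrow> real" where
  "weight x = inverse ((1 + norm x) ^ (2 * DIM('a)))"

lemma weight_pos: "weight x > 0"
  by (simp add: weight_def add_pos_nonneg)

lemma weight_measurable [measurable]: "weight \<in> borel_measurable borel"
  unfolding weight_def by measurable

lemma integrable_weight: "integrable lborel (weight :: 'a::euclidean_space \<Rightarrow> real)"
proof (rule integrableI_bounded)
  let ?f = "\<lambda>x::real. inverse (1 + x ^ 2)"
  have "integrable lborel ?f"
    using integrable_inverse_1_plus_square by (simp add: set_integrable_def)
  then have fin: "(\<integral>\<^sup>+x. ennreal (?f x) \<partial>lborel) < \<infinity>"
    using integrableD(2)[of lborel ?f] by (simp add: less_top)
  have "(\<integral>\<^sup>+x. ennreal (norm (weight (x :: 'a))) \<partial>lborel) \<le>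
    (\<integral>\<^sup>+x. (\<Prod>b\<in>Basis. ennreal (?f ((x :: 'a) \<bullet> b))) \<partial>lborel)"
  proof (rule nn_integral_mono)
    fix x :: 'a
    have "(\<Prod>b\<in>Basis. 1 + (x \<bullet> b) ^ 2) \<le> (\<Prod>b\<in>(Basis :: 'a set). (1 + norm x) ^ 2)"
    proof (rule prod_mono)
      fix b :: 'a assume "b \<in> Basis"
      then have "(x \<bullet> b) ^ 2 \<le> norm x ^ 2"
        using Basis_le_norm[of b x] by (simp add: abs_le_square_iff[symmetric])
      then show "0 \<le> 1 + (x \<bullet> b) ^ 2 \<and> 1 + (x \<bullet> b) ^ 2 \<le> (1 + norm x) ^ 2"
        by (simp add: power2_sum add_increasing2)
    qed
    also have "\<dots> = (1 + norm x) ^ (2 * DIM('a))"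
      by (simp add: power_mult)
    finally have "weight x \<le> inverse (\<Prod>b\<in>Basis. 1 + (x \<bullet> b) ^ 2)"
      unfolding weight_def by (intro le_imp_inverse_le prod_pos) (auto intro: add_pos_nonneg)
    then have "ennreal (norm (weight x)) \<le> ennreal (\<Prod>b\<in>Basis. ?f (x \<bullet> b))"
      using weight_pos[of x] by (intro ennreal_leI) (simp add: prod_inversef[symmetric] o_def)
    then show "ennreal (norm (weight x)) \<le> (\<Prod>b\<in>Basis. ennreal (?f (x \<bullet> b)))"
      by (subst prod_ennreal) auto
  qed
  also have "\<dots> = (\<Prod>b\<in>(Basis :: 'a set). (\<integral>\<^sup>+x. ennreal (?f x) \<partial>lborel))"
    by (rule nn_integral_lborel_prod[where f = "\<lambda>b. ?f"]) auto
  also have "\<dots> < \<infinity>"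
    using fin by (simp add: power_less_top_ennreal)
  finally show "(\<integral>\<^sup>+x. ennreal (norm (weight (x :: 'a))) \<partial>lborel) < \<infinity>" .
qed simp

lemma schwartz_norm_le_weight:
  fixes f :: "'a::euclidean_space \<Rightarrow> complex"
  assumes "f \<in> schwartz"
  shows "norm (f x) \<le> 2 ^ Suc (2 * DIM('a)) * snorm (2 * DIM('a)) f * weight x"
proof -
  let ?N = "2 * DIM('a)"
  have "(1 + norm x) ^ ?N * norm (f x) \<le> 2 ^ Suc ?N * snorm ?N f"
    using snorm_upper_weight[OF assms, of x ?N 0] by simp
  moreover have "(1 + norm x) ^ ?N > 0"
    by (simp add: add_pos_nonneg)
  ultimately show ?thesis
    unfolding weight_def by (simp add: field_simps)
qed

lemma integrable_schwartz:
  fixes f :: "'a::euclidean_space \<Rightarrow> complex"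
  assumes "f \<in> schwartz"
  shows "integrable lborel f"
proof (rule Bochner_Integration.integrable_bound)
  show "integrable lborel (\<lambda>x::'a. 2 ^ Suc (2 * DIM('a)) * snorm (2 * DIM('a)) f * weight x)"
    by (intro integrable_mult_right integrable_weight)
  show "AE x in lborel. norm (f x) \<le> norm (2 ^ Suc (2 * DIM('a)) * snorm (2 * DIM('a)) f * weight x)"
    unfolding real_norm_def by (intro AE_I2 order_trans[OF schwartz_norm_le_weight[OF assms] abs_ge_self])
qed (use schwartz_borel_measurable[OF assms] in simp)

text \<open>Lets every result on applying a tempered distribution in one variable be read as a
  result on integrals with parameters.\<close>

lemma tempered_integral: "tempered (\<lambda>f::'a::euclidean_space \<Rightarrow> complex. \<integral>x. f x \<partial>lborel)"
proof (rule temperedI)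
  show "linear_on_schwartz (\<lambda>f::'a \<Rightarrow> complex. \<integral>x. f x \<partial>lborel)"
    by (simp add: linear_on_schwartz_def integrable_schwartz)
  fix f :: "'a \<Rightarrow> complex" assume f: "f \<in> schwartz"
  let ?N = "2 * DIM('a)"
  have "norm (\<integral>x. f x \<partial>lborel) \<le> (\<integral>x. 2 ^ Suc ?N * snorm ?N f * weight (x :: 'a) \<partial>lborel)"
    by (intro Bochner_Integration.integral_norm_bound_integral integrable_schwartz f
        integrable_mult_right integrable_weight schwartz_norm_le_weight)
  also have "\<dots> = (2 ^ Suc ?N * (\<integral>x. weight (x :: 'a) \<partial>lborel)) * snorm ?N f"
    by (simp add: mult_ac)
  finally show "norm (\<integral>x. f x \<partial>lborel) \<le> (2 ^ Suc ?N * (\<integral>x. weight (x :: 'a) \<partial>lborel)) * snorm ?N f" .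
qed

section \<open>Applying a tempered distribution in one variable\<close>

lemma has_derivative_Pair_right: "(Pair p has_derivative (\<lambda>h. (0, h))) (at y)"
proof -
  have "((\<lambda>y. (p, y)) has_derivative (\<lambda>h. (0, h))) (at y)"
    by (intro derivative_intros)
  then show ?thesis
    by simp
qed

lemma partial_deriv_slice:
  fixes F :: "'a::euclidean_space \<times> 'b::euclidean_space \<Rightarrow> complex"
  assumes "F differentiable at (p, y)"
  shows "partial_deriv b (\<lambda>y. F (p, y)) y = partial_deriv (0, b) F (p, y)"
    and "(\<lambda>y. F (p, y)) differentiable at y"
proof -
  have "((\<lambda>y. F (p, y)) has_derivative (\<lambda>h. partial_deriv (0, h) F (p, y))) (at y)"
    using has_derivative_compose[OF has_derivative_Pair_right differentiable_has_derivative[OF assms]] .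
  then show "partial_deriv b (\<lambda>y. F (p, y)) y = partial_deriv (0, b) F (p, y)"
    "(\<lambda>y. F (p, y)) differentiable at y"
    by (auto intro: partial_deriv_eqI simp: differentiable_def)
qed

lemma map_Pair_Basis: "set bs \<subseteq> Basis \<Longrightarrow> set (map (Pair 0) bs) \<subseteq> Basis"
  by (auto simp: Basis_prod_def)

lemma partial_derivs_slice:
  fixes F :: "'a::euclidean_space \<times> 'b::euclidean_space \<Rightarrow> complex"
  assumes "F \<in> schwartz" "set bs \<subseteq> Basis"
  shows "partial_derivs bs (\<lambda>y. F (p, y)) = (\<lambda>y. partial_derivs (map (Pair 0) bs) F (p, y))"
  using assms(2)
proof (induction bs)
  case (Cons b bs)
  then have "partial_derivs (map (Pair 0) bs) F differentiable at (p, y)" for y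
    using smooth_funD[OF schwartz_smooth[OF assms(1)] map_Pair_Basis] by auto
  then show ?case
    using Cons by (simp add: partial_deriv_slice(1))
qed simp

lemma slice_schwartz:
  fixes F :: "'a::euclidean_space \<times> 'b::euclidean_space \<Rightarrow> complex"
  assumes "F \<in> schwartz"
  shows "(\<lambda>y. F (p, y)) \<in> schwartz"
  unfolding schwartz_iff smooth_fun_def
proof (intro conjI ballI allI impI)
  fix bs y assume "bs \<in> lists (Basis :: 'b set)"
  then have bs: "set bs \<subseteq> Basis"
    by auto
  show "partial_derivs bs (\<lambda>y. F (p, y)) differentiable at y"
    unfolding partial_derivs_slice[OF assms bs]
    by (intro partial_deriv_slice(2) smooth_funD[OF schwartz_smooth[OF assms] map_Pair_Basis] bs)
next
  fix bs and k :: nat assume bs: "set bs \<subseteq> (Basis :: 'b set)"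
  obtain C where C: "\<And>x. norm x ^ k * norm (partial_derivs (map (Pair 0) bs) F x) \<le> C"
    using schwartz_bounded[OF assms map_Pair_Basis[OF bs], of k] by blast
  have "norm y ^ k * norm (partial_derivs (map (Pair 0) bs) F (p, y)) \<le>
    norm (p, y) ^ k * norm (partial_derivs (map (Pair 0) bs) F (p, y))" for y
    using norm_snd_le[of y p] by (intro mult_right_mono power_mono) auto
  then show "\<exists>C. \<forall>y. norm y ^ k * norm (partial_derivs bs (\<lambda>y. F (p, y)) y) \<le> C"
    unfolding partial_derivs_slice[OF assms bs] using C order_trans by blast
qed

text \<open>Since \<open>norm p\<close> is at most the norm of the pair, \<open>j\<close> powers of
  it are absorbed by the weights of \<open>F\<close>, at the price of raising the index by
  \<open>j\<close>. This is the source of decay in \<open>p\<close> for functionals applied to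
  slices.\<close>

lemma snorm_slice:
  fixes F :: "'a::euclidean_space \<times> 'b::euclidean_space \<Rightarrow> complex"
  assumes "F \<in> schwartz"
  shows "norm p ^ j * snorm n (\<lambda>y. F (p, y)) \<le> snorm (n + j) F"
proof (cases "norm p ^ j = 0")
  case True
  then show ?thesis
    using snorm_nonneg[OF assms, of "n + j"] by (simp only: mult_zero_left)
next
  case False
  then have pos: "norm p ^ j > 0"
    using zero_le_power[OF norm_ge_zero, of p j] by linarith
  have "snorm n (\<lambda>y. F (p, y)) \<le> snorm (n + j) F / norm p ^ j"
  proof (rule snorm_least)
    fix k bs y assume *: "k \<le> n" "set bs \<subseteq> (Basis :: 'b set)" "length bs \<le> n"
    have "norm p ^ j * (norm y ^ k * norm (partial_derivs (map (Pair 0) bs) F (p, y))) \<le>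
      norm (p, y) ^ j * (norm (p, y) ^ k * norm (partial_derivs (map (Pair 0) bs) F (p, y)))"
      using norm_snd_le[of y p] norm_fst_le[of p y]
      by (intro mult_mono power_mono order.refl) auto
    also have "\<dots> = norm (p, y) ^ (k + j) * norm (partial_derivs (map (Pair 0) bs) F (p, y))"
      by (simp add: power_add)
    also have "\<dots> \<le> snorm (n + j) F"
      using * map_Pair_Basis[of bs] by (intro snorm_upper assms) auto
    finally show "norm y ^ k * norm (partial_derivs bs (\<lambda>y. F (p, y)) y) \<le> snorm (n + j) F / norm p ^ j"
      using pos by (simp add: partial_derivs_slice[OF assms *(2)] field_simps)
  qed
  then show ?thesis
    using pos by (simp add: field_simps)
qed

section \<open>Taylor estimates in the first variable, uniform in the second\<close>

lemma norm_partial_deriv_le: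
  fixes F :: "'a::euclidean_space \<times> 'b::euclidean_space \<Rightarrow> complex"
  assumes "F differentiable at z" "0 \<le> c"
    and "\<And>b. b \<in> Basis \<Longrightarrow> c * norm (partial_deriv (b, 0) F z) \<le> B"
  shows "c * norm (partial_deriv (h, 0) F z) \<le> real DIM('a) * norm h * B"
proof -
  note lin = partial_deriv_linear[OF assms(1)]
  have "(h, 0) = (\<Sum>b\<in>Basis. (h \<bullet> b) *\<^sub>R (b, 0 :: 'b))"
    by (simp add: prod_eq_iff fst_sum snd_sum euclidean_representation)
  then have "partial_deriv (h, 0) F z = (\<Sum>b\<in>Basis. (h \<bullet> b) *\<^sub>R partial_deriv (b, 0) F z)"
    by (simp only: linear_sum[OF lin] linear_scale[OF lin])
  then have "c * norm (partial_deriv (h, 0) F z) \<le> c * (\<Sum>b\<in>Basis. \<bar>h \<bullet> b\<bar> * norm (partial_deriv (b, 0) F z))"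
    using assms(2) by (auto intro!: mult_left_mono order_trans[OF norm_sum])
  also have "\<dots> = (\<Sum>b\<in>Basis. \<bar>h \<bullet> b\<bar> * (c * norm (partial_deriv (b, 0) F z)))"
    by (simp add: sum_distrib_left mult_ac)
  also have "\<dots> \<le> (\<Sum>b\<in>(Basis :: 'a set). norm h * B)"
  proof (rule sum_mono)
    fix b :: 'a assume b: "b \<in> Basis"
    have "0 \<le> B"
      using order_trans[OF _ assms(3)[OF b]] assms(2) by simp
    then show "\<bar>h \<bullet> b\<bar> * (c * norm (partial_deriv (b, 0) F z)) \<le> norm h * B"
      using assms(2,3) b Basis_le_norm[OF b, of h] by (intro mult_mono) auto
  qed
  finally show ?thesis
    by simp
qed

text \<open>The weight \<open>norm y ^ k\<close> is constant along the segment from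
  \<open>(p, y)\<close> to \<open>(p + h, y)\<close> and is dominated by the weight of each of its
  points, so the mean value inequality applies with the weight included.\<close>

lemma slice_difference_bound:
  fixes F :: "'a::euclidean_space \<times> 'b::euclidean_space \<Rightarrow> complex"
  assumes diff: "\<And>z. F differentiable at z"
    and B: "\<And>z b. b \<in> Basis \<Longrightarrow> norm z ^ k * norm (partial_deriv (b, 0) F z) \<le> B"
  shows "norm y ^ k * norm (F (p + h, y) - F (p, y)) \<le> real DIM('a) * norm h * B"
proof -
  let ?f = "\<lambda>t. norm y ^ k *\<^sub>R F ((p, y) + t *\<^sub>R (h, 0))"
  have "norm (?f 1 - ?f 0) \<le> (real DIM('a) * norm h * B) * 1"
  proof (rule norm_diff_le_vector_derivative)
    fix t :: real
    show "(?f has_vector_derivative norm y ^ k *\<^sub>R partial_deriv (h, 0) F ((p, y) + t *\<^sub>R (h, 0))) (at t)"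
      by (rule bounded_linear.has_vector_derivative[OF bounded_linear_scaleR_right])
        (rule has_vector_derivative_along_line[OF diff])
    have "norm y ^ k * norm (partial_deriv (h, 0) F ((p, y) + t *\<^sub>R (h, 0))) \<le> real DIM('a) * norm h * B"
    proof (rule norm_partial_deriv_le[OF diff])
      fix b :: 'a assume b: "b \<in> Basis"
      have "norm y ^ k * norm (partial_deriv (b, 0) F ((p, y) + t *\<^sub>R (h, 0))) \<le>
        norm ((p, y) + t *\<^sub>R (h, 0)) ^ k * norm (partial_deriv (b, 0) F ((p, y) + t *\<^sub>R (h, 0)))"
        using norm_snd_le[of y "p + t *\<^sub>R h"] by (intro mult_right_mono power_mono) auto
      then show "norm y ^ k * norm (partial_deriv (b, 0) F ((p, y) + t *\<^sub>R (h, 0))) \<le> B"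
        using B[OF b] order_trans by blast
    qed simp
    then show "norm (norm y ^ k *\<^sub>R partial_deriv (h, 0) F ((p, y) + t *\<^sub>R (h, 0))) \<le> real DIM('a) * norm h * B"
      by simp
  qed simp
  then show ?thesis
    by (simp flip: scaleR_diff_right)
qed

text \<open>The derivative of the remainder along the segment is a difference of first derivatives,
  to which the first-order estimate applies. Each of the two steps contributes a factor
  \<open>real DIM('a) * norm h\<close>.\<close>

lemma slice_taylor_bound:
  fixes F :: "'a::euclidean_space \<times> 'b::euclidean_space \<Rightarrow> complex"
  assumes diff: "\<And>z. F differentiable at z"
    and diff2: "\<And>z b. b \<in> Basis \<Longrightarrow> partial_deriv (b, 0) F differentiable at z"
    and B: "\<And>z b c. b \<in> Basis \<Longrightarrow> c \<in> Basis \<Longrightarrow>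
      norm z ^ k * norm (partial_deriv (c, 0) (partial_deriv (b, 0) F) z) \<le> B"
  shows "norm y ^ k * norm (F (p + h, y) - F (p, y) - (\<Sum>b\<in>Basis. of_real (h \<bullet> b) * partial_deriv (b, 0) F (p, y)))
    \<le> (real DIM('a) * norm h) ^ 2 * B"
proof -
  let ?D = "\<lambda>z. \<Sum>b\<in>Basis. of_real (h \<bullet> b) * partial_deriv (b, 0) F z"
  have D: "partial_deriv (h, 0) F z = ?D z" for z
  proof -
    note lin = partial_deriv_linear[OF diff[of z]]
    have "(h, 0) = (\<Sum>b\<in>Basis. (h \<bullet> b) *\<^sub>R (b, 0 :: 'b))"
      by (simp add: prod_eq_iff fst_sum snd_sum euclidean_representation)
    then have "partial_deriv (h, 0) F z = (\<Sum>b\<in>Basis. (h \<bullet> b) *\<^sub>R partial_deriv (b, 0) F z)"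
      by (simp only: linear_sum[OF lin] linear_scale[OF lin])
    then show ?thesis
      by (simp add: scaleR_conv_of_real)
  qed
  have B0: "0 \<le> B"
    using order_trans[OF _ B[OF SOME_Basis SOME_Basis, of 0]] by simp
  let ?f = "\<lambda>t. norm y ^ k *\<^sub>R (F ((p, y) + t *\<^sub>R (h, 0)) - t *\<^sub>R ?D (p, y))"
  have "norm (?f 1 - ?f 0) \<le> ((real DIM('a) * norm h) ^ 2 * B) * 1"
  proof (rule norm_diff_le_vector_derivative)
    fix t :: real assume t: "0 \<le> t" "t \<le> 1"
    show "(?f has_vector_derivative norm y ^ k *\<^sub>R (?D ((p, y) + t *\<^sub>R (h, 0)) - ?D (p, y))) (at t)"
    proof (rule bounded_linear.has_vector_derivative[OF bounded_linear_scaleR_right])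
      show "((\<lambda>t. F ((p, y) + t *\<^sub>R (h, 0)) - t *\<^sub>R ?D (p, y)) has_vector_derivative
        ?D ((p, y) + t *\<^sub>R (h, 0)) - ?D (p, y)) (at t)"
        unfolding D[symmetric]
        by (rule has_vector_derivative_diff[OF has_vector_derivative_along_line[OF diff]])
          (auto intro!: derivative_eq_intros simp: has_vector_derivative_def)
    qed
    have "norm y ^ k * norm (?D (p + t *\<^sub>R h, y) - ?D (p, y)) \<le> (real DIM('a) * norm h) ^ 2 * B"
    proof -
      have "norm y ^ k * norm (?D (p + t *\<^sub>R h, y) - ?D (p, y)) =
        norm y ^ k * norm (\<Sum>b\<in>Basis. of_real (h \<bullet> b) * (partial_deriv (b, 0) F (p + t *\<^sub>R h, y) - partial_deriv (b, 0) F (p, y)))"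
        by (simp add: sum_subtractf algebra_simps)
      also have "\<dots> \<le> norm y ^ k * (\<Sum>b\<in>Basis. \<bar>h \<bullet> b\<bar> * norm (partial_deriv (b, 0) F (p + t *\<^sub>R h, y) - partial_deriv (b, 0) F (p, y)))"
        by (intro mult_left_mono order_trans[OF norm_sum]) (auto simp: norm_mult)
      also have "\<dots> = (\<Sum>b\<in>Basis. \<bar>h \<bullet> b\<bar> * (norm y ^ k * norm (partial_deriv (b, 0) F (p + t *\<^sub>R h, y) - partial_deriv (b, 0) F (p, y))))"
        by (simp add: sum_distrib_left mult_ac)
      also have "\<dots> \<le> (\<Sum>b\<in>(Basis :: 'a set). norm h * (real DIM('a) * norm h * B))"
      proof (rule sum_mono)
        fix b :: 'a assume b: "b \<in> Basis"
        have "norm y ^ k * norm (partial_deriv (b, 0) F (p + t *\<^sub>R h, y) - partial_deriv (b, 0) F (p, y))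
          \<le> real DIM('a) * norm (t *\<^sub>R h) * B"
          by (intro slice_difference_bound diff2 B b)
        also have "\<dots> \<le> real DIM('a) * norm h * B"
          using t B0 by (intro mult_right_mono mult_left_mono) (auto simp: mult_left_le_one_le)
        finally show "\<bar>h \<bullet> b\<bar> * (norm y ^ k * norm (partial_deriv (b, 0) F (p + t *\<^sub>R h, y) - partial_deriv (b, 0) F (p, y)))
          \<le> norm h * (real DIM('a) * norm h * B)"
          using Basis_le_norm[OF b, of h] by (rule_tac mult_mono) auto
      qed
      also have "\<dots> = (real DIM('a) * norm h) ^ 2 * B"
        by (simp add: power2_eq_square)
      finally show ?thesis .
    qed
    then show "norm (norm y ^ k *\<^sub>R (?D ((p, y) + t *\<^sub>R (h, 0)) - ?D (p, y))) \<le> (real DIM('a) * norm h) ^ 2 * B"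
      by simp
  qed simp
  then show ?thesis
    by (simp add: algebra_simps flip: scaleR_diff_right)
qed

lemma Pair_Basis: "b \<in> Basis \<Longrightarrow> (b, 0) \<in> Basis" "c \<in> Basis \<Longrightarrow> (0, c) \<in> Basis"
  by (auto simp: Basis_prod_def)

lemma partial_derivs_diff:
  assumes "smooth_fun f" "smooth_fun g" "set bs \<subseteq> Basis"
  shows "partial_derivs bs (\<lambda>x. f x - g x) = (\<lambda>x. partial_derivs bs f x - partial_derivs bs g x)"
  using partial_derivs_add[OF assms(1) smooth_fun_cmult[OF assms(2), of "-1"] assms(3)]
    partial_derivs_cmult[OF assms(2,3), of "-1"] by simp

lemma snorm_slice_difference:
  fixes F :: "'a::euclidean_space \<times> 'b::euclidean_space \<Rightarrow> complex"
  assumes F: "F \<in> schwartz"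
  shows "snorm n (\<lambda>y. F (p + h, y) - F (p, y)) \<le> real DIM('a) * norm h * snorm (n + 1) F"
proof (rule snorm_least)
  fix k bs y assume *: "k \<le> n" "set bs \<subseteq> (Basis :: 'b set)" "length bs \<le> n"
  define G where "G = partial_derivs (map (Pair 0) bs) F"
  have bs: "set (map (Pair 0) bs) \<subseteq> (Basis :: ('a \<times> 'b) set)"
    using *(2) map_Pair_Basis by blast
  have "G \<in> schwartz"
    unfolding G_def by (intro partial_derivs_schwartz F bs)
  moreover have "norm z ^ k * norm (partial_deriv (b, 0) G z) \<le> snorm (n + 1) F" if "b \<in> Basis" for b z
    using snorm_upper[OF F, of k "n + 1" "(b, 0) # map (Pair 0) bs" z] * bs that Pair_Basis(1)[OF that]
    by (simp add: G_def)
  ultimately have "norm y ^ k * norm (G (p + h, y) - G (p, y)) \<le> real DIM('a) * norm h * snorm (n + 1) F"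
    by (intro slice_difference_bound schwartz_differentiable)
  moreover have "partial_derivs bs (\<lambda>y. F (p + h, y) - F (p, y)) y = G (p + h, y) - G (p, y)"
    unfolding partial_derivs_diff[OF schwartz_smooth[OF slice_schwartz[OF F]] schwartz_smooth[OF slice_schwartz[OF F]] *(2)]
    by (simp add: partial_derivs_slice[OF F *(2)] G_def)
  ultimately show "norm y ^ k * norm (partial_derivs bs (\<lambda>y. F (p + h, y) - F (p, y)) y) \<le>
      real DIM('a) * norm h * snorm (n + 1) F"
    by simp
qed

lemma partial_derivs_sum:
  assumes "\<And>i. i \<in> I \<Longrightarrow> f i \<in> schwartz" "set bs \<subseteq> Basis"
  shows "partial_derivs bs (\<lambda>x. \<Sum>i\<in>I. c i * f i x) = (\<lambda>x. \<Sum>i\<in>I. c i * partial_derivs bs (f i) x)"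
  using assms(1)
proof (induction I rule: infinite_finite_induct)
  case (insert i I)
  then have "smooth_fun (\<lambda>x. c i * f i x)" "smooth_fun (\<lambda>x. \<Sum>i\<in>I. c i * f i x)"
    by (auto intro!: schwartz_smooth schwartz_cmult schwartz_sum)
  then show ?case
    using insert by (simp add: partial_derivs_add partial_derivs_cmult schwartz_smooth assms(2))
qed (use partial_derivs_cmult[OF schwartz_smooth[OF schwartz_zero] assms(2), of 0] in simp_all)

text \<open>Derivatives in \<open>y\<close> of the Taylor remainder of \<open>F\<close> are Taylor
  remainders of the function \<open>G\<close> differentiated in \<open>y\<close>. This exchanges
  derivatives in the two variables and is where their symmetry enters.\<close>

lemma snorm_slice_taylor:
  fixes F :: "'a::euclidean_space \<times> 'b::euclidean_space \<Rightarrow> complex"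
  assumes F: "F \<in> schwartz"
  shows "snorm n (\<lambda>y. F (p + h, y) - F (p, y) - (\<Sum>b\<in>Basis. of_real (h \<bullet> b) * partial_deriv (b, 0) F (p, y)))
    \<le> (real DIM('a) * norm h) ^ 2 * snorm (n + 2) F"
proof (rule snorm_least)
  fix k bs y assume *: "k \<le> n" "set bs \<subseteq> (Basis :: 'b set)" "length bs \<le> n"
  define G where "G = partial_derivs (map (Pair 0) bs) F"
  have bs: "set (map (Pair 0) bs) \<subseteq> (Basis :: ('a \<times> 'b) set)"
    using *(2) map_Pair_Basis by blast
  have G: "G \<in> schwartz"
    unfolding G_def by (intro partial_derivs_schwartz F bs)
  have "norm z ^ k * norm (partial_deriv (c, 0) (partial_deriv (b, 0) G) z) \<le> snorm (n + 2) F"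
    if "b \<in> Basis" "c \<in> Basis" for b c z
    using snorm_upper[OF F, of k "n + 2" "(c, 0) # (b, 0) # map (Pair 0) bs" z] * bs
      Pair_Basis(1)[OF that(1), where 'b = 'b] Pair_Basis(1)[OF that(2), where 'b = 'b]
    by (simp add: G_def)
  then have "norm y ^ k * norm (G (p + h, y) - G (p, y) - (\<Sum>b\<in>Basis. of_real (h \<bullet> b) * partial_deriv (b, 0) G (p, y)))
      \<le> (real DIM('a) * norm h) ^ 2 * snorm (n + 2) F"
    by (intro slice_taylor_bound schwartz_differentiable partial_deriv_schwartz G Pair_Basis)
  moreover have "partial_derivs bs (\<lambda>y. F (p + h, y) - F (p, y) -
      (\<Sum>b\<in>Basis. of_real (h \<bullet> b) * partial_deriv (b, 0) F (p, y))) y =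
    G (p + h, y) - G (p, y) - (\<Sum>b\<in>Basis. of_real (h \<bullet> b) * partial_deriv (b, 0) G (p, y))"
  proof -
    have b: "partial_deriv (b, 0) F \<in> schwartz" if "b \<in> (Basis :: 'a set)" for b
      using that by (intro partial_deriv_schwartz F Pair_Basis)
    have c: "partial_deriv (b, 0) G = partial_derivs (map (Pair 0) bs) (partial_deriv (b, 0) F)"
      if "b \<in> (Basis :: 'a set)" for b
      unfolding G_def using that bs by (intro partial_derivs_commute schwartz_smooth F Pair_Basis)
    have s: "(\<lambda>y. F (p + h, y) - F (p, y)) \<in> schwartz"
      "(\<lambda>y. \<Sum>b\<in>Basis. of_real (h \<bullet> b) * partial_deriv (b, 0) F (p, y)) \<in> schwartz"
      by (intro schwartz_diff schwartz_sum schwartz_cmult slice_schwartz F b; assumption?)+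
    show ?thesis
      unfolding partial_derivs_diff[OF schwartz_smooth[OF s(1)] schwartz_smooth[OF s(2)] *(2)]
        partial_derivs_diff[OF schwartz_smooth[OF slice_schwartz[OF F]] schwartz_smooth[OF slice_schwartz[OF F]] *(2)]
      by (subst partial_derivs_sum)
        (auto simp: slice_schwartz b c[unfolded G_def] partial_derivs_slice F *(2) G_def)
  qed
  ultimately show "norm y ^ k * norm (partial_derivs bs (\<lambda>y. F (p + h, y) - F (p, y) -
      (\<Sum>b\<in>Basis. of_real (h \<bullet> b) * partial_deriv (b, 0) F (p, y))) y) \<le>
      (real DIM('a) * norm h) ^ 2 * snorm (n + 2) F"
    by simp
qed

lemma has_derivative_quadraticI:
  fixes f :: "'a::real_normed_vector \<Rightarrow> 'b::real_normed_vector"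
  assumes "bounded_linear f'" and C: "\<And>h. norm (f (x + h) - f x - f' h) \<le> C * norm h ^ 2"
  shows "(f has_derivative f') (at x)"
  unfolding has_derivative_at_alt
proof (intro conjI allI impI)
  fix e :: real assume e: "e > 0"
  show "\<exists>d>0. \<forall>y. norm (y - x) < d \<longrightarrow> norm (f y - f x - f' (y - x)) \<le> e * norm (y - x)"
  proof (intro exI[of _ "e / (\<bar>C\<bar> + 1)"] conjI allI impI)
    fix y assume y: "norm (y - x) < e / (\<bar>C\<bar> + 1)"
    have "norm (f y - f x - f' (y - x)) \<le> C * norm (y - x) ^ 2"
      using C[of "y - x"] by simp
    also have "\<dots> \<le> (\<bar>C\<bar> + 1) * norm (y - x) ^ 2"
      by (intro mult_right_mono) auto
    also have "\<dots> = ((\<bar>C\<bar> + 1) * norm (y - x)) * norm (y - x)"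
      by (simp add: power2_eq_square)
    also have "\<dots> \<le> e * norm (y - x)"
      using y by (intro mult_right_mono) (auto simp: field_simps add_nonneg_pos)
    finally show "norm (f y - f x - f' (y - x)) \<le> e * norm (y - x)" .
  qed (use e in \<open>auto intro!: divide_pos_pos add_nonneg_pos\<close>)
qed (rule assms)

definition apply_snd :: "'b distr \<Rightarrow> ('a \<times> 'b \<Rightarrow> complex) \<Rightarrow> 'a \<Rightarrow> complex" where
  "apply_snd v F = (\<lambda>p. v (\<lambda>y. F (p, y)))"

text \<open>The first-order Taylor remainder in \<open>p\<close> is quadratic in \<open>h\<close> in
  each norm of functions of \<open>y\<close>, so a continuous functional carries the expansion
  over.\<close>

lemma has_derivative_apply_snd:
  fixes F :: "'a::euclidean_space \<times> 'b::euclidean_space \<Rightarrow> complex"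
  assumes v: "tempered v" and F: "F \<in> schwartz"
  shows "(apply_snd v F has_derivative
    (\<lambda>h. \<Sum>b\<in>Basis. of_real (h \<bullet> b) * apply_snd v (partial_deriv (b, 0) F) p)) (at p)"
proof -
  note lin = tempered_linear[OF v]
  obtain m C where C: "C \<ge> 0" "\<And>f. f \<in> schwartz \<Longrightarrow> norm (v f) \<le> C * snorm m f"
    using tempered_bound[OF v] by blast
  have b: "(\<lambda>y. partial_deriv (b, 0) F (p, y)) \<in> schwartz" if "b \<in> Basis" for b :: 'a
    using that by (intro slice_schwartz partial_deriv_schwartz F Pair_Basis)
  show ?thesis
  proof (rule has_derivative_quadraticI)
    show "bounded_linear (\<lambda>h. \<Sum>b\<in>Basis. of_real (h \<bullet> b) * apply_snd v (partial_deriv (b, 0) F) p)"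
      by (intro bounded_linear_sum bounded_linear_mult_const
          bounded_linear_compose[OF bounded_linear_of_real bounded_linear_inner_left])
    fix h
    have s: "(\<lambda>y. \<Sum>b\<in>Basis. of_real (h \<bullet> b) * partial_deriv (b, 0) F (p, y)) \<in> schwartz"
      "(\<lambda>y. F (p + h, y) - F (p, y)) \<in> schwartz"
      by (intro schwartz_diff schwartz_sum schwartz_cmult slice_schwartz F b; assumption?)+
    have "v (\<lambda>y. F (p + h, y) - F (p, y) - (\<Sum>b\<in>Basis. of_real (h \<bullet> b) * partial_deriv (b, 0) F (p, y)))
      = apply_snd v F (p + h) - apply_snd v F p - (\<Sum>b\<in>Basis. of_real (h \<bullet> b) * apply_snd v (partial_deriv (b, 0) F) p)"
      unfolding apply_snd_def
      by (subst linear_on_schwartz_diff[OF lin s(2,1)], subst linear_on_schwartz_sum[OF lin])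
        (auto simp: linear_on_schwartz_diff[OF lin] linear_on_schwartzD(2)[OF lin] slice_schwartz F b schwartz_cmult)
    then have "norm (apply_snd v F (p + h) - apply_snd v F p - (\<Sum>b\<in>Basis. of_real (h \<bullet> b) * apply_snd v (partial_deriv (b, 0) F) p))
      \<le> C * snorm m (\<lambda>y. F (p + h, y) - F (p, y) - (\<Sum>b\<in>Basis. of_real (h \<bullet> b) * partial_deriv (b, 0) F (p, y)))"
      using C(2)[OF schwartz_diff[OF s(2,1)]] by simp
    also have "\<dots> \<le> C * ((real DIM('a) * norm h) ^ 2 * snorm (m + 2) F)"
      by (intro mult_left_mono snorm_slice_taylor F C)
    also have "\<dots> = (C * real DIM('a) ^ 2 * snorm (m + 2) F) * norm h ^ 2"
      by (simp add: power_mult_distrib)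
    finally show "norm (apply_snd v F (p + h) - apply_snd v F p - (\<Sum>b\<in>Basis. of_real (h \<bullet> b) * apply_snd v (partial_deriv (b, 0) F) p))
      \<le> (C * real DIM('a) ^ 2 * snorm (m + 2) F) * norm h ^ 2" .
  qed
qed

lemma partial_deriv_apply_snd:
  fixes F :: "'a::euclidean_space \<times> 'b::euclidean_space \<Rightarrow> complex"
  assumes "tempered v" "F \<in> schwartz" "b \<in> Basis"
  shows "partial_deriv b (apply_snd v F) p = apply_snd v (partial_deriv (b, 0) F) p"
proof -
  have "partial_deriv b (apply_snd v F) p = (\<Sum>c\<in>Basis. of_real (b \<bullet> c) * apply_snd v (partial_deriv (c, 0) F) p)"
    by (rule partial_deriv_eqI[OF has_derivative_apply_snd[OF assms(1,2)]])
  also have "\<dots> = (\<Sum>c\<in>Basis. if b = c then apply_snd v (partial_deriv (c, 0) F) p else 0)"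
    using assms(3) by (intro sum.cong) (auto simp: inner_Basis)
  finally show ?thesis
    using assms(3) by simp
qed

text \<open>Gives meaning to nested pairings, as in \<open>tensor_distr\<close>, where the outer
  distribution is applied to \<open>apply_snd v F\<close>. Derivatives in the remaining variable
  fall on \<open>F\<close>, so the family is stable; decay comes from
  \<open>snorm_slice\<close>.\<close>

lemma schwartz_op_apply_snd:
  fixes v :: "'b::euclidean_space distr"
  assumes v: "tempered v"
  shows "schwartz_op (\<lambda>F :: 'a::euclidean_space \<times> 'b \<Rightarrow> complex. apply_snd v F)"
proof -
  note lin = linear_on_schwartzD[OF tempered_linear[OF v]]
  let ?B = "{\<lambda>F. apply_snd v (D F) | D. schwartz_op D} :: (('a \<times> 'b \<Rightarrow> complex) \<Rightarrow> ('a \<Rightarrow> complex)) set"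
  show ?thesis
  proof (rule schwartz_op_criterion[where B = ?B])
    show "(\<lambda>F. apply_snd v F) \<in> ?B"
      using schwartz_op_id by (intro CollectI exI[of _ "\<lambda>F. F"] conjI refl)
  next
    fix L :: "('a \<times> 'b \<Rightarrow> complex) \<Rightarrow> 'a \<Rightarrow> complex" and F :: "'a \<times> 'b \<Rightarrow> complex" and p :: 'a
    assume "L \<in> ?B" "F \<in> schwartz"
    then show "L F differentiable at p"
      using has_derivative_apply_snd[OF v schwartz_opD(1)] differentiable_def by blast
  next
    fix L :: "('a \<times> 'b \<Rightarrow> complex) \<Rightarrow> 'a \<Rightarrow> complex" and b :: 'a
    assume "L \<in> ?B" and b: "b \<in> Basis"
    then obtain D where D: "schwartz_op D" and L: "L = (\<lambda>F. apply_snd v (D F))"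
      by blast
    have "(\<lambda>F. apply_snd v (partial_deriv (b, 0) (D F))) \<in> ?B"
      using schwartz_op_compose[OF schwartz_op_partial_deriv[OF Pair_Basis(1)[OF b]] D]
      by (intro CollectI exI[of _ "\<lambda>F. partial_deriv (b, 0) (D F)"] conjI refl)
    then show "\<exists>M. op_span ?B M \<and> (\<forall>F\<in>schwartz. \<forall>p. partial_deriv b (L F) p = M F p)"
      using partial_deriv_apply_snd[OF v schwartz_opD(1)[OF D] b] unfolding L
      by (intro exI[of _ "\<lambda>F. apply_snd v (partial_deriv (b, 0) (D F))"] conjI op_span.base) auto
  next
    fix L :: "('a \<times> 'b \<Rightarrow> complex) \<Rightarrow> 'a \<Rightarrow> complex"
    assume "L \<in> ?B"
    then obtain D where D: "schwartz_op D" and L: "L = (\<lambda>F. apply_snd v (D F))"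
      by blast
    obtain m C where C: "C \<ge> 0" "\<And>f. f \<in> schwartz \<Longrightarrow> norm (v f) \<le> C * snorm m f"
      using tempered_bound[OF v] by blast
    have "decay_bounded (\<lambda>F :: 'a \<times> 'b \<Rightarrow> complex. apply_snd v F)"
      unfolding decay_bounded_def
    proof (intro allI exI conjI ballI)
      fix k and F :: "'a \<times> 'b \<Rightarrow> complex" and p :: 'a
      assume F: "F \<in> schwartz"
      have "norm p ^ k * norm (apply_snd v F p) \<le> norm p ^ k * (C * snorm m (\<lambda>y. F (p, y)))"
        unfolding apply_snd_def by (intro mult_left_mono C slice_schwartz F) auto
      also have "\<dots> = C * (norm p ^ k * snorm m (\<lambda>y. F (p, y)))"
        by simp
      also have "\<dots> \<le> C * snorm (m + k) F"
        by (intro mult_left_mono snorm_slice F C)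
      finally show "norm p ^ k * norm (apply_snd v F p) \<le> C * snorm (m + k) F" .
    qed (rule C)
    from decay_bounded_compose[OF this D] show "decay_bounded L"
      unfolding L .
  qed (auto simp: apply_snd_def lin slice_schwartz)
qed

lemma schwartz_op_slice:
  fixes p :: "'a::euclidean_space"
  shows "schwartz_op (\<lambda>(F :: 'a \<times> 'b::euclidean_space \<Rightarrow> complex) y. F (p, y))"
  unfolding schwartz_op_def
proof (intro conjI allI ballI)
  fix n
  have "snorm n (\<lambda>y. F (p, y)) \<le> 1 * snorm n F" if "F \<in> schwartz" for F :: "'a \<times> 'b \<Rightarrow> complex"
    using snorm_slice[OF that, of p 0 n] by simp
  then show "\<exists>m C. C \<ge> 0 \<and> (\<forall>F\<in>schwartz. snorm n (\<lambda>y. (F :: 'a \<times> 'b \<Rightarrow> complex) (p, y)) \<le> C * snorm m F)"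
    by (intro exI[of _ n] exI[of _ 1]) simp
qed (simp_all add: slice_schwartz)

section \<open>The partial Fourier transform\<close>

lemma integral_lborel_affine:
  fixes f :: "'a::euclidean_space \<Rightarrow> complex"
  assumes [measurable]: "f \<in> borel_measurable borel" and c: "c \<noteq> 0"
  shows "(\<integral>x. f x \<partial>lborel) = of_real (\<bar>c\<bar> ^ DIM('a)) * (\<integral>x. f (t + c *\<^sub>R x) \<partial>lborel)"
proof -
  have "(\<integral>x. f x \<partial>lborel) = (\<integral>x. f x \<partial>density (distr lborel borel (\<lambda>x. t + c *\<^sub>R x)) (\<lambda>_. ennreal (\<bar>c\<bar> ^ DIM('a))))"
    using lborel_affine[OF c, of t] by simp
  also have "\<dots> = (\<integral>x. \<bar>c\<bar> ^ DIM('a) *\<^sub>R f x \<partial>distr lborel borel (\<lambda>x. t + c *\<^sub>R x))"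
    by (intro integral_density) auto
  also have "\<dots> = (\<integral>x. \<bar>c\<bar> ^ DIM('a) *\<^sub>R f (t + c *\<^sub>R x) \<partial>lborel)"
    by (intro integral_distr) auto
  finally show ?thesis
    by (simp add: scaleR_conv_of_real)
qed

lemma integral_lborel_translate:
  fixes f :: "'a::euclidean_space \<Rightarrow> complex"
  assumes "f \<in> borel_measurable borel"
  shows "(\<integral>x. f (c + x) \<partial>lborel) = (\<integral>x. f x \<partial>lborel)"
  using integral_lborel_affine[OF assms, of 1 c] by simp

lemma integral_lborel_uminus:
  fixes f :: "'a::euclidean_space \<Rightarrow> complex"
  assumes "f \<in> borel_measurable borel"
  shows "(\<integral>x. f (- x) \<partial>lborel) = (\<integral>x. f x \<partial>lborel)"
  using integral_lborel_affine[OF assms, of "-1" 0] by simp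

text \<open>Translation invariance: integrating \<open>gauss p * f (p + y)\<close> over
  \<open>y\<close> gives a multiple of \<open>gauss p\<close>, whose derivative at 0 vanishes.
  Differentiating under the integral sign at \<open>p = 0\<close> gives the integral of
  \<open>partial_deriv b f\<close>, as \<open>gauss\<close> is 1 with zero derivative there.\<close>

lemma integral_partial_deriv:
  fixes f :: "'a::euclidean_space \<Rightarrow> complex"
  assumes f: "f \<in> schwartz" and b: "b \<in> Basis"
  shows "(\<integral>x. partial_deriv b f x \<partial>lborel) = 0"
proof -
  define A where "A = (\<lambda>z :: 'a \<times> 'a. (fst z, fst z + snd z))"
  have A: "linear A" "inj A"
    by (auto simp: A_def algebra_simps intro!: linearI injI)
  then have bl: "bounded_linear A"
    by (simp add: linear_conv_bounded_linear)
  define F where "F = (\<lambda>z. tensor gauss f (A z))"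
  have F: "F \<in> schwartz"
    unfolding F_def by (intro schwartz_compose_linear[OF _ A] tensor_schwartz gauss_schwartz f)
  let ?v = "\<lambda>f::'a \<Rightarrow> complex. \<integral>x. f x \<partial>lborel"
  have "apply_snd ?v F = (\<lambda>p. (\<integral>x. f x \<partial>lborel) * gauss p)"
    by (simp add: apply_snd_def F_def tensor_def A_def mult.commute
      integral_lborel_translate[OF schwartz_borel_measurable[OF f]])
  then have "partial_deriv b (apply_snd ?v F) 0 = 0"
    using partial_deriv_eqI[OF has_derivative_mult_right[OF has_derivative_gauss[of "0 :: 'a"]]] by simp
  moreover have "partial_deriv (b, 0) F (0, y) = partial_deriv b f y" for y
  proof -
    have "partial_deriv (b, 0) F (0, y) = partial_deriv (A (b, 0)) (tensor gauss f) (A (0, y))"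
      unfolding F_def by (intro partial_deriv_compose_linear(1) bl schwartz_differentiable tensor_schwartz gauss_schwartz f)
    also have "\<dots> = partial_deriv b f y"
      using partial_deriv_eqI[OF has_derivative_gauss[of "0 :: 'a"]]
      by (subst partial_deriv_tensor(1)) (auto simp: schwartz_differentiable gauss_schwartz f A_def gauss_zero)
    finally show ?thesis .
  qed
  ultimately show ?thesis
    using partial_deriv_apply_snd[OF tempered_integral F b, of 0] by (simp add: apply_snd_def)
qed

section \<open>Decay and derivatives of the partial Fourier transform\<close>

definition fourier2 :: "('a::euclidean_space \<times> 'b::euclidean_space \<Rightarrow> complex) \<Rightarrow> 'a \<times> 'b \<Rightarrow> complex" where
  "fourier2 F = (\<lambda>(x, y). fourier (\<lambda>\<xi>. F (x, \<xi>)) y)"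

lemma fourier2_Pair: "fourier2 F (x, \<eta>) = (\<integral>\<xi>. F (x, \<xi>) * cis (- 2 * pi * (\<xi> \<bullet> \<eta>)) \<partial>lborel)"
  by (simp add: fourier2_def fourier_def)

lemma schwartz_mult_cis:
  fixes f :: "'a::euclidean_space \<Rightarrow> complex"
  assumes "f \<in> schwartz"
  shows "(\<lambda>x. f x * cis (c * (x \<bullet> \<eta>))) \<in> schwartz"
  using schwartz_mult[OF moderate_cis_inner assms] by (simp add: mult.commute)

lemma integrable_schwartz_cis:
  fixes f :: "'a::euclidean_space \<Rightarrow> complex"
  shows "f \<in> schwartz \<Longrightarrow> integrable lborel (\<lambda>x. f x * cis (c * (x \<bullet> \<eta>)))"
  by (intro integrable_schwartz schwartz_mult_cis)

lemma partial_deriv_cis_inner: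
  "partial_deriv b (\<lambda>x::'a::euclidean_space. cis (c * (x \<bullet> \<eta>))) x = \<i> * of_real (c * (b \<bullet> \<eta>)) * cis (c * (x \<bullet> \<eta>))"
  "(\<lambda>x::'a. cis (c * (x \<bullet> \<eta>))) differentiable at x"
proof -
  have "((\<lambda>x. c * (x \<bullet> \<eta>)) has_derivative (\<lambda>h. c * (h \<bullet> \<eta>))) (at x)"
    by (auto intro!: derivative_eq_intros)
  from partial_deriv_cis[OF this]
  show "partial_deriv b (\<lambda>x::'a::euclidean_space. cis (c * (x \<bullet> \<eta>))) x = \<i> * of_real (c * (b \<bullet> \<eta>)) * cis (c * (x \<bullet> \<eta>))"
    "(\<lambda>x::'a. cis (c * (x \<bullet> \<eta>))) differentiable at x" .
qed

lemma fourier_partial_deriv: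
  fixes f :: "'a::euclidean_space \<Rightarrow> complex"
  assumes f: "f \<in> schwartz" and b: "b \<in> Basis"
  shows "fourier (partial_deriv b f) \<eta> = \<i> * of_real (2 * pi * (\<eta> \<bullet> b)) * fourier f \<eta>"
proof -
  let ?e = "\<lambda>x. cis (- 2 * pi * (x \<bullet> \<eta>))"
  have "0 = (\<integral>x. partial_deriv b (\<lambda>x. f x * ?e x) x \<partial>lborel)"
    by (rule integral_partial_deriv[OF schwartz_mult_cis[OF f] b, symmetric])
  also have "\<dots> = (\<integral>x. partial_deriv b f x * ?e x - \<i> * of_real (2 * pi * (\<eta> \<bullet> b)) * (f x * ?e x) \<partial>lborel)"
    by (intro Bochner_Integration.integral_cong refl, subst partial_deriv_mult)
      (auto simp: schwartz_differentiable[OF f] partial_deriv_cis_inner(1)[of b "- 2 * pi" \<eta>, simplified]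
        partial_deriv_cis_inner(2)[of "- 2 * pi" \<eta>, simplified] inner_commute)
  also have "\<dots> = fourier (partial_deriv b f) \<eta> - \<i> * of_real (2 * pi * (\<eta> \<bullet> b)) * fourier f \<eta>"
    unfolding fourier_def
    using integrable_schwartz_cis[OF f, of "- 2 * pi" \<eta>]
      integrable_schwartz_cis[OF partial_deriv_schwartz[OF f b], of "- 2 * pi" \<eta>]
    by (subst Bochner_Integration.integral_diff) auto
  finally show ?thesis
    by simp
qed

lemma fourier_norm_bound: "\<exists>N C. C \<ge> 0 \<and> (\<forall>f\<in>schwartz. \<forall>\<eta>. norm (fourier f (\<eta> :: 'a::euclidean_space)) \<le> C * snorm N f)"
proof -
  let ?N = "2 * DIM('a)"
  let ?C = "2 ^ Suc ?N * (\<integral>x. weight (x :: 'a) \<partial>lborel)"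
  have "norm (fourier f \<eta>) \<le> ?C * snorm ?N f" if f: "f \<in> schwartz" for f :: "'a \<Rightarrow> complex" and \<eta>
  proof -
    have "norm (fourier f \<eta>) \<le> (\<integral>x. 2 ^ Suc ?N * snorm ?N f * weight (x :: 'a) \<partial>lborel)"
      unfolding fourier_def
      by (rule Bochner_Integration.integral_norm_bound_integral[OF integrable_schwartz_cis[OF f]
            integrable_mult_right[OF integrable_weight]])
        (use schwartz_norm_le_weight[OF f] in \<open>simp add: norm_mult\<close>)
    also have "\<dots> = ?C * snorm ?N f"
      by (simp add: mult_ac)
    finally show ?thesis .
  qed
  moreover have "?C \<ge> 0"
    by (intro mult_nonneg_nonneg Bochner_Integration.integral_nonneg less_imp_le[OF weight_pos]) auto
  ultimately show ?thesis
    by blast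
qed

text \<open>Trades a power of the norm for a power of one coordinate, that is, for an iterated
  derivative in a single direction before the Fourier transform.\<close>

lemma norm_le_inner_Basis: "\<exists>b\<in>Basis. norm x \<le> real DIM('a) * \<bar>x \<bullet> b\<bar>" for x :: "'a::euclidean_space"
proof (rule ccontr)
  assume "\<not> ?thesis"
  then have "(\<Sum>b\<in>Basis. \<bar>x \<bullet> b\<bar>) < (\<Sum>b\<in>(Basis :: 'a set). norm x / real DIM('a))"
    by (intro sum_strict_mono) (auto simp: field_simps not_le)
  then show False
    using norm_le_l1[of x] by simp
qed

lemma partial_derivs_replicate: "partial_derivs (replicate k b) (partial_deriv b f) = partial_deriv b (partial_derivs (replicate k b) f)"
  by (induction k) simp_all

lemma fourier2_partial_derivs:
  fixes F :: "'a::euclidean_space \<times> 'b::euclidean_space \<Rightarrow> complex"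
  assumes F: "F \<in> schwartz" and b: "b \<in> Basis"
  shows "fourier2 (partial_derivs (replicate k (0, b)) F) (x, \<eta>) = (\<i> * of_real (2 * pi * (\<eta> \<bullet> b))) ^ k * fourier2 F (x, \<eta>)"
  using F
proof (induction k arbitrary: F)
  case (Suc k)
  have "fourier2 (partial_deriv (0, b) F) (x, \<eta>) = \<i> * of_real (2 * pi * (\<eta> \<bullet> b)) * fourier2 F (x, \<eta>)"
  proof -
    have "partial_deriv b (\<lambda>y. F (x, y)) = (\<lambda>y. partial_deriv (0, b) F (x, y))"
      by (intro ext partial_deriv_slice(1) schwartz_differentiable Suc.prems)
    with fourier_partial_deriv[OF slice_schwartz[OF Suc.prems, of x] b, of \<eta>] show ?thesis
      by (simp add: fourier2_def)
  qed
  then show ?case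
    using Suc.IH[OF partial_deriv_schwartz[OF Suc.prems Pair_Basis(2)[OF b]]]
    by (simp add: partial_derivs_replicate)
qed simp

text \<open>One of the two components carries at least half of the norm. Decay in \<open>x\<close>
  is inherited from the slices of \<open>F\<close>; decay in the frequency comes from derivatives of
  \<open>F\<close> in its second variable.\<close>

lemma decay_bounded_fourier2:
  "decay_bounded (fourier2 :: ('a::euclidean_space \<times> 'b::euclidean_space \<Rightarrow> complex) \<Rightarrow> _)"
  unfolding decay_bounded_def
proof
  fix k
  obtain N C where C: "C \<ge> 0" "\<And>f \<eta>. f \<in> schwartz \<Longrightarrow> norm (fourier f (\<eta> :: 'b)) \<le> C * snorm N f"
    using fourier_norm_bound[where 'a = 'b] by blast
  have le: "norm x ^ j * norm (fourier2 F (x, \<eta>)) \<le> C * snorm (N + j) F"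
    if F: "F \<in> schwartz" for F :: "'a \<times> 'b \<Rightarrow> complex" and x \<eta> j
  proof -
    have "norm x ^ j * norm (fourier2 F (x, \<eta>)) \<le> norm x ^ j * (C * snorm N (\<lambda>\<xi>. F (x, \<xi>)))"
      unfolding fourier2_def using C(2)[OF slice_schwartz[OF F]] by (auto intro!: mult_left_mono)
    also have "\<dots> = C * (norm x ^ j * snorm N (\<lambda>\<xi>. F (x, \<xi>)))"
      by simp
    also have "\<dots> \<le> C * snorm (N + j) F"
      by (intro mult_left_mono snorm_slice F C)
    finally show ?thesis .
  qed
  \<comment> \<open>A common majorant for the two cases: the power of 2 comes from halving the norm,
    the power of the dimension from passing to one coordinate of the frequency.\<close>
  let ?D = "2 ^ k * (1 + real DIM('b) ^ k)"
  have D: "?D \<ge> 2 ^ k" "?D \<ge> 2 ^ k * real DIM('b) ^ k"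
    by (auto simp: algebra_simps)
  have "norm z ^ k * norm (fourier2 F z) \<le> ?D * C * snorm (N + k) F"
    if F: "F \<in> schwartz" for F :: "'a \<times> 'b \<Rightarrow> complex" and z
  proof -
    obtain x \<eta> where z: "z = (x, \<eta>)"
      by (cases z)
    have nonneg: "0 \<le> C * snorm (N + k) F"
      using C(1) snorm_nonneg[OF F] by simp
    consider "norm z \<le> 2 * norm x" | "norm z \<le> 2 * norm \<eta>"
      using norm_Pair_le[of x \<eta>] unfolding z by linarith
    then show ?thesis
    proof cases
      case 1
      then have "norm z ^ k * norm (fourier2 F z) \<le> (2 * norm x) ^ k * norm (fourier2 F z)"
        by (intro mult_right_mono power_mono) auto
      also have "\<dots> = 2 ^ k * (norm x ^ k * norm (fourier2 F (x, \<eta>)))"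
        by (simp add: power_mult_distrib z)
      also have "\<dots> \<le> 2 ^ k * (C * snorm (N + k) F)"
        by (intro mult_left_mono le F) auto
      also have "\<dots> \<le> ?D * (C * snorm (N + k) F)"
        by (intro mult_right_mono nonneg D)
      finally show ?thesis
        by (simp add: mult.assoc)
    next
      case 2
      obtain b where b: "b \<in> Basis" "norm \<eta> \<le> real DIM('b) * \<bar>\<eta> \<bullet> b\<bar>"
        using norm_le_inner_Basis[of \<eta>] by blast
      have bs: "set (replicate k (0, b)) \<subseteq> (Basis :: ('a \<times> 'b) set)"
        using Pair_Basis(2)[OF b(1)] by auto
      have "norm z \<le> (2 * real DIM('b)) * \<bar>\<eta> \<bullet> b\<bar>"
        using 2 b(2) by linarith
      then have "norm z ^ k * norm (fourier2 F z) \<le> ((2 * real DIM('b)) * \<bar>\<eta> \<bullet> b\<bar>) ^ k * norm (fourier2 F z)"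
        by (intro mult_right_mono power_mono) auto
      also have "\<dots> \<le> ((2 * real DIM('b)) * \<bar>2 * pi * (\<eta> \<bullet> b)\<bar>) ^ k * norm (fourier2 F z)"
      proof (intro mult_right_mono power_mono mult_left_mono)
        have "1 * \<bar>\<eta> \<bullet> b\<bar> \<le> (2 * pi) * \<bar>\<eta> \<bullet> b\<bar>"
          using pi_gt3 by (intro mult_right_mono) auto
        then show "\<bar>\<eta> \<bullet> b\<bar> \<le> \<bar>2 * pi * (\<eta> \<bullet> b)\<bar>"
          by (simp add: abs_mult)
      qed auto
      also have "\<dots> = 2 ^ k * real DIM('b) ^ k * norm (fourier2 (partial_derivs (replicate k (0, b)) F) (x, \<eta>))"
        unfolding fourier2_partial_derivs[OF F b(1)] z
        by (simp add: power_mult_distrib norm_mult norm_power del: of_real_mult)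
      also have "\<dots> \<le> 2 ^ k * real DIM('b) ^ k * (C * snorm (N + k) F)"
      proof (rule mult_left_mono)
        have "norm (fourier2 (partial_derivs (replicate k (0, b)) F) (x, \<eta>)) \<le> C * snorm N (partial_derivs (replicate k (0, b)) F)"
          using le[OF partial_derivs_schwartz[OF F bs], where j = 0] by simp
        also have "\<dots> \<le> C * snorm (N + k) F"
          using snorm_partial_derivs[OF F bs, of N] by (intro mult_left_mono C) auto
        finally show "norm (fourier2 (partial_derivs (replicate k (0, b)) F) (x, \<eta>)) \<le> C * snorm (N + k) F" .
      qed simp
      also have "\<dots> \<le> ?D * (C * snorm (N + k) F)"
        by (intro mult_right_mono nonneg D)
      finally show ?thesis
        by (simp add: mult.assoc)
    qed
  qed
  then show "\<exists>m C. C \<ge> 0 \<and> (\<forall>F\<in>schwartz. \<forall>z. norm z ^ k * norm (fourier2 (F :: 'a \<times> 'b \<Rightarrow> complex) z) \<le> C * snorm m F)"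
    using C(1) by (intro exI[of _ "N + k"] exI[of _ "?D * C"]) simp
qed

text \<open>
  The integrand of \<open>fourier2\<close> is not a Schwartz function of all variables jointly; it becomes one
  after multiplication by a Gaussian in the frequency variable, so that the results on \<open>apply_snd\<close>
  yield differentiation under the integral sign.
\<close>

lemma fourier2_derivative:
  fixes F :: "'a::euclidean_space \<times> 'b::euclidean_space \<Rightarrow> complex"
  assumes F: "F \<in> schwartz"
  shows "fourier2 F differentiable at z"
    and "b \<in> Basis \<Longrightarrow> partial_deriv b (fourier2 F) z =
      fourier2 (\<lambda>w. partial_deriv (fst b, 0) F w + of_real (- 2 * pi * (snd w \<bullet> snd b)) * \<i> * F w) z"
proof -
  \<comment> \<open>Sends \<open>((x, \<eta>), \<xi>)\<close> to
    \<open>((x, \<xi>), \<eta>)\<close>: \<open>apply_snd\<close> expects the integration variable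
    last, while \<open>F\<close> takes it in its second slot and the Gaussian takes the
    frequency.\<close>
  define A where "A = (\<lambda>w :: ('a \<times> 'b) \<times> 'b. ((fst (fst w), snd w), snd (fst w)))"
  have A: "linear A" "inj A"
    by (auto simp: A_def intro!: linearI injI)
  then have bl: "bounded_linear A"
    by (simp add: linear_conv_bounded_linear)
  define q where "q = (\<lambda>w :: ('a \<times> 'b) \<times> 'b. - 2 * pi * (snd w \<bullet> snd (fst w)))"
  define q' where "q' = (\<lambda>(w :: ('a \<times> 'b) \<times> 'b) (h :: ('a \<times> 'b) \<times> 'b). - 2 * pi * (snd h \<bullet> snd (fst w) + snd w \<bullet> snd (fst h)))"
  have q: "(q has_derivative q' w) (at w)" for w
    unfolding q_def q'_def by (auto intro!: derivative_eq_intros simp: algebra_simps inner_commute)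
  have mod: "(\<lambda>w. cis (q w)) \<in> moderate"
    unfolding q_def
    by (intro moderate_cis_bilinear bounded_linear_compose[OF bounded_linear_snd] bounded_linear_fst bounded_linear_snd)
  note dcis = partial_deriv_cis[OF q]
  define H where "H = (\<lambda>w. cis (q w) * tensor F gauss (A w))"
  have H: "H \<in> schwartz"
    unfolding H_def by (intro schwartz_mult[OF mod] schwartz_compose_linear[OF _ A] tensor_schwartz F gauss_schwartz)
  let ?v = "\<lambda>f::'b \<Rightarrow> complex. \<integral>x. f x \<partial>lborel"
  let ?G = "\<lambda>z. gauss (snd z) * fourier2 F z"
  have "apply_snd ?v H (x, \<eta>) = ?G (x, \<eta>)" for x \<eta>
    by (simp add: apply_snd_def H_def q_def tensor_def A_def fourier2_Pair mult_ac)
  then have eq: "apply_snd ?v H = ?G"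
    by auto
  have G: "?G \<in> schwartz"
    unfolding eq[symmetric] by (rule schwartz_opD(1)[OF schwartz_op_apply_snd[OF tempered_integral] H])
  have dgauss: "partial_deriv h (\<lambda>z. gauss (snd z)) z = - of_real (snd z \<bullet> snd h) * gauss (snd z)"
    "(\<lambda>z. gauss (snd z)) differentiable at z" for h z :: "'a \<times> 'b"
    using partial_deriv_compose_linear[of "snd :: 'a \<times> 'b \<Rightarrow> 'b" gauss z,
        OF bounded_linear_snd schwartz_differentiable[OF gauss_schwartz]]
      partial_deriv_eqI[OF has_derivative_gauss] by auto
  have "(\<lambda>z. ?G z / gauss (snd z)) differentiable at z"
    by (intro differentiable_divide schwartz_differentiable[OF G] dgauss gauss_nonzero)
  then show diff: "fourier2 F differentiable at z"
    by (simp add: gauss_nonzero)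
  assume b: "b \<in> Basis"
  let ?D = "\<lambda>w. partial_deriv (fst b, 0) F w + of_real (- 2 * pi * (snd w \<bullet> snd b)) * \<i> * F w"
  obtain x \<eta> where z: "z = (x, \<eta>)"
    by (cases z)
  \<comment> \<open>The derivative also hits the Gaussian and leaves the term with
    \<open>of_real (\<eta> \<bullet> snd b)\<close>. The product rule for \<open>?G\<close> produces
    the same term, and the two cancel at the end.\<close>
  have pH: "partial_deriv (b, 0) H ((x, \<eta>), \<xi>) = gauss \<eta> * (?D (x, \<xi>) * cis (- 2 * pi * (\<xi> \<bullet> \<eta>)))
      - of_real (\<eta> \<bullet> snd b) * H ((x, \<eta>), \<xi>)" for \<xi>
  proof -
    have "partial_deriv (b, 0) H ((x, \<eta>), \<xi>) =
      cis (q ((x, \<eta>), \<xi>)) * partial_deriv (A (b, 0)) (tensor F gauss) (A ((x, \<eta>), \<xi>)) +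
      \<i> * of_real (q' ((x, \<eta>), \<xi>) (b, 0)) * cis (q ((x, \<eta>), \<xi>)) * tensor F gauss (A ((x, \<eta>), \<xi>))"
      unfolding H_def
      using partial_deriv_compose_linear[OF bl schwartz_differentiable[OF tensor_schwartz[OF F gauss_schwartz]]]
      by (subst partial_deriv_mult) (auto simp: dcis)
    also have "partial_deriv (A (b, 0)) (tensor F gauss) (A ((x, \<eta>), \<xi>)) =
      F (x, \<xi>) * (- of_real (\<eta> \<bullet> snd b) * gauss \<eta>) + partial_deriv (fst b, 0) F (x, \<xi>) * gauss \<eta>"
      using partial_deriv_eqI[OF has_derivative_gauss[of \<eta>]]
      by (subst partial_deriv_tensor(1)) (auto simp: schwartz_differentiable F gauss_schwartz A_def)
    finally show ?thesis
      by (simp add: H_def q_def q'_def tensor_def A_def algebra_simps)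
  qed
  have int1: "integrable lborel (\<lambda>\<xi>. ?D (x, \<xi>) * cis (- 2 * pi * (\<xi> \<bullet> \<eta>)))"
  proof -
    have "integrable lborel (\<lambda>\<xi>. inverse (gauss \<eta>) * (partial_deriv (b, 0) H ((x, \<eta>), \<xi>) + of_real (\<eta> \<bullet> snd b) * H ((x, \<eta>), \<xi>)))"
      by (intro integrable_mult_right Bochner_Integration.integrable_add integrable_schwartz slice_schwartz H
        partial_deriv_schwartz Pair_Basis b)
    then show ?thesis
      unfolding pH by (simp add: gauss_nonzero mult.assoc[symmetric, of "inverse (gauss \<eta>)"])
  qed
  have "partial_deriv b ?G z = apply_snd ?v (partial_deriv (b, 0) H) z"
    unfolding eq[symmetric] by (rule partial_deriv_apply_snd[OF tempered_integral H b])
  also have "\<dots> = gauss \<eta> * fourier2 ?D z - of_real (\<eta> \<bullet> snd b) * apply_snd ?v H z"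
    unfolding apply_snd_def z pH fourier2_Pair integral_mult_right_zero[symmetric]
    by (rule Bochner_Integration.integral_diff[OF integrable_mult_right integrable_mult_right])
      (intro int1 integrable_schwartz slice_schwartz H)+
  finally have "partial_deriv b ?G z = gauss \<eta> * fourier2 ?D z - of_real (\<eta> \<bullet> snd b) * ?G z"
    by (simp add: eq)
  moreover have "partial_deriv b ?G z = gauss \<eta> * partial_deriv b (fourier2 F) z - of_real (\<eta> \<bullet> snd b) * ?G z"
    using diff by (subst partial_deriv_mult) (auto simp: dgauss z)
  ultimately show "partial_deriv b (fourier2 F) z = fourier2 ?D z"
    using gauss_nonzero[of \<eta>] by simp
qed

lemma schwartz_op_zero:
  "schwartz_op (\<lambda>(f :: 'a::euclidean_space \<Rightarrow> complex) (x :: 'b::euclidean_space). 0)"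
  unfolding schwartz_op_def
proof (intro conjI allI ballI)
  fix n
  have "snorm n (\<lambda>x :: 'b. 0) \<le> 0"
    using snorm_cmult[OF schwartz_zero, of n 0] by simp
  then show "\<exists>m C. C \<ge> 0 \<and> (\<forall>f\<in>schwartz. snorm n (\<lambda>x :: 'b. 0) \<le> C * snorm m (f :: 'a \<Rightarrow> complex))"
    by (intro exI[of _ n] exI[of _ 0]) simp
qed (simp_all add: schwartz_zero)

lemma schwartz_op_add:
  assumes "schwartz_op L" "schwartz_op M"
  shows "schwartz_op (\<lambda>f x. L f x + M f x)"
  unfolding schwartz_op_def
proof (intro conjI allI ballI)
  fix n
  obtain m C where C: "C \<ge> 0" "\<And>f. f \<in> schwartz \<Longrightarrow> snorm n (L f) \<le> C * snorm m f"
    using schwartz_opD(4)[OF assms(1), of n] by blast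
  obtain l D where D: "D \<ge> 0" "\<And>f. f \<in> schwartz \<Longrightarrow> snorm n (M f) \<le> D * snorm l f"
    using schwartz_opD(4)[OF assms(2), of n] by blast
  have "snorm n (\<lambda>x. L f x + M f x) \<le> (C + D) * snorm (max m l) f" if f: "f \<in> schwartz" for f
  proof -
    have "snorm n (\<lambda>x. L f x + M f x) \<le> C * snorm m f + D * snorm l f"
      using snorm_add[OF schwartz_opD(1)[OF assms(1) f] schwartz_opD(1)[OF assms(2) f], of n] C(2)[OF f] D(2)[OF f]
      by linarith
    also have "\<dots> \<le> C * snorm (max m l) f + D * snorm (max m l) f"
      by (intro add_mono mult_left_mono snorm_mono f C D) auto
    finally show ?thesis
      by (simp add: algebra_simps)
  qed
  then show "\<exists>m C'. C' \<ge> 0 \<and> (\<forall>f\<in>schwartz. snorm n (\<lambda>x. L f x + M f x) \<le> C' * snorm m f)"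
    using C(1) D(1) by (intro exI[of _ "max m l"] exI[of _ "C + D"]) simp
qed (simp_all add: schwartz_opD[OF assms(1)] schwartz_opD[OF assms(2)] schwartz_add algebra_simps)

lemma schwartz_op_fourier2:
  "schwartz_op (fourier2 :: ('a::euclidean_space \<times> 'b::euclidean_space \<Rightarrow> complex) \<Rightarrow> _)"
proof -
  let ?B = "{\<lambda>F. fourier2 (D F) | D. schwartz_op D} :: (('a \<times> 'b \<Rightarrow> complex) \<Rightarrow> ('a \<times> 'b \<Rightarrow> complex)) set"
  show ?thesis
  proof (rule schwartz_op_criterion[where B = ?B])
    show "fourier2 \<in> ?B"
      using schwartz_op_id by (intro CollectI exI[of _ "\<lambda>F. F"] conjI refl)
  next
    fix F G :: "'a \<times> 'b \<Rightarrow> complex" and c assume F: "F \<in> schwartz" and G: "G \<in> schwartz"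
    show "fourier2 (\<lambda>z. F z + G z) = (\<lambda>z. fourier2 F z + fourier2 G z)"
      using integrable_schwartz_cis[OF slice_schwartz[OF F], where c = "- 2 * pi"]
        integrable_schwartz_cis[OF slice_schwartz[OF G], where c = "- 2 * pi"]
      by (auto simp: fourier2_Pair fun_eq_iff distrib_right)
  next
    fix F :: "'a \<times> 'b \<Rightarrow> complex" and c
    show "fourier2 (\<lambda>z. c * F z) = (\<lambda>z. c * fourier2 F z)"
      by (auto simp: fourier2_Pair fun_eq_iff mult.assoc)
  next
    fix L :: "('a \<times> 'b \<Rightarrow> complex) \<Rightarrow> 'a \<times> 'b \<Rightarrow> complex" and F :: "'a \<times> 'b \<Rightarrow> complex" and z
    assume "L \<in> ?B" "F \<in> schwartz"
    then show "L F differentiable at z"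
      using fourier2_derivative(1)[OF schwartz_opD(1)] by blast
  next
    fix L :: "('a \<times> 'b \<Rightarrow> complex) \<Rightarrow> 'a \<times> 'b \<Rightarrow> complex" and b :: "'a \<times> 'b"
    assume "L \<in> ?B" and b: "b \<in> Basis"
    then obtain D where D: "schwartz_op D" and L: "L = (\<lambda>F. fourier2 (D F))"
      by blast
    define M where "M = (\<lambda>(F :: 'a \<times> 'b \<Rightarrow> complex) w.
      partial_deriv (fst b, 0) F w + of_real (- 2 * pi * (snd w \<bullet> snd b)) * \<i> * F w)"
    have M: "schwartz_op M"
      unfolding M_def
    proof (intro schwartz_op_add schwartz_op_mult moderate_mult moderate_const)
      show "(\<lambda>w. complex_of_real (- 2 * pi * (snd w \<bullet> snd b))) \<in> moderate"
        by (intro moderate_linear bounded_linear_compose[OF bounded_linear_of_real] bounded_linear_const_mult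
          bounded_linear_compose[OF bounded_linear_inner_left] bounded_linear_snd)
      show "schwartz_op (\<lambda>F :: 'a \<times> 'b \<Rightarrow> complex. partial_deriv (fst b, 0) F)"
      \<comment> \<open>A basis vector of the second factor has \<open>fst b = 0\<close>, and the
        derivative in the first variable then degenerates to the zero operator.\<close>
      proof (cases "fst b = 0")
        case True
        have "partial_deriv 0 F = (\<lambda>z. 0)" if "F \<in> schwartz" for F :: "'a \<times> 'b \<Rightarrow> complex"
          using linear_0[OF partial_deriv_linear[OF schwartz_differentiable[OF that]]] by auto
        then show ?thesis
          unfolding True by (intro schwartz_op_cong[OF schwartz_op_zero]) (auto simp: zero_prod_def)
      next
        case False
        then show ?thesis
          using b by (intro schwartz_op_partial_deriv Pair_Basis) (auto simp: Basis_prod_def)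
      qed
    qed
    have "(\<lambda>F. fourier2 (M (D F))) \<in> ?B"
      using schwartz_op_compose[OF M D] by (intro CollectI exI[of _ "\<lambda>F. M (D F)"] conjI refl)
    then show "\<exists>M. op_span ?B M \<and> (\<forall>F\<in>schwartz. \<forall>z. partial_deriv b (L F) z = M F z)"
      using fourier2_derivative(2)[OF schwartz_opD(1)[OF D] b] unfolding L
      by (intro exI[of _ "\<lambda>F. fourier2 (M (D F))"] conjI op_span.base) (auto simp: M_def)
  next
    fix L :: "('a \<times> 'b \<Rightarrow> complex) \<Rightarrow> 'a \<times> 'b \<Rightarrow> complex"
    assume "L \<in> ?B"
    then show "decay_bounded L"
      using decay_bounded_compose[OF decay_bounded_fourier2] by blast
  qed
qed

text \<open>As \<open>gauss\<close> is 1 at 0, the full transform is a slice of the partial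
  transform of a tensor product and inherits its continuity and its derivatives.\<close>

lemma fourier_eq_fourier2:
  fixes f :: "'a::euclidean_space \<Rightarrow> complex"
  shows "fourier f \<eta> = fourier2 (tensor (gauss :: 'a \<Rightarrow> complex) f) (0, \<eta>)"
  by (simp add: fourier2_def tensor_def gauss_zero)

lemma schwartz_op_fourier: "schwartz_op (fourier :: ('a::euclidean_space \<Rightarrow> complex) \<Rightarrow> _)"
proof (rule schwartz_op_cong)
  show "schwartz_op (\<lambda>(f :: 'a \<Rightarrow> complex) \<eta>. fourier2 (tensor (gauss :: 'a \<Rightarrow> complex) f) (0, \<eta>))"
    by (rule schwartz_op_compose[OF schwartz_op_slice
      schwartz_op_compose[OF schwartz_op_fourier2 schwartz_op_tensor_right[OF gauss_schwartz]]])
qed (simp add: fourier_eq_fourier2 fun_eq_iff)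

lemma inv_fourier_eq: "inv_fourier f x = fourier f (- x)"
  by (simp add: inv_fourier_def fourier_def inner_commute)

lemma schwartz_op_reflect: "schwartz_op (\<lambda>(f :: 'a::euclidean_space \<Rightarrow> complex) x. f (- x))"
  by (intro schwartz_op_compose_linear linearI injI) auto

lemma schwartz_op_inv_fourier: "schwartz_op (inv_fourier :: ('a::euclidean_space \<Rightarrow> complex) \<Rightarrow> _)"
  by (rule schwartz_op_cong[OF schwartz_op_compose[OF schwartz_op_reflect schwartz_op_fourier]])
    (simp add: inv_fourier_eq fun_eq_iff)

lemmas fourier_schwartz = schwartz_opD(1)[OF schwartz_op_fourier]
  and inv_fourier_schwartz = schwartz_opD(1)[OF schwartz_op_inv_fourier]
  and fourier2_schwartz = schwartz_opD(1)[OF schwartz_op_fourier2]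

section \<open>Tempered distributions commute with integrals\<close>

lemma swap_schwartz: "F \<in> schwartz \<Longrightarrow> (\<lambda>p. F (snd p, fst p)) \<in> schwartz"
  using schwartz_compose_linear[OF _ linear_swap inj_swap, of F] by (simp add: prod.swap_def)

definition integral_fst :: "('a::euclidean_space \<times> 'b \<Rightarrow> complex) \<Rightarrow> 'b \<Rightarrow> complex" where
  "integral_fst F = (\<lambda>w. \<integral>z. F (z, w) \<partial>lborel)"

lemma schwartz_op_integral_fst:
  "schwartz_op (integral_fst :: ('a::euclidean_space \<times> 'b::euclidean_space \<Rightarrow> complex) \<Rightarrow> _)"
proof (rule schwartz_op_cong[OF schwartz_op_compose[OF schwartz_op_apply_snd[OF tempered_integral]
      schwartz_op_compose_linear[OF linear_swap inj_swap]]])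
  show "apply_snd (\<lambda>f. \<integral>z. f z \<partial>lborel) (\<lambda>x. F (prod.swap x)) = integral_fst F" for F :: "'a \<times> 'b \<Rightarrow> complex"
    by (simp add: apply_snd_def integral_fst_def)
qed

lemma partial_derivs_integral_fst:
  fixes F :: "'a::euclidean_space \<times> 'b::euclidean_space \<Rightarrow> complex"
  assumes "F \<in> schwartz" "set bs \<subseteq> Basis"
  shows "partial_derivs bs (integral_fst F) = integral_fst (partial_derivs (map (Pair 0) bs) F)"
  using assms(2)
proof (induction bs)
  case (Cons b bs)
  let ?G = "partial_derivs (map (Pair 0) bs) F"
  let ?v = "\<lambda>f::'a \<Rightarrow> complex. \<integral>x. f x \<partial>lborel"
  have G: "?G \<in> schwartz"
    using Cons.prems map_Pair_Basis[of bs] by (intro partial_derivs_schwartz assms) auto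
  have bl: "bounded_linear (prod.swap :: 'b \<times> 'a \<Rightarrow> _)"
    using linear_swap linear_conv_bounded_linear by blast
  have b: "b \<in> Basis"
    using Cons.prems by simp
  have "integral_fst ?G = apply_snd ?v (\<lambda>w. ?G (prod.swap w))"
    by (simp add: apply_snd_def integral_fst_def)
  then have "partial_deriv b (integral_fst ?G) = integral_fst (partial_deriv (0, b) ?G)"
    using partial_deriv_apply_snd[OF tempered_integral schwartz_compose_linear[OF G linear_swap inj_swap] b]
    by (simp add: fun_eq_iff partial_deriv_compose_linear(1)[OF bl schwartz_differentiable[OF G]] apply_snd_def integral_fst_def)
  then show ?case
    using Cons by simp
qed simp

text \<open>Each norm of the slices has an integrable majorant in \<open>z\<close>, which controls
  the tails of integrals of slices.\<close>

lemma snorm_slice_weight: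
  fixes F :: "'a::euclidean_space \<times> 'b::euclidean_space \<Rightarrow> complex"
  assumes F: "F \<in> schwartz"
  obtains C where "C \<ge> 0" "\<And>z. snorm n (\<lambda>w. F (z, w)) \<le> C * weight z"
proof
  let ?N = "2 * DIM('a)"
  let ?C = "2 ^ ?N * (snorm n F + snorm (n + ?N) F)"
  show "?C \<ge> 0"
    using snorm_nonneg[OF F] by (intro mult_nonneg_nonneg add_nonneg_nonneg) auto
  fix z
  have s: "0 \<le> snorm n (\<lambda>w. F (z, w))"
    by (intro snorm_nonneg slice_schwartz F)
  have "(1 + norm z) ^ ?N * snorm n (\<lambda>w. F (z, w)) \<le> 2 ^ ?N * (1 + norm z ^ ?N) * snorm n (\<lambda>w. F (z, w))"
    by (intro mult_right_mono power_one_plus_norm_le s)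
  also have "\<dots> = 2 ^ ?N * (norm z ^ 0 * snorm n (\<lambda>w. F (z, w)) + norm z ^ ?N * snorm n (\<lambda>w. F (z, w)))"
    by (simp add: algebra_simps)
  also have "\<dots> \<le> 2 ^ ?N * (snorm (n + 0) F + snorm (n + ?N) F)"
    by (intro mult_left_mono add_mono snorm_slice F) auto
  finally have "(1 + norm z) ^ ?N * snorm n (\<lambda>w. F (z, w)) \<le> ?C"
    by simp
  moreover have "(1 + norm z) ^ ?N > 0"
    by (simp add: add_pos_nonneg)
  ultimately show "snorm n (\<lambda>w. F (z, w)) \<le> ?C * weight z"
    unfolding weight_def by (simp add: field_simps)
qed

text \<open>Linearity of a functional reaches only finite sums, and composing with a simple function
  turns the integral into one. The set \<open>K\<close> keeps the coefficients finite, since level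
  sets of \<open>s\<close> may have infinite measure.\<close>

lemma integral_simple_compose:
  fixes h :: "'a::euclidean_space \<Rightarrow> complex"
  assumes s: "simple_function lborel s" and K: "K \<in> sets lborel" "emeasure lborel K < \<infinity>"
  shows "(\<integral>z. indicator K z * h (s z) \<partial>lborel) = (\<Sum>c\<in>range s. of_real (measure lborel (K \<inter> s -` {c})) * h c)"
    and "integrable lborel (\<lambda>z. indicator K z * h (s z))"
proof -
  have fin: "finite (range s)" and meas: "s -` {c} \<in> sets lborel" for c
    using simple_functionD[OF s] by auto
  have eq: "indicator K z * h (s z) = (\<Sum>c\<in>range s. indicator (K \<inter> s -` {c}) z * h c)" for z
  proof -
    have "(\<Sum>c\<in>range s. indicator (K \<inter> s -` {c}) z * h c) = (\<Sum>c\<in>range s. if s z = c then indicator K z * h c else 0)"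
      by (intro sum.cong) (auto simp: indicator_def)
    then show ?thesis
      using fin by simp
  qed
  have int: "integrable lborel (\<lambda>z. indicator (K \<inter> s -` {c}) z * h c)" for c
  proof (intro integrable_mult_left)
    have "emeasure lborel (K \<inter> s -` {c}) \<le> emeasure lborel K"
      by (intro emeasure_mono K) auto
    then have "integrable lborel (indicator (K \<inter> s -` {c}) :: _ \<Rightarrow> real)"
      using K meas[of c] by (intro integrable_real_indicator) auto
    from integrable_of_real[OF this, where ?'a = complex]
    show "integrable lborel (indicator (K \<inter> s -` {c}) :: _ \<Rightarrow> complex)"
      by (simp add: of_real_indicator)
  qed
  show "integrable lborel (\<lambda>z. indicator K z * h (s z))"
    unfolding eq by (intro Bochner_Integration.integrable_sum int)
  have "(\<integral>z. indicator (K \<inter> s -` {c}) z * h c \<partial>lborel) = of_real (measure lborel (K \<inter> s -` {c})) * h c" for c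
    using integral_complex_of_real[of lborel "indicator (K \<inter> s -` {c})"] by (simp add: of_real_indicator)
  then show "(\<integral>z. indicator K z * h (s z) \<partial>lborel) = (\<Sum>c\<in>range s. of_real (measure lborel (K \<inter> s -` {c})) * h c)"
    unfolding eq Bochner_Integration.integral_sum[OF int] by (simp only:)
qed

text \<open>Replacing \<open>z\<close> by a simple function on a large ball turns both sides into
  \<open>U\<close> of the same finite sum of slices. Continuity of \<open>U\<close> reduces the two
  errors to \<open>snorm m\<close> distances of slices, which are Lipschitz in \<open>z\<close> on
  the ball and integrable outside it.\<close>

theorem tempered_integral_commute:
  fixes F :: "'a::euclidean_space \<times> 'b::euclidean_space \<Rightarrow> complex"
  assumes U: "tempered U" and F: "F \<in> schwartz"
  shows "U (integral_fst F) = (\<integral>z. U (\<lambda>w. F (z, w)) \<partial>lborel)"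
proof -
  note lin = tempered_linear[OF U]
  obtain m C where C: "C \<ge> 0" "\<And>f. f \<in> schwartz \<Longrightarrow> norm (U f) \<le> C * snorm m f"
    using tempered_bound[OF U] by blast
  obtain W where W: "W \<ge> 0" "\<And>z. snorm m (\<lambda>w. F (z, w)) \<le> W * weight z"
    using snorm_slice_weight[OF F] by blast
  define D where "D = real DIM('a) * snorm (m + 1) F"
  have D: "D \<ge> 0"
    using snorm_nonneg[OF F] by (simp add: D_def)
  have lip: "snorm m (\<lambda>w. F (z', w) - F (z, w)) \<le> D * norm (z' - z)" for z z'
    using snorm_slice_difference[OF F, of m z "z' - z"] by (simp add: D_def mult_ac)
  have sl: "(\<lambda>w. F (z, w)) \<in> schwartz" for z
    by (rule slice_schwartz[OF F])
  have intU: "integrable lborel (\<lambda>z. U (\<lambda>w. F (z, w)))"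
    using integrable_schwartz[OF schwartz_opD(1)[OF schwartz_op_apply_snd[OF U] F]]
    by (simp add: apply_snd_def)
  have I: "integral_fst F \<in> schwartz"
    by (rule schwartz_opD(1)[OF schwartz_op_integral_fst F])
  define K where "K = (\<lambda>n::nat. cball (0 :: 'a) (real n))"
  have K: "K n \<in> sets lborel" "emeasure lborel (K n) < \<infinity>" for n
    using emeasure_bounded_finite[OF bounded_cball] by (auto simp: K_def)
  obtain s :: "nat \<Rightarrow> 'a \<Rightarrow> 'a" where s: "\<And>i. simple_function lborel (s i)"
    "\<And>z. (\<lambda>i. s i z) \<longlonglongrightarrow> z" "\<And>i z. norm (s i z) \<le> 2 * norm z"
    using borel_measurable_implies_sequence_metric[of "\<lambda>z::'a. z" lborel 0] by auto
  let ?J = "\<integral>z. U (\<lambda>w. F (z, w)) \<partial>lborel"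
  \<comment> \<open>Pointwise majorant for the \<open>snorm m\<close> distance between a slice and
    its approximation: a Lipschitz error on the ball, the whole slice off it.\<close>
  define e where "e = (\<lambda>n i z. indicator (K n) z * (D * norm (s i z - z)) + indicator (- K n) z * (W * weight z))"
  have sm [measurable]: "s i \<in> borel_measurable borel" for i
    using borel_measurable_simple_function[OF s(1)] by simp
  have Km [measurable]: "K n \<in> sets borel" for n
    by (simp add: K_def)
  \<comment> \<open>The approximants satisfy \<open>norm (s i z) \<le> 2 * norm z\<close>, hence the
    factor 3 on the ball of radius \<open>n\<close>.\<close>
  have int1: "integrable lborel (\<lambda>z. indicator (K n) z * (D * norm (s i z - z)))" for n i
  proof (rule Bochner_Integration.integrable_bound)
    show "integrable lborel (\<lambda>z. indicator (K n) z * (D * (3 * real n)))"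
      using K[of n] by (intro integrable_mult_left integrable_real_indicator)
    show "AE z in lborel. norm (indicator (K n) z * (D * norm (s i z - z))) \<le> norm (indicator (K n) z * (D * (3 * real n)))"
    proof (rule AE_I2)
      fix z
      have "norm (s i z - z) \<le> 3 * real n" if "z \<in> K n"
        using norm_triangle_ineq4[of "s i z" z] s(3)[of i z] that by (simp add: K_def)
      then show "norm (indicator (K n) z * (D * norm (s i z - z))) \<le> norm (indicator (K n) z * (D * (3 * real n)))"
        using D by (auto simp: indicator_def intro!: mult_left_mono)
    qed
  qed simp
  have int2: "integrable lborel (\<lambda>z. indicator (- K n) z * (W * weight z))" for n
    by (rule Bochner_Integration.integrable_bound[OF integrable_mult_right[OF integrable_weight, of W]])
      (auto simp: indicator_def W weight_pos less_imp_le)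
  have inte: "integrable lborel (e n i)" for n i
    unfolding e_def by (intro Bochner_Integration.integrable_add int1 int2)
  \<comment> \<open>The factor 2 counts the two comparisons with \<open>U S\<close>, one for each
    side of the claim.\<close>
  have est: "norm (U (integral_fst F) - ?J) \<le> 2 * C * (\<integral>z. e n i z \<partial>lborel)" for n i
  proof -
    let ?c = "\<lambda>c. of_real (measure lborel (K n \<inter> s i -` {c})) :: complex"
    define S where "S = (\<lambda>w. \<Sum>c\<in>range (s i). ?c c * F (c, w))"
    have S: "S \<in> schwartz"
      unfolding S_def by (intro schwartz_sum schwartz_cmult sl)
    have US: "U S = (\<integral>z. indicator (K n) z * U (\<lambda>w. F (s i z, w)) \<partial>lborel)"
      unfolding S_def integral_simple_compose(1)[OF s(1) K, where h = "\<lambda>z. U (\<lambda>w. F (z, w))"]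
      by (subst linear_on_schwartz_sum[OF lin])
        (auto simp: linear_on_schwartzD(2)[OF lin] sl intro!: schwartz_cmult)
    have le_e: "snorm m (\<lambda>w. F (z, w) - indicator (K n) z * F (s i z, w)) \<le> e n i z" for z
    proof (cases "z \<in> K n")
      case True
      then show ?thesis
        using lip[of z "s i z"] by (simp add: e_def norm_minus_commute)
    next
      case False
      then show ?thesis
        using W(2)[of z] by (simp add: e_def)
    qed
    have sd: "(\<lambda>w. F (z, w) - indicator (K n) z * F (s i z, w)) \<in> schwartz" for z
      by (intro schwartz_diff schwartz_cmult sl)
    have "norm (U (integral_fst F) - U S) \<le> C * (\<integral>z. e n i z \<partial>lborel)"
    proof -
      have "snorm m (\<lambda>w. integral_fst F w - S w) \<le> (\<integral>z. e n i z \<partial>lborel)"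
      proof (rule snorm_least)
        fix k bs w assume *: "k \<le> m" "set bs \<subseteq> (Basis :: 'b set)" "length bs \<le> m"
        let ?G = "partial_derivs (map (Pair 0) bs) F"
        have G: "?G \<in> schwartz"
          by (intro partial_derivs_schwartz F map_Pair_Basis *)
        have ints: "integrable lborel (\<lambda>z. ?G (z, w))" "integrable lborel (\<lambda>z. indicator (K n) z * ?G (s i z, w))"
          using integrable_schwartz[OF slice_schwartz[OF swap_schwartz[OF G], of w]]
            integral_simple_compose(2)[OF s(1) K, where h = "\<lambda>z. ?G (z, w)"] by auto
        have "partial_derivs bs (\<lambda>w. integral_fst F w - S w) w = integral_fst ?G w - (\<Sum>c\<in>range (s i). ?c c * ?G (c, w))"
          unfolding partial_derivs_diff[OF schwartz_smooth[OF I] schwartz_smooth[OF S] *(2)]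
            partial_derivs_integral_fst[OF F *(2)]
          unfolding S_def partial_derivs_sum[OF sl *(2)] partial_derivs_slice[OF F *(2)] ..
        also have "\<dots> = (\<integral>z. ?G (z, w) - indicator (K n) z * ?G (s i z, w) \<partial>lborel)"
          unfolding integral_simple_compose(1)[OF s(1) K, where h = "\<lambda>z. ?G (z, w)", symmetric] integral_fst_def
          by (rule Bochner_Integration.integral_diff[OF ints, symmetric])
        finally have "norm w ^ k * norm (partial_derivs bs (\<lambda>w. integral_fst F w - S w) w) =
          norm (\<integral>z. of_real (norm w ^ k) * (?G (z, w) - indicator (K n) z * ?G (s i z, w)) \<partial>lborel)"
          by (simp add: norm_mult norm_power)
        also have "\<dots> \<le> (\<integral>z. e n i z \<partial>lborel)"
        proof (rule Bochner_Integration.integral_norm_bound_integral[OF _ inte])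
          show "integrable lborel (\<lambda>z. of_real (norm w ^ k) * (?G (z, w) - indicator (K n) z * ?G (s i z, w)))"
            by (intro integrable_mult_right Bochner_Integration.integrable_diff ints)
          fix z
          have "?G (z, w) - indicator (K n) z * ?G (s i z, w) =
            partial_derivs bs (\<lambda>w. F (z, w) - indicator (K n) z * F (s i z, w)) w"
            unfolding partial_derivs_diff[OF schwartz_smooth[OF sl] schwartz_smooth[OF schwartz_cmult[OF sl]] *(2)]
              partial_derivs_cmult[OF schwartz_smooth[OF sl] *(2)] partial_derivs_slice[OF F *(2)] ..
          then have "norm (of_real (norm w ^ k) * (?G (z, w) - indicator (K n) z * ?G (s i z, w)))
            = norm w ^ k * norm (partial_derivs bs (\<lambda>w. F (z, w) - indicator (K n) z * F (s i z, w)) w)"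
            by (simp add: norm_mult norm_power)
          also have "\<dots> \<le> e n i z"
            using snorm_upper[OF sd *, of w z] le_e[of z] by linarith
          finally show "norm (of_real (norm w ^ k) * (?G (z, w) - indicator (K n) z * ?G (s i z, w))) \<le> e n i z" .
        qed
        finally show "norm w ^ k * norm (partial_derivs bs (\<lambda>w. integral_fst F w - S w) w) \<le> (\<integral>z. e n i z \<partial>lborel)" .
      qed
      then show ?thesis
        using order_trans[OF C(2)[OF schwartz_diff[OF I S]] mult_left_mono[OF _ C(1)]]
        by (simp add: linear_on_schwartz_diff[OF lin I S])
    qed
    moreover have "norm (?J - U S) \<le> C * (\<integral>z. e n i z \<partial>lborel)"
    proof -
      have "?J - U S = (\<integral>z. U (\<lambda>w. F (z, w)) - indicator (K n) z * U (\<lambda>w. F (s i z, w)) \<partial>lborel)"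
        unfolding US
        by (rule Bochner_Integration.integral_diff[OF intU
              integral_simple_compose(2)[OF s(1) K, where h = "\<lambda>z. U (\<lambda>w. F (z, w))"], symmetric])
      also have "norm \<dots> \<le> (\<integral>z. C * e n i z \<partial>lborel)"
      proof (rule Bochner_Integration.integral_norm_bound_integral[OF _ integrable_mult_right[OF inte]])
        show "integrable lborel (\<lambda>z. U (\<lambda>w. F (z, w)) - indicator (K n) z * U (\<lambda>w. F (s i z, w)))"
          by (intro Bochner_Integration.integrable_diff intU
            integral_simple_compose(2)[OF s(1) K, where h = "\<lambda>z. U (\<lambda>w. F (z, w))"])
        fix z
        have "U (\<lambda>w. F (z, w)) - indicator (K n) z * U (\<lambda>w. F (s i z, w)) =
          U (\<lambda>w. F (z, w) - indicator (K n) z * F (s i z, w))"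
          by (simp add: linear_on_schwartz_diff[OF lin] linear_on_schwartzD(2)[OF lin] sl schwartz_cmult)
        also have "norm \<dots> \<le> C * e n i z"
          by (intro order_trans[OF C(2)[OF sd]] mult_left_mono le_e C)
        finally show "norm (U (\<lambda>w. F (z, w)) - indicator (K n) z * U (\<lambda>w. F (s i z, w))) \<le> C * e n i z" .
      qed
      finally show ?thesis
        by simp
    qed
    ultimately show ?thesis
      using norm_triangle_ineq4[of "U (integral_fst F) - U S" "?J - U S"] by simp
  qed
  have lim1: "(\<lambda>i. \<integral>z. indicator (K n) z * (D * norm (s i z - z)) \<partial>lborel) \<longlonglongrightarrow> (\<integral>z. 0 \<partial>(lborel :: 'a measure))" for n
  proof (rule integral_dominated_convergence[where w = "\<lambda>z. indicator (K n) z * (D * (3 * real n))"])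
    show "integrable lborel (\<lambda>z. indicator (K n) z * (D * (3 * real n)))"
      using K[of n] by (intro integrable_mult_left integrable_real_indicator)
    show "AE z in lborel. (\<lambda>i. indicator (K n) z * (D * norm (s i z - z))) \<longlonglongrightarrow> 0"
    proof (rule AE_I2)
      fix z
      have "(\<lambda>i. indicator (K n) z * (D * norm (s i z - z))) \<longlonglongrightarrow> indicator (K n) z * (D * norm (z - z))"
        by (intro tendsto_intros s(2))
      then show "(\<lambda>i. indicator (K n) z * (D * norm (s i z - z))) \<longlonglongrightarrow> 0"
        by simp
    qed
    show "AE z in lborel. norm (indicator (K n) z * (D * norm (s i z - z))) \<le> indicator (K n) z * (D * (3 * real n))" for i
    proof (rule AE_I2)
      fix z
      have "norm (s i z - z) \<le> 3 * real n" if "z \<in> K n"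
        using norm_triangle_ineq4[of "s i z" z] s(3)[of i z] that by (simp add: K_def)
      then show "norm (indicator (K n) z * (D * norm (s i z - z))) \<le> indicator (K n) z * (D * (3 * real n))"
        using D by (auto simp: indicator_def intro!: mult_left_mono)
    qed
  qed simp_all
  \<comment> \<open>The mesh tends to 0 first, with the ball fixed, because the Lipschitz error is
    controlled only over a bounded region. The ball exhausts the space afterwards.\<close>
  have est2: "norm (U (integral_fst F) - ?J) \<le> 2 * C * (\<integral>z. indicator (- K n) z * (W * weight z) \<partial>lborel)" for n
  proof (rule LIMSEQ_le_const)
    have "(\<integral>z. e n i z \<partial>lborel) = (\<integral>z. indicator (K n) z * (D * norm (s i z - z)) \<partial>lborel) +
        (\<integral>z. indicator (- K n) z * (W * weight z) \<partial>lborel)" for i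
      unfolding e_def by (intro Bochner_Integration.integral_add int1 int2)
    then show "(\<lambda>i. 2 * C * (\<integral>z. e n i z \<partial>lborel)) \<longlonglongrightarrow> 2 * C * (\<integral>z. indicator (- K n) z * (W * weight z) \<partial>lborel)"
      using tendsto_mult_left[OF tendsto_add[OF lim1[of n] tendsto_const], of "2 * C" "\<integral>z. indicator (- K n) z * (W * weight z) \<partial>lborel"]
      by simp
    show "\<exists>N. \<forall>i\<ge>N. norm (U (integral_fst F) - ?J) \<le> 2 * C * (\<integral>z. e n i z \<partial>lborel)"
      using est by blast
  qed
  have lim2: "(\<lambda>n. \<integral>z. indicator (- K n) z * (W * weight z) \<partial>lborel) \<longlonglongrightarrow> (\<integral>z. 0 \<partial>(lborel :: 'a measure))"
  proof (rule integral_dominated_convergence[where w = "\<lambda>z. W * weight z"])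
    show "integrable lborel (\<lambda>z::'a. W * weight z)"
      by (intro integrable_mult_right integrable_weight)
    show "AE z in lborel. (\<lambda>n. indicator (- K n) z * (W * weight z)) \<longlonglongrightarrow> 0"
    proof (rule AE_I2)
      fix z :: 'a
      obtain N where "norm z \<le> real N"
        using real_arch_simple by blast
      then have "indicator (- K n) z * (W * weight z) = 0" if "n \<ge> N" for n
        using that by (auto simp: K_def indicator_def)
      then show "(\<lambda>n. indicator (- K n) z * (W * weight z)) \<longlonglongrightarrow> 0"
        by (intro tendsto_eventually) (auto simp: eventually_sequentially)
    qed
    show "AE z in lborel. norm (indicator (- K n) z * (W * weight z)) \<le> W * weight z" for n
      using W(1) less_imp_le[OF weight_pos]
      by (intro AE_I2) (auto simp: indicator_def intro!: mult_nonneg_nonneg)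
  qed simp_all
  have "norm (U (integral_fst F) - ?J) \<le> 0"
    using LIMSEQ_le_const[OF tendsto_mult_left[OF lim2, of "2 * C"], of "norm (U (integral_fst F) - ?J)"] est2
    by simp
  then show ?thesis
    by simp
qed

text \<open>Fubini's theorem as the case in which the distribution is itself an integral.\<close>

lemma integral_swap_schwartz:
  fixes F :: "'a::euclidean_space \<times> 'b::euclidean_space \<Rightarrow> complex"
  assumes "F \<in> schwartz"
  shows "(\<integral>w. (\<integral>z. F (z, w) \<partial>lborel) \<partial>lborel) = (\<integral>z. (\<integral>w. F (z, w) \<partial>lborel) \<partial>lborel)"
  using tempered_integral_commute[OF tempered_integral assms] by (simp add: integral_fst_def)

section \<open>Tensor products are total\<close>

text \<open>A translation is not linear, but it is a slice of a linear shear. The Gaussian in the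
  auxiliary variable becomes a nonzero constant on the slice and is divided out.\<close>

lemma translate_schwartz:
  fixes f :: "'a::euclidean_space \<Rightarrow> complex"
  assumes "f \<in> schwartz"
  shows "(\<lambda>x. f (x + c)) \<in> schwartz"
proof -
  define A where "A = (\<lambda>z :: 'a \<times> 'a. (fst z, snd z + fst z))"
  have "linear A" "inj A"
    by (auto simp: A_def algebra_simps intro!: linearI injI)
  from slice_schwartz[OF schwartz_compose_linear[OF tensor_schwartz[OF gauss_schwartz assms] this], of c]
  have "(\<lambda>x. gauss c * f (x + c)) \<in> schwartz"
    by (simp add: A_def tensor_def)
  from schwartz_cmult[OF this, of "inverse (gauss c)"] show ?thesis
    by (simp add: gauss_nonzero mult.assoc[symmetric])
qed

lemma scale_schwartz:
  fixes f :: "'a::euclidean_space \<Rightarrow> complex"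
  assumes "f \<in> schwartz" "r \<noteq> 0"
  shows "(\<lambda>x. f (r *\<^sub>R x)) \<in> schwartz"
  using assms(2) by (intro schwartz_compose_linear[OF assms(1)] linearI injI) (auto simp: algebra_simps)

lemma integral_gauss: "(\<integral>x. gauss (x :: 'a::euclidean_space) \<partial>lborel) = of_real (sqrt (2 * pi) ^ DIM('a))"
proof -
  let ?g = "\<lambda>x::real. exp (- x\<^sup>2 / 2)"
  have "has_bochner_integral lborel std_normal_density 1"
    using std_normal_moment_even[of 0] by simp
  from has_bochner_integral_mult_right[OF this, of "sqrt (2 * pi)"]
  have "has_bochner_integral lborel ?g (sqrt (2 * pi))"
    by (simp add: std_normal_density_def)
  then have 1: "(\<integral>\<^sup>+x. ennreal (?g x) \<partial>lborel) = ennreal (sqrt (2 * pi))"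
    by (subst nn_integral_eq_integral) (auto simp: has_bochner_integral_iff)
  have "(\<integral>\<^sup>+x. ennreal (exp (- ((x :: 'a) \<bullet> x) / 2)) \<partial>lborel) = (\<integral>\<^sup>+x. (\<Prod>b\<in>Basis. ennreal (?g ((x :: 'a) \<bullet> b))) \<partial>lborel)"
  proof (rule nn_integral_cong)
    fix x :: 'a
    have "exp (- (x \<bullet> x) / 2) = (\<Prod>b\<in>Basis. ?g (x \<bullet> b))"
      unfolding euclidean_inner[of x x]
      by (simp add: exp_sum[symmetric] sum_negf[symmetric] sum_divide_distrib power2_eq_square)
    then show "ennreal (exp (- (x \<bullet> x) / 2)) = (\<Prod>b\<in>Basis. ennreal (?g (x \<bullet> b)))"
      by (simp add: prod_ennreal)
  qed
  also have "\<dots> = (\<Prod>b\<in>(Basis :: 'a set). ennreal (sqrt (2 * pi)))"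
    unfolding 1[symmetric] by (rule nn_integral_lborel_prod[where f = "\<lambda>b. ?g"]) auto
  also have "\<dots> = ennreal (sqrt (2 * pi) ^ DIM('a))"
    by (simp add: ennreal_power)
  finally have "(\<integral>x. exp (- ((x :: 'a) \<bullet> x) / 2) \<partial>lborel) = sqrt (2 * pi) ^ DIM('a)"
    by (subst integral_eq_nn_integral) auto
  then show ?thesis
    unfolding gauss_def integral_complex_of_real by simp
qed

lemma norm_gauss: "norm (gauss x) = exp (- (x \<bullet> x) / 2)"
  by (simp add: gauss_def)

lemma norm_gauss_scale: "norm (gauss (r *\<^sub>R x)) = exp (- (r\<^sup>2 * (x \<bullet> x)) / 2)"
  unfolding norm_gauss by (simp add: power2_eq_square mult.assoc)

lemma isCont_schwartz: "f \<in> schwartz \<Longrightarrow> isCont f x"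
  by (intro differentiable_imp_continuous_within schwartz_differentiable)

text \<open>
  Mollification: \<open>F\<close> is the limit of its convolutions with narrow Gaussians, and these are
  superpositions of translated Gaussians, which are tensor products.
\<close>

theorem tempered_eq_zero_if_zero_on_tensors:
  fixes U :: "('a::euclidean_space \<times> 'b::euclidean_space) distr"
  assumes U: "tempered U"
    and zero: "\<And>f g. f \<in> schwartz \<Longrightarrow> g \<in> schwartz \<Longrightarrow> U (tensor f g) = 0"
    and F: "F \<in> schwartz"
  shows "U F = 0"
proof -
  note lin = tempered_linear[OF U]
  \<comment> \<open>Translates of \<open>F\<close> paired with \<open>U\<close> need not decay in
    the translation parameter. The Gaussian factor makes \<open>k\<close> a Schwartz function,
    whence \<open>h = k / gauss\<close> is continuous with controlled growth.\<close>
  define k where "k = (\<lambda>v. U (\<lambda>x. gauss v * F (x - v)))"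
  define h where "h = (\<lambda>v. U (\<lambda>x. F (x - v)))"
  have Fv: "(\<lambda>x. F (x - v)) \<in> schwartz" for v
    using translate_schwartz[OF F, of "- v"] by simp
  have k_eq: "k v = gauss v * h v" for v
    unfolding k_def h_def by (rule linear_on_schwartzD(2)[OF lin Fv])
  have k: "k \<in> schwartz"
  proof -
    define A where "A = (\<lambda>z :: ('a \<times> 'b) \<times> ('a \<times> 'b). (fst z, snd z - fst z))"
    have A: "linear A" "inj A"
      by (auto simp: A_def algebra_simps intro!: linearI injI)
    show ?thesis
      using schwartz_opD(1)[OF schwartz_op_apply_snd[OF U] schwartz_compose_linear[OF tensor_schwartz[OF gauss_schwartz F] A]]
      by (simp add: apply_snd_def A_def tensor_def k_def)
  qed
  have int_zero: "(\<integral>y. gauss y * h (t *\<^sub>R y) \<partial>lborel) = 0" if t: "t \<noteq> 0" for t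
  proof -
    define A where "A = (\<lambda>z :: ('a \<times> 'b) \<times> ('a \<times> 'b). (fst z, snd z - t *\<^sub>R fst z))"
    have A: "linear A" "inj A"
      by (auto simp: A_def algebra_simps intro!: linearI injI)
    define P where "P = (\<lambda>z. tensor gauss F (A z))"
    have P: "P \<in> schwartz"
      unfolding P_def by (intro schwartz_compose_linear[OF _ A] tensor_schwartz gauss_schwartz F)
    \<comment> \<open>Corresponds to the substitution \<open>y = (x - z) / t\<close>, which moves
      the dependence on \<open>x\<close> from \<open>F\<close> to the Gaussian. For fixed
      \<open>z\<close> what remains is a tensor product in \<open>x\<close>.\<close>
    define B where "B = (\<lambda>z :: ('a \<times> 'b) \<times> ('a \<times> 'b). (fst z, (1 / t) *\<^sub>R (snd z - fst z)))"
    have B: "linear B" "inj B"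
      using t by (auto simp: B_def algebra_simps intro!: linearI injI)
    define Q where "Q = (\<lambda>z. tensor F gauss (B z))"
    have Q: "Q \<in> schwartz"
      unfolding Q_def by (intro schwartz_compose_linear[OF _ B] tensor_schwartz gauss_schwartz F)
    have "(\<integral>y. gauss y * h (t *\<^sub>R y) \<partial>lborel) = (\<integral>y. U (\<lambda>x. P (y, x)) \<partial>lborel)"
      unfolding h_def P_def A_def tensor_def by (simp add: linear_on_schwartzD(2)[OF lin Fv])
    also have "\<dots> = U (integral_fst P)"
      by (rule tempered_integral_commute[OF U P, symmetric])
    also have "integral_fst P = (\<lambda>x. of_real (\<bar>- 1 / t\<bar> ^ DIM('a \<times> 'b)) * integral_fst Q x)"
    proof
      fix x
      have m: "(\<lambda>y. P (y, x)) \<in> borel_measurable borel"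
        using schwartz_borel_measurable[OF slice_schwartz[OF swap_schwartz[OF P], of x]] by simp
      have "integral_fst P x = of_real (\<bar>- 1 / t\<bar> ^ DIM('a \<times> 'b)) * (\<integral>z. P ((1 / t) *\<^sub>R x + (- 1 / t) *\<^sub>R z, x) \<partial>lborel)"
        unfolding integral_fst_def using t by (intro integral_lborel_affine[OF m]) auto
      also have "(\<lambda>z. P ((1 / t) *\<^sub>R x + (- 1 / t) *\<^sub>R z, x)) = (\<lambda>z. Q (z, x))"
        using t by (simp add: P_def Q_def A_def B_def tensor_def algebra_simps)
      finally show "integral_fst P x = of_real (\<bar>- 1 / t\<bar> ^ DIM('a \<times> 'b)) * integral_fst Q x"
        by (simp add: integral_fst_def)
    qed
    also have "U \<dots> = of_real (\<bar>- 1 / t\<bar> ^ DIM('a \<times> 'b)) * U (integral_fst Q)"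
      by (rule linear_on_schwartzD(2)[OF lin schwartz_opD(1)[OF schwartz_op_integral_fst Q]])
    also have "U (integral_fst Q) = (\<integral>z. U (\<lambda>x. Q (z, x)) \<partial>lborel)"
      by (rule tempered_integral_commute[OF U Q])
    also have "(\<lambda>z. U (\<lambda>x. Q (z, x))) = (\<lambda>z. 0)"
    proof
      fix z :: "'a \<times> 'b"
      define f where "f = (\<lambda>p :: 'a. gauss ((1 / t) *\<^sub>R (p - fst z)))"
      define g where "g = (\<lambda>q :: 'b. gauss ((1 / t) *\<^sub>R (q - snd z)))"
      have f: "f \<in> schwartz"
        using translate_schwartz[OF scale_schwartz[OF gauss_schwartz, of "1 / t"], of "- fst z"] t by (simp add: f_def)
      have g: "g \<in> schwartz"
        using translate_schwartz[OF scale_schwartz[OF gauss_schwartz, of "1 / t"], of "- snd z"] t by (simp add: g_def)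
      have "(\<lambda>x. Q (z, x)) = (\<lambda>x. F z * tensor f g x)"
        by (cases z) (auto simp: Q_def B_def tensor_def f_def g_def fun_eq_iff gauss_Pair[symmetric])
      then show "U (\<lambda>x. Q (z, x)) = 0"
        using linear_on_schwartzD(2)[OF lin tensor_schwartz[OF f g], of "F z"] zero[OF f g] by simp
    qed
    finally show ?thesis
      by simp
  qed
  \<comment> \<open>The shift by 2 keeps \<open>?t n\<close> at most 1/2. The quotient
    \<open>gauss y / gauss (?t n *\<^sub>R y)\<close> then stays below
    \<open>gauss ((1 / 2) *\<^sub>R y)\<close> in modulus, an integrable majorant that does not
    depend on \<open>n\<close>.\<close>
  let ?t = "\<lambda>n::nat. 1 / (real n + 2)"
  have t: "?t n \<noteq> 0" "0 \<le> ?t n" "?t n \<le> 1 / 2" for n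
    by (auto simp: field_simps)
  have tlim: "?t \<longlonglongrightarrow> 0"
    by real_asymp
  have "(\<lambda>n. \<integral>y. gauss y * h (?t n *\<^sub>R y) \<partial>lborel) \<longlonglongrightarrow> (\<integral>y. gauss (y :: 'a \<times> 'b) * h 0 \<partial>lborel)"
  proof (rule integral_dominated_convergence)
    have h_eq: "h v = k v / gauss v" for v
      by (simp add: k_eq gauss_nonzero)
    have cont: "isCont h v" for v
      unfolding h_eq by (intro isCont_divide isCont_schwartz k gauss_schwartz gauss_nonzero)
    then have hm: "h \<in> borel_measurable borel"
      by (intro borel_measurable_continuous_onI) (simp add: continuous_on_eq_continuous_at)
    have gm: "(gauss :: 'a \<times> 'b \<Rightarrow> complex) \<in> borel_measurable borel"
      by (rule schwartz_borel_measurable[OF gauss_schwartz])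
    show "(\<lambda>y :: 'a \<times> 'b. gauss y * h 0) \<in> borel_measurable lborel"
      using gm by simp
    show "(\<lambda>y. gauss y * h (?t n *\<^sub>R y)) \<in> borel_measurable lborel" for n
      using gm measurable_compose[OF _ hm, of "\<lambda>y. ?t n *\<^sub>R y" borel] by simp
    show "integrable lborel (\<lambda>y :: 'a \<times> 'b. snorm 0 k * norm (gauss ((1 / 2) *\<^sub>R y)))"
      by (intro integrable_mult_right integrable_norm integrable_schwartz scale_schwartz gauss_schwartz) simp
    show "AE y in lborel. (\<lambda>n. gauss y * h (?t n *\<^sub>R y)) \<longlonglongrightarrow> gauss y * h 0"
    proof (rule AE_I2)
      fix y :: "'a \<times> 'b"
      have "(\<lambda>n. ?t n *\<^sub>R y) \<longlonglongrightarrow> 0"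
        using tendsto_scaleR[OF tlim tendsto_const, of y] by simp
      then show "(\<lambda>n. gauss y * h (?t n *\<^sub>R y)) \<longlonglongrightarrow> gauss y * h 0"
        by (intro tendsto_mult tendsto_const isCont_tendsto_compose[OF cont])
    qed
    show "AE y in lborel. norm (gauss y * h (?t n *\<^sub>R y)) \<le> snorm 0 k * norm (gauss ((1 / 2) *\<^sub>R y))" for n
    proof (rule AE_I2)
      fix y :: "'a \<times> 'b"
      have arith_exp: "exp (- s / 2) / exp (- (r * s) / 2) = exp (- s / 2 + r * s / 2)" for r s :: real
        by (simp flip: exp_diff)
      have arith: "- s / 2 + r * s / 2 \<le> - ((1 / 2)\<^sup>2 * s) / 2" if "r * s \<le> (1 / 2)\<^sup>2 * s" "0 \<le> s" for r s :: real
        using that by (simp add: power2_eq_square)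
      have "(?t n)\<^sup>2 \<le> (1 / 2)\<^sup>2"
        using t by (intro power_mono)
      then have "(?t n)\<^sup>2 * (y \<bullet> y) \<le> (1 / 2)\<^sup>2 * (y \<bullet> y)"
        by (intro mult_right_mono) auto
      then have *: "- (y \<bullet> y) / 2 + (?t n)\<^sup>2 * (y \<bullet> y) / 2 \<le> - ((1 / 2)\<^sup>2 * (y \<bullet> y)) / 2"
        using inner_ge_zero[of y] arith[of "(?t n)\<^sup>2" "y \<bullet> y"] by (simp only:)
      have "norm (gauss y * h (?t n *\<^sub>R y)) = norm (k (?t n *\<^sub>R y)) * (norm (gauss y) / norm (gauss (?t n *\<^sub>R y)))"
        unfolding h_eq by (simp add: norm_mult norm_divide)
      also have "norm (gauss y) / norm (gauss (?t n *\<^sub>R y)) = exp (- (y \<bullet> y) / 2 + (?t n)\<^sup>2 * (y \<bullet> y) / 2)"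
        unfolding norm_gauss_scale unfolding norm_gauss by (simp only: arith_exp)
      also have "norm (k (?t n *\<^sub>R y)) * \<dots> \<le> snorm 0 k * exp (- ((1 / 2)\<^sup>2 * (y \<bullet> y)) / 2)"
        using snorm_upper0[OF k, of 0 0 "?t n *\<^sub>R y"] *
        by (intro mult_mono snorm_nonneg k) auto
      also have "exp (- ((1 / 2)\<^sup>2 * (y \<bullet> y)) / 2) = norm (gauss ((1 / 2) *\<^sub>R y))"
        unfolding norm_gauss by (simp add: power2_eq_square)
      finally show "norm (gauss y * h (?t n *\<^sub>R y)) \<le> snorm 0 k * norm (gauss ((1 / 2) *\<^sub>R y))" .
    qed
  qed
  then have "(\<integral>y. gauss (y :: 'a \<times> 'b) * h 0 \<partial>lborel) = 0"
    unfolding int_zero[OF t(1)] using LIMSEQ_unique tendsto_const by blast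
  then have "h 0 = 0"
    using integral_gauss[where 'a = "'a \<times> 'b"] by simp
  then show ?thesis
    by (simp add: h_def)
qed

corollary tempered_eq_if_eq_on_tensors:
  fixes U V :: "('a::euclidean_space \<times> 'b::euclidean_space) distr"
  assumes "tempered U" "tempered V"
    and "\<And>f g. f \<in> schwartz \<Longrightarrow> g \<in> schwartz \<Longrightarrow> U (tensor f g) = V (tensor f g)"
    and "F \<in> schwartz"
  shows "U F = V F"
  using tempered_eq_zero_if_zero_on_tensors[OF tempered_diff[OF assms(1,2)] _ assms(4)] assms(3) by simp

section \<open>Fourier inversion\<close>

lemma partial_deriv_fourier:
  fixes f :: "'a::euclidean_space \<Rightarrow> complex"
  assumes f: "f \<in> schwartz" and b: "b \<in> Basis"
  shows "partial_deriv b (fourier f) \<eta> = fourier (\<lambda>\<xi>. of_real (- 2 * pi * (\<xi> \<bullet> b)) * \<i> * f \<xi>) \<eta>"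
proof -
  define T where "T = tensor (gauss :: 'a \<Rightarrow> complex) f"
  have T: "T \<in> schwartz"
    unfolding T_def by (intro tensor_schwartz gauss_schwartz f)
  have "fourier f = (\<lambda>\<eta>. fourier2 T (0, \<eta>))"
    by (simp add: fourier_eq_fourier2 T_def fun_eq_iff)
  then have "partial_deriv b (fourier f) \<eta> = partial_deriv (0, b) (fourier2 T) (0, \<eta>)"
    by (simp add: partial_deriv_slice(1) fourier2_derivative(1) T)
  also have "\<dots> = fourier2 (\<lambda>w. partial_deriv (0, 0) T w + of_real (- 2 * pi * (snd w \<bullet> b)) * \<i> * T w) (0, \<eta>)"
    using fourier2_derivative(2)[OF T Pair_Basis(2)[OF b], of "(0, \<eta>)"] by simp
  also have "\<dots> = fourier (\<lambda>\<xi>. of_real (- 2 * pi * (\<xi> \<bullet> b)) * \<i> * f \<xi>) \<eta>"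
    using linear_0[OF partial_deriv_linear[OF schwartz_differentiable[OF T]]]
    by (simp add: fourier2_def T_def tensor_def gauss_zero zero_prod_def[symmetric])
  finally show ?thesis .
qed

lemma fourier_cmult: "fourier (\<lambda>x. c * f x) \<eta> = c * fourier f \<eta>"
  by (simp add: fourier_def mult.assoc)

text \<open>The Gaussian satisfies a first-order linear equation that the Fourier transform maps to
  one of the same kind, with coefficient \<open>- 4 * pi\<^sup>2 * (\<eta> \<bullet> b)\<close>. The
  function \<open>G\<close> solves the equation of opposite sign, so the product is constant, and
  its value at 0 is the Gaussian integral.\<close>

lemma fourier_gauss:
  "fourier gauss (\<eta> :: 'a::euclidean_space) = of_real (sqrt (2 * pi) ^ DIM('a)) * gauss ((2 * pi) *\<^sub>R \<eta>)"
proof -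
  let ?g = "fourier (gauss :: 'a \<Rightarrow> complex)"
  define G where "G = (\<lambda>\<eta> :: 'a. complex_of_real (exp (2 * pi\<^sup>2 * (\<eta> \<bullet> \<eta>))))"
  have dgb: "partial_deriv b ?g \<eta> = of_real (- 4 * pi\<^sup>2 * (\<eta> \<bullet> b)) * ?g \<eta>" if b: "b \<in> Basis" for b \<eta>
  proof -
    have "partial_deriv b ?g \<eta> = fourier (\<lambda>\<xi>. of_real (- 2 * pi * (\<xi> \<bullet> b)) * \<i> * gauss \<xi>) \<eta>"
      by (rule partial_deriv_fourier[OF gauss_schwartz b])
    also have "(\<lambda>\<xi>. of_real (- 2 * pi * (\<xi> \<bullet> b)) * \<i> * gauss \<xi>) = (\<lambda>\<xi>. (of_real (2 * pi) * \<i>) * partial_deriv b gauss \<xi>)"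
      using partial_deriv_eqI[OF has_derivative_gauss, where b = b] by (simp add: fun_eq_iff)
    also have "fourier \<dots> \<eta> = of_real (2 * pi) * \<i> * (\<i> * of_real (2 * pi * (\<eta> \<bullet> b)) * ?g \<eta>)"
      unfolding fourier_cmult fourier_partial_deriv[OF gauss_schwartz b] ..
    also have "\<dots> = of_real (- 4 * pi\<^sup>2 * (\<eta> \<bullet> b)) * ?g \<eta>"
      by (simp add: power2_eq_square algebra_simps)
    finally show ?thesis .
  qed
  have dg: "(?g has_derivative (\<lambda>h. of_real (- 4 * pi\<^sup>2 * (\<eta> \<bullet> h)) * ?g \<eta>)) (at \<eta>)" for \<eta>
  proof -
    have diff: "?g differentiable at \<eta>"
      by (intro schwartz_differentiable fourier_schwartz gauss_schwartz)
    have "partial_deriv h ?g \<eta> = of_real (- 4 * pi\<^sup>2 * (\<eta> \<bullet> h)) * ?g \<eta>" for h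
    proof -
      have "partial_deriv h ?g \<eta> = (\<Sum>b\<in>Basis. (h \<bullet> b) *\<^sub>R (of_real (- 4 * pi\<^sup>2 * (\<eta> \<bullet> b)) * ?g \<eta>))"
        unfolding partial_deriv_sum_Basis[OF diff, of h] by (intro sum.cong refl) (simp add: dgb)
      also have "\<dots> = of_real (- 4 * pi\<^sup>2 * (\<Sum>b\<in>Basis. (\<eta> \<bullet> b) * (h \<bullet> b))) * ?g \<eta>"
        by (simp add: scaleR_conv_of_real sum_distrib_left sum_distrib_right sum_negf mult_ac)
      finally show ?thesis
        by (simp add: euclidean_inner[of \<eta> h])
    qed
    then show ?thesis
      using differentiable_has_derivative[OF diff] by simp
  qed
  have dG: "(G has_derivative (\<lambda>h. of_real (4 * pi\<^sup>2 * (\<eta> \<bullet> h)) * G \<eta>)) (at \<eta>)" for \<eta>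
    unfolding G_def by (auto intro!: derivative_eq_intros simp: fun_eq_iff inner_commute algebra_simps)
  have "\<forall>\<eta>\<in>UNIV. ((\<lambda>\<eta>. ?g \<eta> * G \<eta>) has_derivative (\<lambda>h. 0)) (at \<eta> within UNIV)"
  proof
    fix \<eta>
    show "((\<lambda>\<eta>. ?g \<eta> * G \<eta>) has_derivative (\<lambda>h. 0)) (at \<eta> within UNIV)"
      using has_derivative_mult[OF dg dG, of \<eta>] by (simp add: algebra_simps)
  qed
  then obtain c where c: "\<And>\<eta>. ?g \<eta> * G \<eta> = c"
    using has_derivative_zero_constant[of UNIV "\<lambda>\<eta>. ?g \<eta> * G \<eta>"] by auto
  have "c = of_real (sqrt (2 * pi) ^ DIM('a))"
    using c[of 0] by (simp add: G_def fourier_def integral_gauss)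
  moreover have "G \<eta> * gauss ((2 * pi) *\<^sub>R \<eta>) = 1"
    by (simp add: G_def gauss_def power2_eq_square mult_ac flip: of_real_mult exp_add)
  ultimately show ?thesis
    using c[of \<eta>] by (metis mult.assoc mult.right_neutral)
qed

lemma integral_fourier_gauss: "(\<integral>\<eta>. fourier gauss (\<eta> :: 'a::euclidean_space) \<partial>lborel) = 1"
proof -
  let ?a = "sqrt (2 * pi) ^ DIM('a)"
  have "(\<integral>x. gauss (x :: 'a) \<partial>lborel) = of_real (\<bar>2 * pi\<bar> ^ DIM('a)) * (\<integral>x. gauss (0 + (2 * pi) *\<^sub>R (x :: 'a)) \<partial>lborel)"
    by (intro integral_lborel_affine schwartz_borel_measurable gauss_schwartz) simp
  then have "complex_of_real ?a = of_real ((2 * pi) ^ DIM('a)) * (\<integral>x. gauss ((2 * pi) *\<^sub>R (x :: 'a)) \<partial>lborel)"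
    by (simp add: integral_gauss)
  moreover have "(2 * pi) ^ DIM('a) = ?a * ?a"
    by (simp only: power_mult_distrib[symmetric]) simp
  ultimately have "complex_of_real ?a * 1 = of_real ?a * (of_real ?a * (\<integral>x. gauss ((2 * pi) *\<^sub>R (x :: 'a)) \<partial>lborel))"
    by (simp only: of_real_mult mult.assoc mult_1_right)
  then have "1 = complex_of_real ?a * (\<integral>x. gauss ((2 * pi) *\<^sub>R (x :: 'a)) \<partial>lborel)"
    by (subst (asm) mult_cancel_left) simp
  then show ?thesis
    by (simp add: fourier_gauss)
qed

text \<open>Damping the inversion integral by \<open>gauss (t *\<^sub>R \<xi>)\<close> allows the
  integrals to be exchanged; the substitution \<open>y = x + t u\<close> turns the result into an
  average of \<open>f (x + t *\<^sub>R u)\<close> against the transform of the Gaussian, which has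
  integral 1. Both sides converge as \<open>t\<close> tends to 0.\<close>

theorem inv_fourier_fourier:
  fixes f :: "'a::euclidean_space \<Rightarrow> complex"
  assumes f: "f \<in> schwartz"
  shows "inv_fourier (fourier f) = f"
proof
  fix x :: 'a
  let ?ff = "fourier f" and ?fg = "fourier (gauss :: 'a \<Rightarrow> complex)"
  have ff: "?ff \<in> schwartz" and fg: "?fg \<in> schwartz"
    by (intro fourier_schwartz f gauss_schwartz)+
  have key: "(\<integral>\<xi>. gauss (t *\<^sub>R \<xi>) * (?ff \<xi> * cis (2 * pi * (x \<bullet> \<xi>))) \<partial>lborel) = (\<integral>u. f (x + t *\<^sub>R u) * ?fg u \<partial>lborel)"
    if t: "t > 0" for t
  proof -
    \<comment> \<open>Without the Gaussian the integrand would not decay in \<open>\<xi>\<close> for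
      fixed \<open>y\<close>; with it, \<open>P\<close> is a Schwartz function of both variables and
      Fubini applies.\<close>
    define gt where "gt = (\<lambda>\<xi> :: 'a. gauss (t *\<^sub>R \<xi>) * cis (2 * pi * (\<xi> \<bullet> x)))"
    have gt: "gt \<in> schwartz"
      unfolding gt_def using t by (intro schwartz_mult_cis scale_schwartz gauss_schwartz) simp
    define P where "P = (\<lambda>z :: 'a \<times> 'a. cis (- 2 * pi * (snd z \<bullet> fst z)) * tensor gt f z)"
    have P: "P \<in> schwartz"
      unfolding P_def
      by (intro schwartz_mult moderate_cis_bilinear bounded_linear_fst bounded_linear_snd tensor_schwartz gt f)
    have "(\<integral>\<xi>. gauss (t *\<^sub>R \<xi>) * (?ff \<xi> * cis (2 * pi * (x \<bullet> \<xi>))) \<partial>lborel) = (\<integral>\<xi>. (\<integral>y. P (\<xi>, y) \<partial>lborel) \<partial>lborel)"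
    proof (rule Bochner_Integration.integral_cong[OF refl])
      fix \<xi>
      have "(\<integral>y. P (\<xi>, y) \<partial>lborel) = (\<integral>y. gt \<xi> * (f y * cis (- 2 * pi * (y \<bullet> \<xi>))) \<partial>lborel)"
        by (simp add: P_def tensor_def mult_ac)
      also have "\<dots> = gt \<xi> * ?ff \<xi>"
        unfolding fourier_def by (rule integral_mult_right_zero)
      finally show "gauss (t *\<^sub>R \<xi>) * (?ff \<xi> * cis (2 * pi * (x \<bullet> \<xi>))) = (\<integral>y. P (\<xi>, y) \<partial>lborel)"
        by (simp add: gt_def inner_commute mult_ac)
    qed
    also have "\<dots> = (\<integral>y. integral_fst P y \<partial>lborel)"
      by (rule tempered_integral_commute[OF tempered_integral P, symmetric])
    also have "\<dots> = of_real (\<bar>t\<bar> ^ DIM('a)) * (\<integral>u. integral_fst P (x + t *\<^sub>R u) \<partial>lborel)"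
      using t by (intro integral_lborel_affine schwartz_borel_measurable schwartz_opD(1)[OF schwartz_op_integral_fst] P) simp
    also have "\<dots> = (\<integral>u. of_real (\<bar>t\<bar> ^ DIM('a)) * integral_fst P (x + t *\<^sub>R u) \<partial>lborel)"
      by simp
    also have "\<dots> = (\<integral>u. f (x + t *\<^sub>R u) * ?fg u \<partial>lborel)"
    proof (rule Bochner_Integration.integral_cong[OF refl])
      fix u :: 'a
      have m: "(\<lambda>\<xi>. gauss \<xi> * cis (- 2 * pi * (\<xi> \<bullet> u))) \<in> borel_measurable borel"
        by (intro schwartz_borel_measurable schwartz_mult_cis gauss_schwartz)
      have "?fg u = of_real (\<bar>t\<bar> ^ DIM('a)) * (\<integral>\<xi>. gauss (0 + t *\<^sub>R \<xi>) * cis (- 2 * pi * ((0 + t *\<^sub>R \<xi>) \<bullet> u)) \<partial>lborel)"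
        unfolding fourier_def using t by (intro integral_lborel_affine[OF m]) simp
      moreover have "integral_fst P (x + t *\<^sub>R u) =
        (\<integral>\<xi>. f (x + t *\<^sub>R u) * (gauss (0 + t *\<^sub>R \<xi>) * cis (- 2 * pi * ((0 + t *\<^sub>R \<xi>) \<bullet> u))) \<partial>lborel)"
        unfolding integral_fst_def
      proof (rule Bochner_Integration.integral_cong[OF refl])
        fix \<xi>
        have "cis (- 2 * pi * ((x + t *\<^sub>R u) \<bullet> \<xi>)) * cis (2 * pi * (\<xi> \<bullet> x)) = cis (- 2 * pi * ((0 + t *\<^sub>R \<xi>) \<bullet> u))"
          by (simp add: cis_mult inner_add_left inner_commute algebra_simps)
        then show "P (\<xi>, x + t *\<^sub>R u) = f (x + t *\<^sub>R u) * (gauss (0 + t *\<^sub>R \<xi>) * cis (- 2 * pi * ((0 + t *\<^sub>R \<xi>) \<bullet> u)))"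
          by (simp add: P_def tensor_def gt_def mult_ac)
      qed
      ultimately show "of_real (\<bar>t\<bar> ^ DIM('a)) * integral_fst P (x + t *\<^sub>R u) = f (x + t *\<^sub>R u) * ?fg u"
        by simp
    qed
    finally show ?thesis .
  qed
  let ?t = "\<lambda>n::nat. 1 / (real n + 1)"
  have t: "?t n > 0" for n
    by simp
  have tlim: "?t \<longlonglongrightarrow> 0"
    by real_asymp
  have tlim': "(\<lambda>n. ?t n *\<^sub>R y) \<longlonglongrightarrow> 0" for y :: 'a
    using tendsto_scaleR[OF tlim tendsto_const, of y] by simp
  have ffc: "(\<lambda>\<xi>. ?ff \<xi> * cis (2 * pi * (x \<bullet> \<xi>))) \<in> schwartz"
    using schwartz_mult_cis[OF ff, of "2 * pi" x] by (simp add: inner_commute)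
  have lim1: "(\<lambda>n. \<integral>\<xi>. gauss (?t n *\<^sub>R \<xi>) * (?ff \<xi> * cis (2 * pi * (x \<bullet> \<xi>))) \<partial>lborel) \<longlonglongrightarrow>
    (\<integral>\<xi>. 1 * (?ff \<xi> * cis (2 * pi * (x \<bullet> \<xi>))) \<partial>lborel)"
  proof (rule integral_dominated_convergence)
    show "integrable lborel (\<lambda>\<xi>. norm (?ff \<xi> * cis (2 * pi * (x \<bullet> \<xi>))))"
      by (intro integrable_norm integrable_schwartz ffc)
    show "(\<lambda>\<xi>. 1 * (?ff \<xi> * cis (2 * pi * (x \<bullet> \<xi>)))) \<in> borel_measurable lborel"
      using schwartz_borel_measurable[OF ffc] by simp
    show "(\<lambda>\<xi>. gauss (?t n *\<^sub>R \<xi>) * (?ff \<xi> * cis (2 * pi * (x \<bullet> \<xi>)))) \<in> borel_measurable lborel" for n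
    proof -
      have "(\<lambda>\<xi> :: 'a. gauss (?t n *\<^sub>R \<xi>)) \<in> borel_measurable borel"
        using t[of n] by (intro schwartz_borel_measurable scale_schwartz gauss_schwartz) simp
      from borel_measurable_times[OF this schwartz_borel_measurable[OF ffc]] show ?thesis
        by simp
    qed
    show "AE \<xi> in lborel. (\<lambda>n. gauss (?t n *\<^sub>R \<xi>) * (?ff \<xi> * cis (2 * pi * (x \<bullet> \<xi>)))) \<longlonglongrightarrow> 1 * (?ff \<xi> * cis (2 * pi * (x \<bullet> \<xi>)))"
      using isCont_tendsto_compose[OF isCont_schwartz[OF gauss_schwartz] tlim'] unfolding gauss_zero
      by (intro AE_I2 tendsto_mult tendsto_const)
    show "AE \<xi> in lborel. norm (gauss (?t n *\<^sub>R \<xi>) * (?ff \<xi> * cis (2 * pi * (x \<bullet> \<xi>)))) \<le> norm (?ff \<xi> * cis (2 * pi * (x \<bullet> \<xi>)))" for n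
      by (rule AE_I2) (simp add: norm_mult norm_gauss mult_left_le_one_le)
  qed
  have lim2: "(\<lambda>n. \<integral>u. f (x + ?t n *\<^sub>R u) * ?fg u \<partial>lborel) \<longlonglongrightarrow> (\<integral>u. f x * ?fg u \<partial>lborel)"
  proof (rule integral_dominated_convergence)
    show "integrable lborel (\<lambda>u. snorm 0 f * norm (?fg u))"
      by (intro integrable_mult_right integrable_norm integrable_schwartz fg)
    show "(\<lambda>u. f x * ?fg u) \<in> borel_measurable lborel"
      using schwartz_borel_measurable[OF fg] by simp
    show "(\<lambda>u. f (x + ?t n *\<^sub>R u) * ?fg u) \<in> borel_measurable lborel" for n
      using schwartz_borel_measurable[OF fg] measurable_compose[OF _ schwartz_borel_measurable[OF f], of "\<lambda>u. x + ?t n *\<^sub>R u" borel]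
      by simp
    have "(\<lambda>n. x + ?t n *\<^sub>R u) \<longlonglongrightarrow> x" for u
      using tendsto_add[OF tendsto_const tlim', of x u] by simp
    then show "AE u in lborel. (\<lambda>n. f (x + ?t n *\<^sub>R u) * ?fg u) \<longlonglongrightarrow> f x * ?fg u"
      by (intro AE_I2 tendsto_mult tendsto_const isCont_tendsto_compose[OF isCont_schwartz[OF f]])
    show "AE u in lborel. norm (f (x + ?t n *\<^sub>R u) * ?fg u) \<le> snorm 0 f * norm (?fg u)" for n
      using snorm_upper0[OF f, of 0 0] by (intro AE_I2) (simp add: norm_mult mult_right_mono)
  qed
  have "(\<integral>\<xi>. 1 * (?ff \<xi> * cis (2 * pi * (x \<bullet> \<xi>))) \<partial>lborel) = (\<integral>u. f x * ?fg u \<partial>lborel)"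
    using LIMSEQ_unique[OF lim1] lim2 unfolding key[OF t] by blast
  then show "inv_fourier ?ff x = f x"
    by (simp add: inv_fourier_def integral_fourier_gauss)
qed

text \<open>The two transforms differ by a reflection, so the substitution of \<open>- x\<close> for
  \<open>x\<close> reduces this to the other order.\<close>

theorem fourier_inv_fourier:
  fixes f :: "'a::euclidean_space \<Rightarrow> complex"
  assumes f: "f \<in> schwartz"
  shows "fourier (inv_fourier f) = f"
proof
  fix \<eta> :: 'a
  let ?g = "\<lambda>x. fourier f x * cis (- 2 * pi * (- x \<bullet> \<eta>))"
  have "?g \<in> schwartz"
    using schwartz_mult_cis[OF fourier_schwartz[OF f], of "2 * pi" \<eta>] by simp
  from integral_lborel_uminus[OF schwartz_borel_measurable[OF this]]
  have "fourier (inv_fourier f) \<eta> = inv_fourier (fourier f) \<eta>"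
    by (simp add: fourier_def[of "inv_fourier f"] inv_fourier_eq[of f] inv_fourier_def[of "fourier f"] inner_commute)
  then show "fourier (inv_fourier f) \<eta> = f \<eta>"
    by (simp add: inv_fourier_fourier[OF f])
qed

section \<open>The Wigner distribution of tempered distributions\<close>

lemma tempered_inv_fourier_distr: "tempered \<sigma> \<Longrightarrow> tempered (inv_fourier_distr \<sigma>)"
  unfolding inv_fourier_distr_def by (rule tempered_compose[OF _ schwartz_op_inv_fourier])

lemma tensor_distr_eq: "tensor_distr u v = (\<lambda>F. u (apply_snd v F))"
  by (simp add: tensor_distr_def apply_snd_def)

lemma tempered_tensor_distr: "tempered u \<Longrightarrow> tempered v \<Longrightarrow> tempered (tensor_distr u v)"
  unfolding tensor_distr_eq by (rule tempered_compose[OF _ schwartz_op_apply_snd])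

lemma tensor_distr_tensor:
  assumes "tempered u" "tempered v" "f \<in> schwartz" "g \<in> schwartz"
  shows "tensor_distr u v (tensor f g) = u f * v g"
  using linear_on_schwartzD(2)[OF tempered_linear[OF assms(2)] assms(4)]
    linear_on_schwartzD(2)[OF tempered_linear[OF assms(1)] assms(3), of "v g"]
  by (simp add: tensor_distr_def tensor_def mult.commute)

text \<open>The outer functionals agree on Schwartz functions only, so the function obtained by
  applying the inner one must first be seen to be Schwartz.\<close>

lemma tensor_distr_cong:
  assumes "distr_eq u u'" "distr_eq v v'" "tempered v'" "F \<in> schwartz"
  shows "tensor_distr u v F = tensor_distr u' v' F"
proof -
  have "apply_snd v F = apply_snd v' F"
    using assms(2) slice_schwartz[OF assms(4)] by (auto simp: apply_snd_def distr_eq_def)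
  moreover have "apply_snd v' F \<in> schwartz"
    by (rule schwartz_opD(1)[OF schwartz_op_apply_snd[OF assms(3)] assms(4)])
  ultimately show ?thesis
    using assms(1) by (simp add: tensor_distr_eq distr_eq_def)
qed

lemma cnj_distr_cong: "distr_eq u v \<Longrightarrow> distr_eq (cnj_distr u) (cnj_distr v)"
  by (simp add: distr_eq_def cnj_distr_def schwartz_cnj)

section \<open>Midpoint coordinates on test functions\<close>

definition midpoint_pullback :: "('a::euclidean_space \<times> 'a \<Rightarrow> complex) \<Rightarrow> 'a \<times> 'a \<Rightarrow> complex" where
  "midpoint_pullback F = (\<lambda>(p, q). F ((1/2) *\<^sub>R (p + q), p - q))"

definition midpoint_pushforward :: "('a::euclidean_space \<times> 'a \<Rightarrow> complex) \<Rightarrow> 'a \<times> 'a \<Rightarrow> complex" where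
  "midpoint_pushforward F = (\<lambda>(x, y). F (x + (1/2) *\<^sub>R y, x - (1/2) *\<^sub>R y))"

lemma midpoint_identities:
  fixes x y :: "'a::real_vector"
  shows "(1/2) *\<^sub>R ((x + (1/2) *\<^sub>R y) + (x - (1/2) *\<^sub>R y)) = x"
    and "(x + (1/2) *\<^sub>R y) - (x - (1/2) *\<^sub>R y) = y"
    and "(1/2) *\<^sub>R (x + y) + (1/2) *\<^sub>R (x - y) = x"
    and "(1/2) *\<^sub>R (x + y) - (1/2) *\<^sub>R (x - y) = y"
  by (simp_all add: algebra_simps flip: scaleR_add_left)

lemma midpoint_pushforward_pullback: "midpoint_pushforward (midpoint_pullback F) = F"
  by (simp only: fun_eq_iff split_paired_All prod.case midpoint_pushforward_def midpoint_pullback_def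
    midpoint_identities simp_thms)

lemma schwartz_op_midpoint_pullback:
  "schwartz_op (midpoint_pullback :: ('a::euclidean_space \<times> 'a \<Rightarrow> complex) \<Rightarrow> _)"
proof -
  let ?A = "\<lambda>z :: 'a \<times> 'a. ((1/2) *\<^sub>R (fst z + snd z), fst z - snd z)"
  have "linear ?A"
    by (auto intro!: linearI simp: algebra_simps)
  moreover have "inj ?A"
    by (rule inj_on_inverseI[where g = "\<lambda>z. (fst z + (1/2) *\<^sub>R snd z, fst z - (1/2) *\<^sub>R snd z)"])
      (auto simp: midpoint_identities)
  ultimately show ?thesis
    using schwartz_op_compose_linear[of ?A] by (simp add: midpoint_pullback_def[abs_def] case_prod_unfold)
qed

lemma schwartz_op_midpoint_pushforward:
  "schwartz_op (midpoint_pushforward :: ('a::euclidean_space \<times> 'a \<Rightarrow> complex) \<Rightarrow> _)"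
proof -
  let ?A = "\<lambda>z :: 'a \<times> 'a. (fst z + (1/2) *\<^sub>R snd z, fst z - (1/2) *\<^sub>R snd z)"
  have "linear ?A"
    by (auto intro!: linearI simp: algebra_simps)
  moreover have "inj ?A"
    by (rule inj_on_inverseI[where g = "\<lambda>z. ((1/2) *\<^sub>R (fst z + snd z), fst z - snd z)"])
      (simp only: fst_conv snd_conv midpoint_identities prod.collapse)
  ultimately show ?thesis
    using schwartz_op_compose_linear[of ?A] by (simp add: midpoint_pushforward_def[abs_def] case_prod_unfold)
qed

lemmas midpoint_pullback_schwartz = schwartz_opD(1)[OF schwartz_op_midpoint_pullback]
  and midpoint_pushforward_schwartz = schwartz_opD(1)[OF schwartz_op_midpoint_pushforward]

lemma wigner_distr_eq:
  "wigner_distr u v F = tensor_distr u (cnj_distr v) (midpoint_pullback (fourier2 F))"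
  by (simp add: wigner_distr_def fourier2_distr_def pullback_midpoint_distr_def midpoint_pullback_def
    fourier2_def)

lemma tempered_wigner_distr: "tempered u \<Longrightarrow> tempered v \<Longrightarrow> tempered (wigner_distr u v)"
  unfolding wigner_distr_eq[abs_def]
  by (rule tempered_compose[OF _ schwartz_op_compose[OF schwartz_op_midpoint_pullback schwartz_op_fourier2]])
    (intro tempered_tensor_distr tempered_cnj_distr)

lemma wigner_eq: "wigner f g = fourier2 (midpoint_pushforward (tensor f (\<lambda>x. cnj (g x))))"
  by (simp add: wigner_def fourier2_def fourier_def midpoint_pushforward_def tensor_def)

lemma wigner_schwartz: "f \<in> schwartz \<Longrightarrow> g \<in> schwartz \<Longrightarrow> wigner f g \<in> schwartz"
  unfolding wigner_eq by (intro fourier2_schwartz midpoint_pushforward_schwartz tensor_schwartz schwartz_cnj)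

text \<open>The change of variables is a composition of two shears, so only translation invariance is used.\<close>

lemma integral_midpoint:
  fixes H :: "'a::euclidean_space \<times> 'a \<Rightarrow> complex"
  assumes H: "H \<in> schwartz"
  shows "(\<integral>p. (\<integral>q. H (p, q) \<partial>lborel) \<partial>lborel) = (\<integral>x. (\<integral>y. H (x + (1/2) *\<^sub>R y, x - (1/2) *\<^sub>R y) \<partial>lborel) \<partial>lborel)"
proof -
  define S where "S = (\<lambda>z :: 'a \<times> 'a. H (fst z, fst z - snd z))"
  have S: "S \<in> schwartz"
    unfolding S_def by (intro schwartz_compose_linear[OF H] linearI injI) (auto simp: algebra_simps prod_eq_iff)
  have "(\<integral>x. (\<integral>y. H (x + (1/2) *\<^sub>R y, x - (1/2) *\<^sub>R y) \<partial>lborel) \<partial>lborel) =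
    (\<integral>x. (\<integral>y. midpoint_pushforward H (x, y) \<partial>lborel) \<partial>lborel)"
    by (simp add: midpoint_pushforward_def)
  also have "\<dots> = (\<integral>y. (\<integral>x. midpoint_pushforward H (x, y) \<partial>lborel) \<partial>lborel)"
    by (rule integral_swap_schwartz[symmetric, OF midpoint_pushforward_schwartz[OF H]])
  also have "\<dots> = (\<integral>y. (\<integral>x. S (x, y) \<partial>lborel) \<partial>lborel)"
  proof (rule Bochner_Integration.integral_cong[OF refl])
    fix y :: 'a
    have m: "(\<lambda>x. S (x, y)) \<in> borel_measurable borel"
      using schwartz_borel_measurable[OF slice_schwartz[OF swap_schwartz[OF S], of y]] by simp
    have "x - (1/2) *\<^sub>R y = (1/2) *\<^sub>R y + x - y" for x
      using midpoint_identities(2)[of x y] by (simp add: algebra_simps)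
    then have "midpoint_pushforward H (x, y) = S ((1/2) *\<^sub>R y + x, y)" for x
      by (simp only: midpoint_pushforward_def S_def prod.case fst_conv snd_conv add.commute[of x])
    then show "(\<integral>x. midpoint_pushforward H (x, y) \<partial>lborel) = (\<integral>x. S (x, y) \<partial>lborel)"
      using integral_lborel_translate[OF m, of "(1/2) *\<^sub>R y"] by simp
  qed
  also have "\<dots> = (\<integral>x. (\<integral>y. S (x, y) \<partial>lborel) \<partial>lborel)"
    by (rule integral_swap_schwartz[OF S])
  also have "\<dots> = (\<integral>p. (\<integral>q. H (p, q) \<partial>lborel) \<partial>lborel)"
  proof (rule Bochner_Integration.integral_cong[OF refl])
    fix p
    show "(\<integral>y. S (p, y) \<partial>lborel) = (\<integral>q. H (p, q) \<partial>lborel)"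
      using integral_lborel_affine[OF schwartz_borel_measurable[OF slice_schwartz[OF H, of p]], of "-1" p]
      by (simp add: S_def)
  qed
  finally show ?thesis
    by simp
qed

section \<open>The Fourier transform of a Wigner distribution\<close>

definition inv_fourier1 :: "('a::euclidean_space \<times> 'b::euclidean_space \<Rightarrow> complex) \<Rightarrow> 'a \<times> 'b \<Rightarrow> complex" where
  "inv_fourier1 F = (\<lambda>(p, q). inv_fourier (\<lambda>x. F (x, q)) p)"

lemma schwartz_op_inv_fourier1:
  "schwartz_op (inv_fourier1 :: ('a::euclidean_space \<times> 'b::euclidean_space \<Rightarrow> complex) \<Rightarrow> _)"
proof -
  let ?A = "\<lambda>z :: 'a \<times> 'b. (snd z, - fst z)"
  have "linear ?A" "inj ?A"
    by (auto intro!: linearI injI)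
  from schwartz_op_compose[OF schwartz_op_compose_linear[OF this]
      schwartz_op_compose[OF schwartz_op_fourier2 schwartz_op_compose_linear[OF linear_swap inj_swap]]]
  show ?thesis
    by (rule schwartz_op_cong) (auto simp: inv_fourier1_def fourier2_def inv_fourier_eq fun_eq_iff)
qed

text \<open>The second variable carries the forward transform because conjugating a distribution
  turns \<open>inv_fourier\<close> into \<open>fourier\<close>.\<close>

definition fourier_mixed :: "('a::euclidean_space \<times> 'b::euclidean_space \<Rightarrow> complex) \<Rightarrow> 'a \<times> 'b \<Rightarrow> complex" where
  "fourier_mixed F = inv_fourier1 (fourier2 F)"

lemma schwartz_op_fourier_mixed: "schwartz_op fourier_mixed"
  unfolding fourier_mixed_def[abs_def] by (rule schwartz_op_compose[OF schwartz_op_inv_fourier1 schwartz_op_fourier2])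

lemma inv_fourier_cmult: "inv_fourier (\<lambda>x. c * f x) = (\<lambda>x. c * inv_fourier f x)"
  by (simp add: fun_eq_iff inv_fourier_def mult.assoc)

lemma fourier_mixed_tensor: "fourier_mixed (tensor f g) = tensor (inv_fourier f) (fourier g)"
  by (auto simp: fourier_mixed_def inv_fourier1_def fourier2_def tensor_def fourier_cmult inv_fourier_cmult
    fun_eq_iff mult.commute[of _ "fourier g _"])

text \<open>The integral kernel, from frequency \<open>a\<close> to frequency \<open>b\<close>, of
  the Weyl quantisation of \<open>F\<close>.\<close>

definition wigner_symbol :: "('a::euclidean_space \<times> 'a \<Rightarrow> complex) \<Rightarrow> 'a \<times> 'a \<Rightarrow> complex" where
  "wigner_symbol F = (\<lambda>(a, b). \<integral>x. F (x, (1/2) *\<^sub>R (a + b)) * cis (2 * pi * (x \<bullet> (a - b))) \<partial>lborel)"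

lemma cis_add_scaled: "cis (c * (a + b)) = cis (c * a) * cis (c * b)"
  by (simp add: cis_mult distrib_left)

lemma inner_midpoint:
  fixes x y a b :: "'a::real_inner"
  shows "(x + (1/2) *\<^sub>R y) \<bullet> a - (x - (1/2) *\<^sub>R y) \<bullet> b = x \<bullet> (a - b) + y \<bullet> ((1/2) *\<^sub>R (a + b))"
  by (simp add: algebra_simps)

text \<open>For \<open>p = x + y/2\<close> and \<open>q = x - y/2\<close> the phase
  \<open>p \<bullet> a - q \<bullet> b\<close> equals
  \<open>x \<bullet> (a - b) + y \<bullet> (a + b) / 2\<close>. The integral over \<open>y\<close>
  is thus an inverse Fourier transform at the midpoint of \<open>a\<close> and \<open>b\<close>, and
  cancels \<open>fourier2\<close>.\<close>

lemma fourier_mixed_midpoint: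
  fixes F :: "'a::euclidean_space \<times> 'a \<Rightarrow> complex"
  assumes F: "F \<in> schwartz"
  shows "fourier_mixed (midpoint_pullback (fourier2 F)) = wigner_symbol F"
proof
  fix z :: "'a \<times> 'a"
  obtain a b where z: "z = (a, b)"
    by (cases z)
  let ?G = "fourier2 F"
  define H where "H = (\<lambda>z. cis (2 * pi * (fst z \<bullet> a)) * (cis (- 2 * pi * (snd z \<bullet> b)) * midpoint_pullback ?G z))"
  have H: "H \<in> schwartz"
    unfolding H_def
    by (intro schwartz_mult moderate_cis_linear bounded_linear_fst bounded_linear_snd
      midpoint_pullback_schwartz fourier2_schwartz F)
  have "fourier_mixed (midpoint_pullback ?G) z = (\<integral>p. (\<integral>q. H (p, q) \<partial>lborel) \<partial>lborel)"
    unfolding z fourier_mixed_def inv_fourier1_def inv_fourier_def H_def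
    by (simp add: fourier2_Pair[of "midpoint_pullback ?G"] inner_commute mult_ac flip: integral_mult_right_zero)
  also have "\<dots> = (\<integral>x. (\<integral>y. H (x + (1/2) *\<^sub>R y, x - (1/2) *\<^sub>R y) \<partial>lborel) \<partial>lborel)"
    by (rule integral_midpoint[OF H])
  also have "\<dots> = (\<integral>x. F (x, (1/2) *\<^sub>R (a + b)) * cis (2 * pi * (x \<bullet> (a - b))) \<partial>lborel)"
  proof (rule Bochner_Integration.integral_cong[OF refl])
    fix x
    have "H (x + (1/2) *\<^sub>R y, x - (1/2) *\<^sub>R y) =
      cis (2 * pi * (x \<bullet> (a - b))) * (?G (x, y) * cis (2 * pi * (((1/2) *\<^sub>R (a + b)) \<bullet> y)))" for y
    proof -
      have "H (x + (1/2) *\<^sub>R y, x - (1/2) *\<^sub>R y) =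
        cis (2 * pi * ((x + (1/2) *\<^sub>R y) \<bullet> a - (x - (1/2) *\<^sub>R y) \<bullet> b)) * midpoint_pullback ?G (x + (1/2) *\<^sub>R y, x - (1/2) *\<^sub>R y)"
        by (simp add: H_def cis_mult mult.assoc[symmetric] right_diff_distrib del: scaleR_half_double)
      moreover have "midpoint_pullback ?G (x + (1/2) *\<^sub>R y, x - (1/2) *\<^sub>R y) = ?G (x, y)"
        by (simp only: midpoint_pullback_def prod.case midpoint_identities)
      ultimately show ?thesis
        unfolding inner_midpoint by (simp add: cis_mult[symmetric] distrib_left inner_commute mult_ac)
    qed
    then have "(\<integral>y. H (x + (1/2) *\<^sub>R y, x - (1/2) *\<^sub>R y) \<partial>lborel) =
      cis (2 * pi * (x \<bullet> (a - b))) * inv_fourier (\<lambda>y. ?G (x, y)) ((1/2) *\<^sub>R (a + b))"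
      by (simp only: inv_fourier_def integral_mult_right_zero)
    also have "(\<lambda>y. ?G (x, y)) = fourier (\<lambda>\<xi>. F (x, \<xi>))"
      by (simp add: fourier2_def)
    also have "inv_fourier \<dots> = (\<lambda>\<xi>. F (x, \<xi>))"
      by (rule inv_fourier_fourier[OF slice_schwartz[OF F]])
    finally show "(\<integral>y. H (x + (1/2) *\<^sub>R y, x - (1/2) *\<^sub>R y) \<partial>lborel) = F (x, (1/2) *\<^sub>R (a + b)) * cis (2 * pi * (x \<bullet> (a - b)))"
      by simp
  qed
  finally show "fourier_mixed (midpoint_pullback ?G) z = wigner_symbol F z"
    by (simp add: z wigner_symbol_def)
qed

lemma inv_fourier_cnj: "inv_fourier (\<lambda>x. cnj (f x)) = (\<lambda>\<xi>. cnj (fourier f \<xi>))"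
proof
  fix \<xi>
  have "cnj (fourier f \<xi>) = (\<integral>x. cnj (f x * cis (- 2 * pi * (x \<bullet> \<xi>))) \<partial>lborel)"
    unfolding fourier_def by (rule Bochner_Integration.integral_cnj[symmetric])
  also have "\<dots> = inv_fourier (\<lambda>x. cnj (f x)) \<xi>"
    by (simp add: inv_fourier_def cis_cnj inner_commute)
  finally show "inv_fourier (\<lambda>x. cnj (f x)) \<xi> = cnj (fourier f \<xi>)"
    by simp
qed

lemma cnj_distr_inv_fourier_distr: "cnj_distr (inv_fourier_distr \<sigma>) g = cnj_distr \<sigma> (fourier g)"
  by (simp add: cnj_distr_def inv_fourier_distr_def inv_fourier_cnj)

text \<open>The tensor product of distributions nests one pairing inside the other, so a transform
  of both variables does not pass through it directly. On tensor products the pairing factorises and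
  each transform acts on its own factor.\<close>

lemma wigner_distr_inv_fourier_distr:
  assumes \<sigma>: "tempered \<sigma>" and F: "F \<in> schwartz"
  shows "wigner_distr (inv_fourier_distr \<sigma>) (inv_fourier_distr \<sigma>) F =
    tensor_distr \<sigma> (cnj_distr \<sigma>) (wigner_symbol F)"
proof -
  let ?E = "inv_fourier_distr \<sigma>"
  note E = tempered_inv_fourier_distr[OF \<sigma>]
  have "tensor_distr ?E (cnj_distr ?E) G = tensor_distr \<sigma> (cnj_distr \<sigma>) (fourier_mixed G)" if "G \<in> schwartz" for G
  proof (rule tempered_eq_if_eq_on_tensors[OF _ _ _ that])
    show "tempered (tensor_distr ?E (cnj_distr ?E))"
      by (intro tempered_tensor_distr tempered_cnj_distr E)
    show "tempered (\<lambda>G. tensor_distr \<sigma> (cnj_distr \<sigma>) (fourier_mixed G))"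
      by (intro tempered_compose[OF _ schwartz_op_fourier_mixed] tempered_tensor_distr tempered_cnj_distr \<sigma>)
    fix f g :: "'a \<Rightarrow> complex" assume "f \<in> schwartz" "g \<in> schwartz"
    then show "tensor_distr ?E (cnj_distr ?E) (tensor f g) = tensor_distr \<sigma> (cnj_distr \<sigma>) (fourier_mixed (tensor f g))"
      by (simp add: fourier_mixed_tensor tensor_distr_tensor E \<sigma> tempered_cnj_distr fourier_schwartz
        inv_fourier_schwartz cnj_distr_inv_fourier_distr)
        (simp add: inv_fourier_distr_def)
  qed
  then show ?thesis
    unfolding wigner_distr_eq
    by (simp add: midpoint_pullback_schwartz fourier2_schwartz F fourier_mixed_midpoint)
qed

text \<open>The phase of \<open>fourier2\<close> in \<open>r\<close> has the sign opposite to that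
  in \<open>wigner_symbol\<close>; the reflection of \<open>r\<close> compensates for it.\<close>

lemma wigner_distr_swap_reflect:
  fixes F :: "'a::euclidean_space \<times> 'a \<Rightarrow> complex"
  assumes F: "F \<in> schwartz"
  shows "swap_reflect_distr (wigner_distr \<sigma> \<sigma>) F = tensor_distr \<sigma> (cnj_distr \<sigma>) (wigner_symbol F)"
proof -
  have "midpoint_pullback (fourier2 (\<lambda>(\<xi>, r). F (- r, \<xi>))) (a, b) = wigner_symbol F (a, b)" for a b
  proof -
    have m: "(\<lambda>x. F (x, (1/2) *\<^sub>R (a + b)) * cis (2 * pi * (x \<bullet> (a - b)))) \<in> borel_measurable borel"
      using schwartz_mult_cis[OF slice_schwartz[OF swap_schwartz[OF F], of "(1/2) *\<^sub>R (a + b)"]]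
      by (intro schwartz_borel_measurable) simp
    show ?thesis
      using integral_lborel_uminus[OF m]
      by (simp add: midpoint_pullback_def fourier2_Pair wigner_symbol_def)
  qed
  then have "midpoint_pullback (fourier2 (\<lambda>(\<xi>, r). F (- r, \<xi>))) = wigner_symbol F"
    by auto
  then show ?thesis
    by (simp add: swap_reflect_distr_def wigner_distr_eq)
qed

section \<open>The Wigner kernel of a Fourier multiplier\<close>

lemma fourier_multiplier_eq: "fourier_multiplier \<sigma> f = (\<lambda>\<phi>. \<sigma> (\<lambda>\<xi>. fourier f \<xi> * inv_fourier \<phi> \<xi>))"
  by (simp add: fourier_multiplier_def inv_fourier_distr_def mult_distr_def)

lemma tempered_fourier_multiplier:
  assumes "tempered \<sigma>" "f \<in> schwartz"
  shows "tempered (fourier_multiplier \<sigma> f)"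
  unfolding fourier_multiplier_eq
  by (rule tempered_compose[OF assms(1) schwartz_op_compose[OF schwartz_op_mult schwartz_op_inv_fourier]])
    (intro schwartz_moderate fourier_schwartz assms)

lemma cnj_distr_fourier_multiplier:
  "cnj_distr (fourier_multiplier \<sigma> g) \<phi> = cnj_distr \<sigma> (\<lambda>\<xi>. cnj (fourier g \<xi>) * fourier \<phi> \<xi>)"
  by (simp add: cnj_distr_def fourier_multiplier_eq inv_fourier_cnj)

text \<open>For the weak-* topology it suffices to pair with one test function at a time, and the
  pairing is a tempered distribution in \<open>f\<close>: \<open>\<sigma>\<close> applied to a fixed
  multiplier times \<open>fourier f\<close>.\<close>

lemma continuous_linear_operator_fourier_multiplier:
  assumes \<sigma>: "tempered \<sigma>"
  shows "continuous_linear_operator (fourier_multiplier \<sigma>)"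
proof -
  have T: "tempered (\<lambda>f. fourier_multiplier \<sigma> f \<phi>)" if \<phi>: "\<phi> \<in> schwartz" for \<phi>
  proof (rule tempered_cong)
    show "tempered (\<lambda>f. \<sigma> (\<lambda>\<xi>. inv_fourier \<phi> \<xi> * fourier f \<xi>))"
      by (rule tempered_compose[OF \<sigma> schwartz_op_compose[OF schwartz_op_mult schwartz_op_fourier]])
        (intro schwartz_moderate inv_fourier_schwartz \<phi>)
  qed (simp add: fourier_multiplier_eq mult.commute)
  have "continuous_map schwartz_topology tempered_topology (fourier_multiplier \<sigma>)"
    unfolding tempered_topology_def
  proof (rule continuous_on_generated_topo)
    fix V :: "'a distr set" assume "V \<in> {{u. tempered u \<and> u \<phi> \<in> U} |\<phi> U. \<phi> \<in> schwartz \<and> open U}"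
    then obtain \<phi> U where V: "V = {u. tempered u \<and> u \<phi> \<in> U}" and \<phi>: "\<phi> \<in> schwartz" and U: "open U"
      by blast
    have "fourier_multiplier \<sigma> -` V \<inter> topspace schwartz_topology =
      {f \<in> topspace schwartz_topology. fourier_multiplier \<sigma> f \<phi> \<in> U}"
      using tempered_fourier_multiplier[OF \<sigma>] by (auto simp: V)
    moreover have "openin schwartz_topology {f \<in> topspace schwartz_topology. fourier_multiplier \<sigma> f \<phi> \<in> U}"
      using T[OF \<phi>] U unfolding tempered_def by (intro openin_continuous_map_preimage[where Y = euclidean]) auto
    ultimately show "openin schwartz_topology (fourier_multiplier \<sigma> -` V \<inter> topspace schwartz_topology)"
      by simp
  next
    \<comment> \<open>The values must lie in the union of the subbasis; the test function 0 with the
      open set \<open>UNIV\<close> already captures every tempered distribution.\<close>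
    have "fourier_multiplier \<sigma> f \<in> {u. tempered u \<and> u (\<lambda>x. 0) \<in> UNIV}" if "f \<in> schwartz" for f
      using tempered_fourier_multiplier[OF \<sigma> that] by simp
    then show "fourier_multiplier \<sigma> ` topspace schwartz_topology \<subseteq>
      \<Union> {{u. tempered u \<and> u \<phi> \<in> U} |\<phi> U. \<phi> \<in> schwartz \<and> open U}"
      using schwartz_zero by (auto intro!: exI[of _ "UNIV :: complex set"] exI)
  qed
  then show ?thesis
    using T tempered_linear by (auto simp: continuous_linear_operator_def)
qed

section \<open>The delta kernel on the side of test functions\<close>

definition delta_op :: "(('a::euclidean_space \<times> 'a) \<times> ('a \<times> 'a) \<Rightarrow> complex) \<Rightarrow> 'a \<times> 'a \<Rightarrow> complex" where
  "delta_op F = (\<lambda>(s, \<xi>). \<integral>y. F ((y + s, \<xi>), (y, \<xi>)) \<partial>lborel)"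

lemma delta_kernel_eq: "delta_kernel G F = G (delta_op F)"
  by (simp add: delta_kernel_def delta_op_def)

lemma schwartz_op_delta_op: "schwartz_op (delta_op :: (('a::euclidean_space \<times> 'a) \<times> ('a \<times> 'a) \<Rightarrow> complex) \<Rightarrow> _)"
proof -
  let ?A = "\<lambda>z :: ('a \<times> 'a) \<times> 'a. ((snd z + fst (fst z), snd (fst z)), (snd z, snd (fst z)))"
  have "linear ?A" "inj ?A"
    by (auto intro!: linearI injI simp: algebra_simps)
  from schwartz_op_compose[OF schwartz_op_apply_snd[OF tempered_integral] schwartz_op_compose_linear[OF this]]
  show ?thesis
    by (rule schwartz_op_cong) (auto simp: delta_op_def apply_snd_def fun_eq_iff)
qed

lemma tempered_delta_kernel: "tempered G \<Longrightarrow> tempered (delta_kernel G)"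
  unfolding delta_kernel_eq[abs_def] by (rule tempered_compose[OF _ schwartz_op_delta_op])

text \<open>The phase identity \<open>inner_midpoint\<close> read backwards: at the midpoint
  frequency the two phases recombine into one in \<open>p\<close> and one in \<open>q\<close>, so
  that the double integral separates.\<close>

lemma fourier_wigner:
  fixes f g :: "'a::euclidean_space \<Rightarrow> complex"
  assumes f: "f \<in> schwartz" and g: "g \<in> schwartz"
  shows "fourier (\<lambda>y. wigner f g (y, (1/2) *\<^sub>R (a + b))) (a - b) = fourier f a * cnj (fourier g b)"
proof -
  define H where "H = (\<lambda>z. cis (- 2 * pi * (fst z \<bullet> a)) * (cis (2 * pi * (snd z \<bullet> b)) * tensor f (\<lambda>x. cnj (g x)) z))"
  have H: "H \<in> schwartz"
    unfolding H_def
    by (intro schwartz_mult moderate_cis_linear bounded_linear_fst bounded_linear_snd tensor_schwartz schwartz_cnj f g)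
  have "fourier (\<lambda>y. wigner f g (y, (1/2) *\<^sub>R (a + b))) (a - b) =
    (\<integral>x. (\<integral>y. H (x + (1/2) *\<^sub>R y, x - (1/2) *\<^sub>R y) \<partial>lborel) \<partial>lborel)"
    unfolding fourier_def wigner_def prod.case
  proof (rule Bochner_Integration.integral_cong[OF refl])
    fix x
    have "H (x + (1/2) *\<^sub>R y, x - (1/2) *\<^sub>R y) =
      f (x + (1/2) *\<^sub>R y) * cnj (g (x - (1/2) *\<^sub>R y)) * cis (- 2 * pi * (y \<bullet> ((1/2) *\<^sub>R (a + b)))) * cis (- 2 * pi * (x \<bullet> (a - b)))"
      for y
    proof -
      have "H (x + (1/2) *\<^sub>R y, x - (1/2) *\<^sub>R y) =
        cis (- 2 * pi * ((x + (1/2) *\<^sub>R y) \<bullet> a - (x - (1/2) *\<^sub>R y) \<bullet> b)) * (f (x + (1/2) *\<^sub>R y) * cnj (g (x - (1/2) *\<^sub>R y)))"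
        by (simp add: H_def tensor_def cis_mult mult.assoc[symmetric] right_diff_distrib)
      then show ?thesis
        unfolding inner_midpoint cis_add_scaled by (simp only: mult_ac)
    qed
    then show "(\<integral>y. f (x + (1/2) *\<^sub>R y) * cnj (g (x - (1/2) *\<^sub>R y)) * cis (- 2 * pi * (y \<bullet> ((1/2) *\<^sub>R (a + b)))) \<partial>lborel)
        * cis (- 2 * pi * (x \<bullet> (a - b))) = (\<integral>y. H (x + (1/2) *\<^sub>R y, x - (1/2) *\<^sub>R y) \<partial>lborel)"
      by (simp only: integral_mult_left_zero)
  qed
  also have "\<dots> = (\<integral>p. (\<integral>q. H (p, q) \<partial>lborel) \<partial>lborel)"
    by (rule integral_midpoint[OF H, symmetric])
  also have "\<dots> = (\<integral>p. (f p * cis (- 2 * pi * (p \<bullet> a))) * inv_fourier (\<lambda>x. cnj (g x)) b \<partial>lborel)"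
    unfolding inv_fourier_def H_def tensor_def
    by (simp add: mult_ac inner_commute flip: integral_mult_right_zero)
  also have "\<dots> = fourier f a * cnj (fourier g b)"
    by (simp add: fourier_def inv_fourier_cnj)
  finally show ?thesis .
qed

text \<open>At a fixed frequency \<open>delta_op\<close> correlates \<open>F\<close> with the Wigner
  function in position. A phase in \<open>s\<close> is a phase in \<open>y + s\<close> times the
  conjugate phase in \<open>y\<close>, so the transform of the correlation is a product, and
  \<open>fourier_wigner\<close> evaluates the factor that belongs to the Wigner function.\<close>

lemma wigner_symbol_delta_op:
  fixes F :: "'a::euclidean_space \<times> 'a \<Rightarrow> complex"
  assumes F: "F \<in> schwartz" and f: "f \<in> schwartz" and g: "g \<in> schwartz"
  shows "wigner_symbol (delta_op (tensor F (wigner f g))) =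
    (\<lambda>z. tensor (fourier f) (\<lambda>\<xi>. cnj (fourier g \<xi>)) z * wigner_symbol F z)"
proof
  fix z :: "'a \<times> 'a"
  obtain a b where z: "z = (a, b)"
    by (cases z)
  define c where "c = (1/2) *\<^sub>R (a + b)"
  define u where "u = (\<lambda>x. F (x, c))"
  define w where "w = (\<lambda>y. wigner f g (y, c))"
  have u: "u \<in> schwartz" and w: "w \<in> schwartz"
    using slice_schwartz[OF swap_schwartz[OF F], of c] slice_schwartz[OF swap_schwartz[OF wigner_schwartz[OF f g]], of c]
    by (simp_all add: u_def w_def)
  define A where "A = (\<lambda>z :: 'a \<times> 'a. (snd z + fst z, snd z))"
  have A: "linear A" "inj A"
    by (auto intro!: linearI injI simp: A_def algebra_simps)
  define P where "P = (\<lambda>z. cis (2 * pi * (fst z \<bullet> (a - b))) * tensor u w (A z))"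
  have P: "P \<in> schwartz"
    unfolding P_def
    by (intro schwartz_mult moderate_cis_linear bounded_linear_fst schwartz_compose_linear[OF _ A] tensor_schwartz u w)
  have "wigner_symbol (delta_op (tensor F (wigner f g))) z = (\<integral>s. (\<integral>y. P (s, y) \<partial>lborel) \<partial>lborel)"
    by (simp add: z wigner_symbol_def delta_op_def P_def tensor_def A_def u_def w_def c_def mult.commute
      flip: integral_mult_right_zero)
  also have "\<dots> = (\<integral>y. (\<integral>s. P (s, y) \<partial>lborel) \<partial>lborel)"
    by (rule integral_swap_schwartz[OF P, symmetric])
  also have "\<dots> = (\<integral>y. (w y * cis (- 2 * pi * (y \<bullet> (a - b)))) * wigner_symbol F z \<partial>lborel)"
  proof (rule Bochner_Integration.integral_cong[OF refl])
    fix y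
    have m: "(\<lambda>x. u x * cis (2 * pi * (x \<bullet> (a - b)))) \<in> borel_measurable borel"
      by (intro schwartz_borel_measurable schwartz_mult_cis u)
    have "P (s, y) = (w y * cis (- 2 * pi * (y \<bullet> (a - b)))) * (u (y + s) * cis (2 * pi * ((y + s) \<bullet> (a - b))))" for s
    proof -
      have "cis (2 * pi * (s \<bullet> (a - b))) = cis (- 2 * pi * (y \<bullet> (a - b))) * cis (2 * pi * ((y + s) \<bullet> (a - b)))"
        by (simp add: cis_mult inner_add_left distrib_left)
      then show ?thesis
        by (simp add: P_def tensor_def A_def mult_ac)
    qed
    then have "(\<integral>s. P (s, y) \<partial>lborel) = (w y * cis (- 2 * pi * (y \<bullet> (a - b)))) * (\<integral>s. u (y + s) * cis (2 * pi * ((y + s) \<bullet> (a - b))) \<partial>lborel)"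
      by (simp only: integral_mult_right_zero)
    also have "(\<integral>s. u (y + s) * cis (2 * pi * ((y + s) \<bullet> (a - b))) \<partial>lborel) = wigner_symbol F z"
      unfolding integral_lborel_translate[OF m, of y] by (simp add: z wigner_symbol_def u_def c_def)
    finally show "(\<integral>s. P (s, y) \<partial>lborel) = (w y * cis (- 2 * pi * (y \<bullet> (a - b)))) * wigner_symbol F z" .
  qed
  also have "\<dots> = fourier w (a - b) * wigner_symbol F z"
    unfolding fourier_def by (rule integral_mult_left_zero)
  also have "fourier w (a - b) = tensor (fourier f) (\<lambda>\<xi>. cnj (fourier g \<xi>)) z"
    unfolding w_def c_def fourier_wigner[OF f g] by (simp add: z tensor_def)
  finally show "wigner_symbol (delta_op (tensor F (wigner f g))) z =
    tensor (fourier f) (\<lambda>\<xi>. cnj (fourier g \<xi>)) z * wigner_symbol F z" .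
qed

text \<open>On tensor products each multiplier contributes a factor in its own variable:
  \<open>fourier f\<close> in the first and, because of the conjugation, the conjugate of
  \<open>fourier g\<close> in the second.\<close>

lemma wigner_distr_fourier_multiplier:
  fixes F :: "'a::euclidean_space \<times> 'a \<Rightarrow> complex"
  assumes \<sigma>: "tempered \<sigma>" and f: "f \<in> schwartz" and g: "g \<in> schwartz" and F: "F \<in> schwartz"
  shows "wigner_distr (fourier_multiplier \<sigma> f) (fourier_multiplier \<sigma> g) F =
    tensor_distr \<sigma> (cnj_distr \<sigma>) (\<lambda>z. tensor (fourier f) (\<lambda>\<xi>. cnj (fourier g \<xi>)) z * wigner_symbol F z)"
proof -
  let ?u = "fourier_multiplier \<sigma> f" and ?v = "fourier_multiplier \<sigma> g"
  let ?m = "tensor (fourier f) (\<lambda>\<xi>. cnj (fourier g \<xi>))"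
  have m: "?m \<in> moderate" "fourier f \<in> moderate" "(\<lambda>\<xi>. cnj (fourier g \<xi>)) \<in> moderate"
    by (intro schwartz_moderate tensor_schwartz schwartz_cnj fourier_schwartz f g)+
  have uv: "tempered ?u" "tempered ?v"
    by (intro tempered_fourier_multiplier \<sigma> f g)+
  have "tensor_distr ?u (cnj_distr ?v) G = tensor_distr \<sigma> (cnj_distr \<sigma>) (\<lambda>z. ?m z * fourier_mixed G z)"
    if "G \<in> schwartz" for G
  proof (rule tempered_eq_if_eq_on_tensors[OF _ _ _ that])
    show "tempered (tensor_distr ?u (cnj_distr ?v))"
      by (intro tempered_tensor_distr tempered_cnj_distr uv)
    show "tempered (\<lambda>G. tensor_distr \<sigma> (cnj_distr \<sigma>) (\<lambda>z. ?m z * fourier_mixed G z))"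
      by (rule tempered_compose[OF _ schwartz_op_compose[OF schwartz_op_mult[OF m(1)] schwartz_op_fourier_mixed]])
        (intro tempered_tensor_distr tempered_cnj_distr \<sigma>)
    fix \<phi> \<psi> :: "'a \<Rightarrow> complex" assume \<phi>: "\<phi> \<in> schwartz" and \<psi>: "\<psi> \<in> schwartz"
    have "(\<lambda>z. ?m z * fourier_mixed (tensor \<phi> \<psi>) z) =
      tensor (\<lambda>\<xi>. fourier f \<xi> * inv_fourier \<phi> \<xi>) (\<lambda>\<xi>. cnj (fourier g \<xi>) * fourier \<psi> \<xi>)"
      unfolding fourier_mixed_tensor by (simp add: tensor_def mult_ac)
    moreover have "(\<lambda>\<xi>. fourier f \<xi> * inv_fourier \<phi> \<xi>) \<in> schwartz" "(\<lambda>\<xi>. cnj (fourier g \<xi>) * fourier \<psi> \<xi>) \<in> schwartz"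
      by (intro schwartz_mult m inv_fourier_schwartz fourier_schwartz \<phi> \<psi>)+
    ultimately show "tensor_distr ?u (cnj_distr ?v) (tensor \<phi> \<psi>) =
      tensor_distr \<sigma> (cnj_distr \<sigma>) (\<lambda>z. ?m z * fourier_mixed (tensor \<phi> \<psi>) z)"
      by (simp add: tensor_distr_tensor \<sigma> uv tempered_cnj_distr \<phi> \<psi> cnj_distr_fourier_multiplier)
        (simp add: fourier_multiplier_eq)
  qed
  then show ?thesis
    unfolding wigner_distr_eq
    by (simp add: midpoint_pullback_schwartz fourier2_schwartz F fourier_mixed_midpoint)
qed

lemma wigner_kernel_identity_fourier_multiplier:
  fixes \<sigma> :: "'a::euclidean_space distr"
  assumes \<sigma>: "tempered \<sigma>"
  shows "wigner_kernel_identity (fourier_multiplier \<sigma>)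
    (delta_kernel (wigner_distr (inv_fourier_distr \<sigma>) (inv_fourier_distr \<sigma>)))"
  unfolding wigner_kernel_identity_def distr_eq_def
proof (intro ballI)
  fix f g :: "'a \<Rightarrow> complex" and F :: "'a \<times> 'a \<Rightarrow> complex"
  assume f: "f \<in> schwartz" and g: "g \<in> schwartz" and F: "F \<in> schwartz"
  let ?E = "inv_fourier_distr \<sigma>"
  have "kernel_apply (delta_kernel (wigner_distr ?E ?E)) (wigner f g) F =
    wigner_distr ?E ?E (delta_op (tensor F (wigner f g)))"
    by (simp add: kernel_apply_def delta_kernel_eq tensor_def case_prod_unfold)
  also have "\<dots> = tensor_distr \<sigma> (cnj_distr \<sigma>) (wigner_symbol (delta_op (tensor F (wigner f g))))"
    by (intro wigner_distr_inv_fourier_distr \<sigma> schwartz_opD(1)[OF schwartz_op_delta_op] tensor_schwartz F wigner_schwartz f g)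
  also have "\<dots> = wigner_distr (fourier_multiplier \<sigma> f) (fourier_multiplier \<sigma> g) F"
    unfolding wigner_symbol_delta_op[OF F f g] by (rule wigner_distr_fourier_multiplier[OF \<sigma> f g F, symmetric])
  finally show "wigner_distr (fourier_multiplier \<sigma> f) (fourier_multiplier \<sigma> g) F =
    kernel_apply (delta_kernel (wigner_distr ?E ?E)) (wigner f g) F"
    by simp
qed

text \<open>
  Uniqueness holds for every operator: Wigner functions of pairs are the images of tensor products
  under an isomorphism of the Schwartz space.
\<close>

lemma wigner_kernel_unique:
  fixes k k' :: "(('a::euclidean_space \<times> 'a) \<times> ('a \<times> 'a)) distr"
  assumes k: "tempered k" "wigner_kernel_identity T k"
    and k': "tempered k'" "wigner_kernel_identity T k'"
  shows "distr_eq k' k"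
proof -
  have eq1: "k' (tensor F (fourier2 (midpoint_pushforward H))) = k (tensor F (fourier2 (midpoint_pushforward H)))"
    if F: "F \<in> schwartz" and H: "H \<in> schwartz" for F H :: "'a \<times> 'a \<Rightarrow> complex"
  proof (rule tempered_eq_if_eq_on_tensors[OF _ _ _ H])
    have op: "schwartz_op (\<lambda>H. tensor F (fourier2 (midpoint_pushforward H)))"
      by (intro schwartz_op_compose[OF schwartz_op_tensor_right[OF F]]
        schwartz_op_compose[OF schwartz_op_fourier2 schwartz_op_midpoint_pushforward])
    show "tempered (\<lambda>H. k' (tensor F (fourier2 (midpoint_pushforward H))))"
      "tempered (\<lambda>H. k (tensor F (fourier2 (midpoint_pushforward H))))"
      by (intro tempered_compose[OF _ op] k k')+
    fix f g :: "'a \<Rightarrow> complex" assume f: "f \<in> schwartz" and g: "g \<in> schwartz"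
    \<comment> \<open>The Wigner transform conjugates its second argument, so
      \<open>tensor f g\<close> comes from the pair of \<open>f\<close> and the conjugate of
      \<open>g\<close>.\<close>
    have eq: "K (tensor F (fourier2 (midpoint_pushforward (tensor f g)))) =
      wigner_distr (T f) (T (\<lambda>x. cnj (g x))) F" if "wigner_kernel_identity T K" for K
      using that f schwartz_cnj[OF g] F
      by (auto simp: wigner_kernel_identity_def distr_eq_def kernel_apply_def wigner_eq tensor_def case_prod_unfold)
    show "k' (tensor F (fourier2 (midpoint_pushforward (tensor f g)))) =
      k (tensor F (fourier2 (midpoint_pushforward (tensor f g))))"
      using eq[OF k(2)] eq[OF k'(2)] by simp
  qed
  have surj: "\<exists>H\<in>schwartz. fourier2 (midpoint_pushforward H) = G" if G: "G \<in> schwartz" for G :: "'a \<times> 'a \<Rightarrow> complex"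
  proof
    \<comment> \<open>A reflected \<open>fourier2\<close> is the inverse partial transform, and
      \<open>midpoint_pullback\<close> is a right inverse of \<open>midpoint_pushforward\<close>;
      together they give a preimage of \<open>G\<close>.\<close>
    define I where "I = (\<lambda>(x, y). fourier2 G (x, - y))"
    have I: "I \<in> schwartz"
    proof -
      have "linear (\<lambda>z :: 'a \<times> 'a. (fst z, - snd z))" "inj (\<lambda>z :: 'a \<times> 'a. (fst z, - snd z))"
        by (auto intro!: linearI injI)
      from schwartz_compose_linear[OF fourier2_schwartz[OF G] this] show ?thesis
        by (simp add: I_def case_prod_unfold)
    qed
    show "midpoint_pullback I \<in> schwartz"
      by (rule midpoint_pullback_schwartz[OF I])
    have "(\<lambda>y. I (x, y)) = inv_fourier (\<lambda>\<xi>. G (x, \<xi>))" for x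
      by (simp add: I_def fourier2_def inv_fourier_eq fun_eq_iff)
    then have "fourier2 I = G"
      using fourier_inv_fourier[OF slice_schwartz[OF G]] by (auto simp: fourier2_def fun_eq_iff)
    then show "fourier2 (midpoint_pushforward (midpoint_pullback I)) = G"
      by (simp add: midpoint_pushforward_pullback)
  qed
  have "k' (tensor F G) = k (tensor F G)" if "F \<in> schwartz" "G \<in> schwartz" for F G
    using surj[OF that(2)] eq1[OF that(1)] by metis
  then show ?thesis
    using tempered_eq_if_eq_on_tensors[OF k'(1) k(1)] by (simp add: distr_eq_def)
qed

text \<open>Being a Wigner kernel depends only on the values on Schwartz functions. Stated for every
  \<open>k\<close> that agrees there with the canonical kernel, so that one statement serves both
  formulas of the theorem.\<close>

lemma is_wigner_kernel_fourier_multiplier: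
  fixes \<sigma> :: "'a::euclidean_space distr"
  assumes \<sigma>: "tempered \<sigma>"
    and k: "distr_eq k (delta_kernel (wigner_distr (inv_fourier_distr \<sigma>) (inv_fourier_distr \<sigma>)))"
  shows "is_wigner_kernel (fourier_multiplier \<sigma>) k"
proof -
  let ?E = "inv_fourier_distr \<sigma>"
  let ?k = "delta_kernel (wigner_distr ?E ?E)"
  have "tempered ?k"
    by (intro tempered_delta_kernel tempered_wigner_distr tempered_inv_fourier_distr \<sigma>)
  then have k1: "tempered k"
    using k by (auto intro: tempered_cong simp: distr_eq_def)
  have "kernel_apply k (wigner f g) F = kernel_apply ?k (wigner f g) F"
    if "f \<in> schwartz" "g \<in> schwartz" "F \<in> schwartz" for f g F
    using k tensor_schwartz[OF that(3) wigner_schwartz[OF that(1,2)]]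
    by (simp add: kernel_apply_def distr_eq_def tensor_def case_prod_unfold)
  then have k2: "wigner_kernel_identity (fourier_multiplier \<sigma>) k"
    using wigner_kernel_identity_fourier_multiplier[OF \<sigma>]
    by (simp add: wigner_kernel_identity_def distr_eq_def)
  show ?thesis
    unfolding is_wigner_kernel_def
    using continuous_linear_operator_fourier_multiplier[OF \<sigma>] k1 k2 wigner_kernel_unique[OF k1 k2] by blast
qed

text \<open>The transpose of the convolution sends \<open>\<phi>\<close> to the correlation
  \<open>integral_fst P\<close>. After substituting \<open>u = x - y\<close> its inverse Fourier
  transform is \<open>fourier f * inv_fourier \<phi>\<close>, the function that
  \<open>\<sigma>\<close> receives from the multiplier.\<close>

lemma fourier_multiplier_eq_conv_distr:
  fixes f \<phi> :: "'a::euclidean_space \<Rightarrow> complex"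
  assumes E: "distr_eq E (inv_fourier_distr \<sigma>)" and f: "f \<in> schwartz" and \<phi>: "\<phi> \<in> schwartz"
  shows "fourier_multiplier \<sigma> f \<phi> = conv_distr E f \<phi>"
proof -
  define A where "A = (\<lambda>z :: 'a \<times> 'a. (fst z - snd z, fst z))"
  have A: "linear A" "inj A"
    by (auto intro!: linearI injI simp: A_def algebra_simps)
  define P where "P = (\<lambda>z. tensor f \<phi> (A z))"
  have P: "P \<in> schwartz"
    unfolding P_def by (intro schwartz_compose_linear[OF _ A] tensor_schwartz f \<phi>)
  have "inv_fourier (integral_fst P) \<xi> = fourier f \<xi> * inv_fourier \<phi> \<xi>" for \<xi>
  proof -
    define Q where "Q = (\<lambda>z. cis (2 * pi * (snd z \<bullet> \<xi>)) * P z)"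
    have Q: "Q \<in> schwartz"
      unfolding Q_def by (intro schwartz_mult moderate_cis_linear bounded_linear_snd P)
    have "inv_fourier (integral_fst P) \<xi> = (\<integral>y. (\<integral>x. Q (x, y) \<partial>lborel) \<partial>lborel)"
      by (simp add: inv_fourier_def integral_fst_def Q_def inner_commute mult.commute flip: integral_mult_right_zero)
    also have "\<dots> = (\<integral>x. (\<integral>y. Q (x, y) \<partial>lborel) \<partial>lborel)"
      by (rule integral_swap_schwartz[OF Q])
    also have "\<dots> = (\<integral>x. fourier f \<xi> * (\<phi> x * cis (2 * pi * (\<xi> \<bullet> x))) \<partial>lborel)"
    proof (rule Bochner_Integration.integral_cong[OF refl])
      fix x
      have "(\<integral>y. Q (x, y) \<partial>lborel) = (\<integral>u. Q (x, x - u) \<partial>lborel)"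
        using integral_lborel_affine[OF schwartz_borel_measurable[OF slice_schwartz[OF Q, of x]], of "-1" x] by simp
      also have "\<dots> = (\<integral>u. (\<phi> x * cis (2 * pi * (\<xi> \<bullet> x))) * (f u * cis (- 2 * pi * (u \<bullet> \<xi>))) \<partial>lborel)"
      proof (rule Bochner_Integration.integral_cong[OF refl])
        fix u
        have "cis (2 * pi * ((x - u) \<bullet> \<xi>)) = cis (2 * pi * (\<xi> \<bullet> x)) * cis (- 2 * pi * (u \<bullet> \<xi>))"
          by (simp add: cis_mult inner_diff_left inner_commute[of \<xi>] right_diff_distrib)
        then show "Q (x, x - u) = (\<phi> x * cis (2 * pi * (\<xi> \<bullet> x))) * (f u * cis (- 2 * pi * (u \<bullet> \<xi>)))"
          by (simp add: Q_def P_def A_def tensor_def mult_ac)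
      qed
      also have "\<dots> = (\<phi> x * cis (2 * pi * (\<xi> \<bullet> x))) * fourier f \<xi>"
        unfolding fourier_def by (rule integral_mult_right_zero)
      finally show "(\<integral>y. Q (x, y) \<partial>lborel) = fourier f \<xi> * (\<phi> x * cis (2 * pi * (\<xi> \<bullet> x)))"
        by (simp add: mult.commute)
    qed
    also have "\<dots> = fourier f \<xi> * inv_fourier \<phi> \<xi>"
      unfolding inv_fourier_def by (rule integral_mult_right_zero)
    finally show ?thesis .
  qed
  then have "inv_fourier (integral_fst P) = (\<lambda>\<xi>. fourier f \<xi> * inv_fourier \<phi> \<xi>)"
    by (rule ext)
  then have "\<sigma> (inv_fourier (integral_fst P)) = fourier_multiplier \<sigma> f \<phi>"
    by (simp only: fourier_multiplier_eq)
  moreover have "E (integral_fst P) = \<sigma> (inv_fourier (integral_fst P))"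
    using E schwartz_opD(1)[OF schwartz_op_integral_fst P] by (simp add: distr_eq_def inv_fourier_distr_def)
  moreover have "conv_distr E f \<phi> = E (integral_fst P)"
    by (simp add: conv_distr_def integral_fst_def P_def A_def tensor_def)
  ultimately show ?thesis
    by simp
qed

theorem theorem3p3:
  fixes t :: real
    and \<sigma> E :: "real \<Rightarrow> (real ^ 'd) distr"
  assumes "tempered (\<sigma> t)"
    and "distr_eq (E t) (inv_fourier_distr (\<sigma> t))"
  shows "tempered (E t) \<and>
    (\<forall>f \<in> schwartz. distr_eq (fourier_multiplier (\<sigma> t) f) (conv_distr (E t) f)) \<and>
    is_wigner_kernel (fourier_multiplier (\<sigma> t))
      (delta_kernel (swap_reflect_distr (wigner_distr (\<sigma> t) (\<sigma> t)))) \<and>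
    is_wigner_kernel (fourier_multiplier (\<sigma> t))
      (delta_kernel (wigner_distr (E t) (E t))) \<and>
    distr_eq (delta_kernel (swap_reflect_distr (wigner_distr (\<sigma> t) (\<sigma> t))))
      (delta_kernel (wigner_distr (E t) (E t)))"
proof -
  let ?E = "inv_fourier_distr (\<sigma> t)"
  let ?k = "delta_kernel (wigner_distr ?E ?E)"
  have E: "tempered ?E"
    by (rule tempered_inv_fourier_distr[OF assms(1)])
  have \<Delta>: "delta_op F \<in> schwartz" if "F \<in> schwartz" for F :: "((real ^ 'd) \<times> (real ^ 'd)) \<times> ((real ^ 'd) \<times> (real ^ 'd)) \<Rightarrow> complex"
    by (rule schwartz_opD(1)[OF schwartz_op_delta_op that])
  have 1: "distr_eq (delta_kernel (swap_reflect_distr (wigner_distr (\<sigma> t) (\<sigma> t)))) ?k"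
    by (simp add: distr_eq_def delta_kernel_eq \<Delta> wigner_distr_swap_reflect wigner_distr_inv_fourier_distr assms(1))
  \<comment> \<open>The distributions \<open>E t\<close> and \<open>?E\<close> agree on Schwartz
    functions only, so their Wigner distributions are compared on Schwartz arguments.\<close>
  have "wigner_distr (E t) (E t) F = wigner_distr ?E ?E F" if "F \<in> schwartz" for F
    unfolding wigner_distr_eq
    by (intro tensor_distr_cong cnj_distr_cong assms(2) tempered_cnj_distr E midpoint_pullback_schwartz
      fourier2_schwartz that)
  then have 2: "distr_eq (delta_kernel (wigner_distr (E t) (E t))) ?k"
    by (simp add: distr_eq_def delta_kernel_eq \<Delta>)
  have 3: "tempered (E t)"
    using assms(2) by (intro tempered_cong[OF E]) (simp add: distr_eq_def)
  show ?thesis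
    using 1 2 3 is_wigner_kernel_fourier_multiplier[OF assms(1)] fourier_multiplier_eq_conv_distr[OF assms(2)]
    by (simp add: distr_eq_def)
qed

end
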